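(* Let $W=\{W(h):h\in\mathfrak{H}\}$ be an isonormal Gaussian process over a real separable Hilbert space $\mathfrak{H}$, defined on a probability space $(\Omega,\mathscr{F},\mathbb{P})$. Fix an integer $q\geq 2$ and let $\{F_n,n\geq 1\}$ be a sequence of random variables in $\bigoplus_{p=0}^{q}\mathbb{C}^W_p$ (the sum of the first $q$ Gaussian Wiener chaoses associated to $W$, together with the constants) such that, as $n\to+\infty$, $F_n$ converges almost surely to some random variable $F$. Then $F$ belongs to $\bigoplus_{p=0}^{q}\mathbb{C}^W_p$. Moreover, for each $p\in\{0,\dots,q\}$, $J_p(F_n)$ converges almost surely to $J_p(F)$ as $n\to+\infty$.
   Context: An isonormal Gaussian process over $\mathfrak{H}$ is a centered Gaussian family $\{W(h):h\in\mathfrak{H}\}$ with $\mathbb{E}[W(h)W(g)]=\langle h,g\rangle_{\mathfrak{H}}$. Let $H_p(x)=(-1)^p e^{x^2/2}\frac{d^p}{dx^p}e^{-x^2/2}$ be the $p$th Hermite polynomial and $\{e_i:i\in\mathbb{N}\}$ an orthonormal basis of $\mathfrak{H}$. The Gaussian Wiener chaos $\mathbb{C}^W_0=\mathbb{R}$ (constants), and for $p\ge1$ the $p$th Gaussian Wiener chaos $\mathbb{C}^W_p$ is the closed subspace of $L^2(\Omega,\sigma\{W\},\mathbb{P})$ having as complete orthonormal system $\{\prod_{i\in\mathbb{N}} H_{a_i}(W(e_i))/\sqrt{a_i!}: a_i\in\mathbb{N}\cup\{0\},\ \sum_i a_i=p\}$. One has the orthogonal decomposition $L^2(\Omega,\sigma\{W\},\mathbb{P})=\bigoplus_{p=0}^\infty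 \mathbb{C}^W_p$, and $J_p$ denotes the orthogonal projection onto $\mathbb{C}^W_p$. *)

theory Defs
  imports "HOL-Probability.Probability"
begin

definition hermite :: "nat \<Rightarrow> real \<Rightarrow> real" where
  "hermite p x = (-1) ^ p * exp (x\<^sup>2 / 2) * (deriv ^^ p) (\<lambda>y. exp (- (y\<^sup>2) / 2)) x"

text \<open>A real random variable is Gaussian (possibly degenerate) iff its characteristic
  function is that of N(mu, sigma^2) for some mu, sigma.\<close>
definition gaussian_rv :: "'w measure \<Rightarrow> ('w \<Rightarrow> real) \<Rightarrow> bool" where
  "gaussian_rv M X \<longleftrightarrow> X \<in> borel_measurable M \<and>
     (\<exists>mu sigma::real. \<forall>t. char (distr M borel X) t
        = iexp (mu * t) * complex_of_real (exp (- (sigma\<^sup>2 * t\<^sup>2) / 2)))"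

definition isonormal :: "'w measure \<Rightarrow> ('h::real_inner \<Rightarrow> 'w \<Rightarrow> real) \<Rightarrow> bool" where
  "isonormal M W \<longleftrightarrow>
     (\<forall>h. W h \<in> borel_measurable M) \<and>
     (\<forall>(n::nat) (c::nat \<Rightarrow> real) (hs::nat \<Rightarrow> 'h).
        gaussian_rv M (\<lambda>w. \<Sum>i<n. c i * W (hs i) w)) \<and>
     (\<forall>h. integrable M (W h) \<and> (\<integral>w. W h w \<partial>M) = 0) \<and>
     (\<forall>h g. integrable M (\<lambda>w. W h w * W g w) \<and> (\<integral>w. W h w * W g w \<partial>M) = inner h g)"

definition countable_onb :: "'h::real_inner set \<Rightarrow> bool" where
  "countable_onb B \<longleftrightarrow> countable B \<and> (\<forall>e\<in>B. norm e = 1) \<and>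
     (\<forall>e\<in>B. \<forall>f\<in>B. e \<noteq> f \<longrightarrow> inner e f = 0) \<and> closure (span B) = UNIV"

definition multi_indices :: "'h set \<Rightarrow> nat \<Rightarrow> ('h \<Rightarrow> nat) set" where
  "multi_indices B p = {a. finite {e. a e \<noteq> 0} \<and> {e. a e \<noteq> 0} \<subseteq> B \<and>
                           (\<Sum>e\<in>{e. a e \<noteq> 0}. a e) = p}"

definition chaos_elem :: "('h \<Rightarrow> 'w \<Rightarrow> real) \<Rightarrow> ('h \<Rightarrow> nat) \<Rightarrow> 'w \<Rightarrow> real" where
  "chaos_elem W a w = (\<Prod>e\<in>{e. a e \<noteq> 0}. hermite (a e) (W e w) / sqrt (fact (a e)))"

definition chaos_span :: "('h \<Rightarrow> 'w \<Rightarrow> real) \<Rightarrow> 'h set \<Rightarrow> nat \<Rightarrow> ('w \<Rightarrow> real) set" where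
  "chaos_span W B p = {Y. \<exists>A c. finite A \<and> A \<subseteq> multi_indices B p \<and>
                          Y = (\<lambda>w. \<Sum>a\<in>A. c a * chaos_elem W a w)}"

text \<open>p-th Wiener chaos: the closed subspace of L^2 spanned by the orthonormal system,
  represented by the (a.e.-closed) set of square-integrable representatives that are
  L^2-limits of finite linear combinations.\<close>
definition wiener_chaos :: "'w measure \<Rightarrow> ('h \<Rightarrow> 'w \<Rightarrow> real) \<Rightarrow> 'h set \<Rightarrow> nat \<Rightarrow> ('w \<Rightarrow> real) set" where
  "wiener_chaos M W B p = {X. X \<in> borel_measurable M \<and> integrable M (\<lambda>w. (X w)\<^sup>2) \<and>
     (\<exists>Y. (\<forall>k. Y k \<in> chaos_span W B p) \<and>
          (\<lambda>k. \<integral>w. (X w - Y k w)\<^sup>2 \<partial>M) \<longlonglongrightarrow> 0)}"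

definition chaos_upto :: "'w measure \<Rightarrow> ('h \<Rightarrow> 'w \<Rightarrow> real) \<Rightarrow> 'h set \<Rightarrow> nat \<Rightarrow> ('w \<Rightarrow> real) set" where
  "chaos_upto M W B q = {X. X \<in> borel_measurable M \<and>
     (\<exists>Xs. (\<forall>p\<le>q. Xs p \<in> wiener_chaos M W B p) \<and> (AE w in M. X w = (\<Sum>p\<le>q. Xs p w)))}"

text \<open>J_p: orthogonal projection (in L^2) onto the p-th chaos; a representative is chosen.\<close>
definition chaos_proj :: "'w measure \<Rightarrow> ('h \<Rightarrow> 'w \<Rightarrow> real) \<Rightarrow> 'h set \<Rightarrow> nat \<Rightarrow> ('w \<Rightarrow> real) \<Rightarrow> ('w \<Rightarrow> real)" where
  "chaos_proj M W B p X = (SOME Y. Y \<in> wiener_chaos M W B p \<and>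
     (\<forall>Z\<in>wiener_chaos M W B p. (\<integral>w. (X w - Y w) * Z w \<partial>M) = 0))"

end

theory Submission
  imports Defs "HOL-Computational_Algebra.Polynomial"
begin

text \<open>Up to an almost surely vanishing error, each \<open>F\<^sub>n\<close> is a finite chaos expansion in independent
  standard normal variables. If such expansions of degree at most \<open>q\<close> converge almost surely, then
  so do their rotations \<open>F\<^sub>n(c W + s W')\<close> with \<open>c\<^sup>2 + s\<^sup>2 = 1\<close> and \<open>W'\<close> an independent copy of \<open>W\<close>. For almost
  every fixed \<open>W\<close> these are polynomials of degree at most \<open>q\<close> in \<open>W'\<close>, for which hypercontractivity
  upgrades convergence in probability to convergence in \<open>L\<^sup>2\<close>; so the expectations over \<open>W'\<close>
  converge. By Mehler's formula these are \<open>\<Sum>\<^sub>p c\<^sup>p J\<^sub>p F\<^sub>n\<close>, and letting \<open>c\<close> vary gives the convergence of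
  every \<open>J\<^sub>p F\<^sub>n\<close>; the limits stay in the chaoses, again by the \<open>L\<^sup>2\<close> upgrade.\<close>

subsection \<open>Hermite polynomials under the normal distribution\<close>

text \<open>The projections J_p are continuous in \<open>L\<^sup>2\<close> but not pathwise: the
  \<open>L\<^sup>2\<close> upgrade alone would give \<open>L\<^sup>2\<close> convergence of
  J_p(F_n), hence almost sure convergence only along subsequences. What is wanted is an operator
  that separates the chaoses and can be evaluated at one sample point at a time. Averaging over an
  independent copy is such an operator, since Fubini lets the original copy be frozen outside a null
  set. A frozen point mixes the degrees, so the moment estimates are proved for all combinations of
  degree at most q at once, with constants that depend neither on the number of variables nor on the
  coefficients. An element of a closed chaos is an \<open>L\<^sup>2\<close> limit and cannot be
  evaluated at a rotated process; it is replaced by an element of the span with squared error at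
  most (1/2)^n, and summability is what makes these errors vanish almost surely. The parameters c =
  2^-k suffice to separate q + 1 chaoses and are countable, so their exceptional null sets can be
  united.\<close>

fun hpoly :: "nat \<Rightarrow> real poly" where
  "hpoly 0 = 1"
| "hpoly (Suc n) = [:0, 1:] * hpoly n - pderiv (hpoly n)"

text \<open>The recursion of \<open>hpoly\<close> is the product rule: differentiating P(x)
  exp(-x^2/2) replaces P by P' - x P, and the alternating sign turns this into x P - P'.\<close>

lemma deriv_iterate_gaussian:
  "(deriv ^^ p) (\<lambda>y::real. exp (- (y\<^sup>2) / 2)) = (\<lambda>x. (-1) ^ p * poly (hpoly p) x * exp (- (x\<^sup>2) / 2))"
proof (induction p)
  case (Suc p)
  have "((\<lambda>x. (-1) ^ p * poly (hpoly p) x * exp (- (x\<^sup>2) / 2)) has_real_derivative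
         (-1) ^ Suc p * poly (hpoly (Suc p)) x * exp (- (x\<^sup>2) / 2)) (at x)" for x :: real
    by (auto intro!: derivative_eq_intros simp: field_simps)
  then have "deriv (\<lambda>x. (-1) ^ p * poly (hpoly p) x * exp (- (x\<^sup>2) / 2)) x =
      (-1) ^ Suc p * poly (hpoly (Suc p)) x * exp (- (x\<^sup>2) / 2)" for x :: real
    by (rule DERIV_imp_deriv)
  then show ?case
    unfolding funpow.simps o_def Suc.IH by (rule ext)
qed simp

lemma hermite_eq_poly: "hermite p x = poly (hpoly p) x"
proof -
  have "(-1) ^ p * (-1) ^ p = (1::real)"
    by (simp flip: power_mult_distrib)
  moreover have "exp (x\<^sup>2 / 2) * exp (- (x\<^sup>2) / 2) = 1"
    by (simp flip: exp_add)
  moreover have "a * b * (a * c * d) = (a * a) * (b * d) * c" for a b c d :: real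
    by (simp add: mult_ac)
  ultimately show ?thesis
    unfolding hermite_def deriv_iterate_gaussian by (metis mult_1)
qed

text \<open>Differentiating the recursion leaves one copy of \<open>hpoly (Suc n)\<close> plus x Q -
  Q' for Q the derivative of \<open>hpoly (Suc n)\<close>. By induction Q is a multiple of
  \<open>hpoly n\<close>, so x Q - Q' is again the recursion and contributes the other n + 1
  copies.\<close>

lemma pderiv_hpoly_Suc: "pderiv (hpoly (Suc n)) = smult (of_nat (Suc n)) (hpoly n)"
proof (induction n)
  case 0
  show ?case by (simp add: pderiv_mult pderiv_pCons)
next
  case (Suc n)
  have "pderiv (hpoly (Suc (Suc n))) = hpoly (Suc n) + [:0, 1:] * pderiv (hpoly (Suc n)) - pderiv (pderiv (hpoly (Suc n)))"
    by (simp only: hpoly.simps(2)[of "Suc n"] pderiv_diff pderiv_mult) (simp add: pderiv_pCons)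
  also have "\<dots> = hpoly (Suc n) + smult (of_nat (Suc n)) ([:0, 1:] * hpoly n - pderiv (hpoly n))"
    by (simp only: Suc.IH pderiv_smult smult_diff_right mult_smult_right add_diff_eq)
  also have "\<dots> = smult (of_nat (Suc (Suc n))) (hpoly (Suc n))"
    by (simp only: hpoly.simps(2)[of n, symmetric] of_nat_Suc smult_add_left smult_1_left add.commute)
  finally show ?case .
qed

lemma degree_hpoly: "degree (hpoly n) = n \<and> lead_coeff (hpoly n) = 1"
proof (induction n)
  case (Suc n)
  then have "hpoly n \<noteq> 0" by auto
  then have a: "degree ([:0, 1:] * hpoly n) = Suc n"
    using Suc by (simp add: degree_mult_eq)
  have b: "degree (pderiv (hpoly n)) < Suc n"
    using Suc by (simp add: degree_pderiv)
  have d: "degree (hpoly (Suc n)) = Suc n"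
    using degree_add_eq_left[of "- pderiv (hpoly n)" "[:0, 1:] * hpoly n"] a b by simp
  have "coeff (hpoly n) n = 1" using Suc by auto
  then have "coeff (hpoly (Suc n)) (Suc n) = 1"
    using b by (simp add: coeff_eq_0)
  then show ?case using d by simp
qed simp

definition hnorm :: "nat \<Rightarrow> real \<Rightarrow> real" where
  "hnorm n x = hermite n x / sqrt (fact n)"

lemma hnorm_eq_poly: "hnorm n x = poly (smult (1 / sqrt (fact n)) (hpoly n)) x"
  by (simp add: hnorm_def hermite_eq_poly)

lemma hnorm_0 [simp]: "hnorm 0 x = 1"
  by (simp add: hnorm_def hermite_eq_poly)

text \<open>The Hermite polynomials form a triangular basis: \<open>hpoly (Suc n)\<close> is monic
  of degree \<open>Suc n\<close>, so subtracting a multiple of it removes the top coefficient and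
  the induction hypothesis takes the rest.\<close>

lemma poly_hnorm_expansion:
  fixes P :: "real poly"
  assumes "degree P \<le> n"
  shows "\<exists>b. \<forall>x. poly P x = (\<Sum>i\<le>n. b i * hnorm i x)"
  using assms
proof (induction n arbitrary: P)
  case 0
  then obtain c where "P = [:c:]" by (meson le_zero_eq degree_eq_zeroE)
  then show ?case by (intro exI[of _ "\<lambda>_. c"]) simp
next
  case (Suc n)
  define Q where "Q = P - smult (coeff P (Suc n)) (hpoly (Suc n))"
  have "degree Q \<le> n"
  proof (rule degree_le, intro allI impI)
    fix i assume "n < i"
    show "coeff Q i = 0"
    proof (cases "i = Suc n")
      case True
      have "coeff (hpoly (Suc n)) (Suc n) = 1" using degree_hpoly[of "Suc n"] by metis
      then show ?thesis using True by (simp add: Q_def del: hpoly.simps)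
    next
      case False
      then have "Suc n < i" using \<open>n < i\<close> by simp
      then show ?thesis
        using degree_hpoly[of "Suc n"] Suc.prems by (simp add: Q_def coeff_eq_0 del: hpoly.simps)
    qed
  qed
  from Suc.IH[OF this] obtain b where b: "\<And>x. poly Q x = (\<Sum>i\<le>n. b i * hnorm i x)" by blast
  define b' where "b' = b(Suc n := coeff P (Suc n) * sqrt (fact (Suc n)))"
  have "poly P x = (\<Sum>i\<le>Suc n. b' i * hnorm i x)" for x
  proof -
    have "poly P x = poly Q x + coeff P (Suc n) * poly (hpoly (Suc n)) x"
      by (simp add: Q_def del: hpoly.simps)
    also have "coeff P (Suc n) * poly (hpoly (Suc n)) x = b' (Suc n) * hnorm (Suc n) x"
      by (simp add: b'_def hnorm_def hermite_eq_poly del: hpoly.simps fact_Suc)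
    also have "poly Q x = (\<Sum>i\<le>n. b' i * hnorm i x)"
      unfolding b by (intro sum.cong) (auto simp: b'_def)
    finally show ?thesis by simp
  qed
  then show ?case by blast
qed

text \<open>Requiring every power to be integrable gives a class closed under sums and products,
  unlike square integrability. All polynomial integrands below, up to fourth powers of sums of
  products, then get their integrability from structural rules.\<close>

definition has_moments :: "'w measure \<Rightarrow> ('w \<Rightarrow> real) \<Rightarrow> bool" where
  "has_moments M f \<longleftrightarrow> f \<in> borel_measurable M \<and> (\<forall>k::nat. integrable M (\<lambda>x. f x ^ k))"

lemma has_moments_measurable: "has_moments M f \<Longrightarrow> f \<in> borel_measurable M"
  by (simp add: has_moments_def)

lemma has_moments_power_integrable: "has_moments M f \<Longrightarrow> integrable M (\<lambda>x. f x ^ k)"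
  by (simp add: has_moments_def)

lemma has_moments_integrable: "has_moments M f \<Longrightarrow> integrable M f"
  using has_moments_power_integrable[of M f 1] by simp

lemma (in finite_measure) has_moments_const: "has_moments M (\<lambda>_. c)"
  by (simp add: has_moments_def)

text \<open>With a = f^k and b = g^k, the bound |a b| <= a^2 + b^2 trades the k-th moment of the
  product for the moments of order 2k of the factors.\<close>

lemma has_moments_mult:
  assumes "has_moments M f" "has_moments M g"
  shows "has_moments M (\<lambda>x. f x * g x)"
proof -
  have [measurable]: "f \<in> borel_measurable M" "g \<in> borel_measurable M"
    using assms by (auto simp: has_moments_def)
  have "integrable M (\<lambda>x. (f x * g x) ^ k)" for k
  proof (rule Bochner_Integration.integrable_bound[where f = "\<lambda>x. f x ^ (2 * k) + g x ^ (2 * k)"])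
    show "integrable M (\<lambda>x. f x ^ (2 * k) + g x ^ (2 * k))"
      using assms by (intro Bochner_Integration.integrable_add has_moments_power_integrable)
    have ab: "\<bar>a * b\<bar> \<le> \<bar>a\<^sup>2 + b\<^sup>2\<bar>" for a b :: real
      using sum_squares_bound[of "\<bar>a\<bar>" "\<bar>b\<bar>"] abs_ge_zero[of "a * b"]
      unfolding abs_mult power2_abs mult.assoc by linarith
    have "norm ((f x * g x) ^ k) \<le> norm (f x ^ (2 * k) + g x ^ (2 * k))" for x
      using ab[of "f x ^ k" "g x ^ k"] by (simp add: power_mult_distrib power_even_eq)
    then show "AE x in M. norm ((f x * g x) ^ k) \<le> norm (f x ^ (2 * k) + g x ^ (2 * k))"
      by simp
  qed measurable
  then show ?thesis by (simp add: has_moments_def)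
qed

lemma has_moments_add:
  assumes "has_moments M f" "has_moments M g"
  shows "has_moments M (\<lambda>x. f x + g x)"
proof -
  have [measurable]: "f \<in> borel_measurable M" "g \<in> borel_measurable M"
    using assms by (auto simp: has_moments_def)
  have "integrable M (\<lambda>x. (f x + g x) ^ k)" for k
  proof (rule Bochner_Integration.integrable_bound[where f = "\<lambda>x. 2 ^ k * (\<bar>f x ^ k\<bar> + \<bar>g x ^ k\<bar>)"])
    show "integrable M (\<lambda>x. 2 ^ k * (\<bar>f x ^ k\<bar> + \<bar>g x ^ k\<bar>))"
      using assms by (intro Bochner_Integration.integrable_add integrable_mult_right integrable_abs has_moments_power_integrable)
    have "\<bar>(a + b) ^ k\<bar> \<le> 2 ^ k * (\<bar>a ^ k\<bar> + \<bar>b ^ k\<bar>)" for a b :: real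
    proof -
      have "\<bar>a + b\<bar> ^ k \<le> (2 * max \<bar>a\<bar> \<bar>b\<bar>) ^ k" by (intro power_mono) auto
      also have "\<dots> = 2 ^ k * (max \<bar>a\<bar> \<bar>b\<bar> ^ k)" by (simp add: power_mult_distrib)
      also have "\<dots> \<le> 2 ^ k * (\<bar>a\<bar> ^ k + \<bar>b\<bar> ^ k)" by (intro mult_left_mono) (auto simp: max_def)
      finally show ?thesis by (simp add: power_abs)
    qed
    from this[of "f x" "g x" for x]
    show "AE x in M. norm ((f x + g x) ^ k) \<le> norm (2 ^ k * (\<bar>f x ^ k\<bar> + \<bar>g x ^ k\<bar>))"
      by (auto simp: abs_mult)
  qed measurable
  then show ?thesis by (simp add: has_moments_def)
qed

lemma (in finite_measure) has_moments_cmult: "has_moments M f \<Longrightarrow> has_moments M (\<lambda>x. c * f x)"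
  by (intro has_moments_mult has_moments_const)

lemma (in finite_measure) has_moments_diff:
  "has_moments M f \<Longrightarrow> has_moments M g \<Longrightarrow> has_moments M (\<lambda>x. f x - g x)"
  using has_moments_add[of M f "\<lambda>x. (-1) * g x"] has_moments_cmult[of g "-1"] by simp

lemma (in finite_measure) has_moments_sum:
  "(\<And>i. i \<in> I \<Longrightarrow> has_moments M (f i)) \<Longrightarrow> has_moments M (\<lambda>x. \<Sum>i\<in>I. f i x)"
  by (induction I rule: infinite_finite_induct) (auto intro!: has_moments_add has_moments_const)

lemma (in finite_measure) has_moments_prod:
  "(\<And>i. i \<in> I \<Longrightarrow> has_moments M (f i)) \<Longrightarrow> has_moments M (\<lambda>x. \<Prod>i\<in>I. f i x)"
  by (induction I rule: infinite_finite_induct) (auto intro!: has_moments_mult has_moments_const)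

lemma (in finite_measure) has_moments_power:
  "has_moments M f \<Longrightarrow> has_moments M (\<lambda>x. f x ^ k)"
  by (induction k) (auto intro!: has_moments_mult has_moments_const)

lemma (in finite_measure) has_moments_poly:
  assumes "has_moments M f"
  shows "has_moments M (\<lambda>x. poly P (f x))"
  unfolding poly_altdef by (intro has_moments_sum has_moments_cmult has_moments_power assms)

lemma has_moments_distr:
  assumes "X \<in> borel_measurable M" "f \<in> borel_measurable borel"
  shows "has_moments (distr M borel X) f \<longleftrightarrow> has_moments M (\<lambda>x. f (X x))"
  using assms unfolding has_moments_def by (auto simp: integrable_distr_eq)

section \<open>Moments and integration by parts under the standard normal law\<close>

interpretation N: prob_space std_normal_distribution
  using real_distribution.axioms(1)[OF real_dist_normal_dist] .

lemma has_moments_normal_id: "has_moments std_normal_distribution (\<lambda>x. x)"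
proof -
  have "integrable std_normal_distribution (\<lambda>x. x ^ k)" for k
    using integrable_std_normal_distribution_moment[of k] by simp
  then show ?thesis by (simp add: has_moments_def)
qed

lemma integrable_normal_poly: "integrable std_normal_distribution (poly P)"
  using has_moments_integrable[OF N.has_moments_poly[OF has_moments_normal_id]] by simp

lemma integrable_normal_poly':
  "integrable std_normal_distribution (\<lambda>x. x * poly P x)"
  "integrable std_normal_distribution (\<lambda>x. poly P x * poly Q x)"
  "integrable std_normal_distribution (\<lambda>x. x * (poly P x * poly Q x))"
proof -
  have "(\<lambda>x. x * poly P x) = poly ([:0, 1:] * P)" "(\<lambda>x. poly P x * poly Q x) = poly (P * Q)"
    "(\<lambda>x. x * (poly P x * poly Q x)) = poly ([:0, 1:] * (P * Q))"
    by auto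
  then show "integrable std_normal_distribution (\<lambda>x. x * poly P x)"
    "integrable std_normal_distribution (\<lambda>x. poly P x * poly Q x)"
    "integrable std_normal_distribution (\<lambda>x. x * (poly P x * poly Q x))"
    by (simp_all only: integrable_normal_poly)
qed

lemma normal_moment_rec:
  "(\<integral>x. x ^ (Suc (Suc n)) \<partial>std_normal_distribution) = real (Suc n) * (\<integral>x. x ^ n \<partial>std_normal_distribution)"
proof (cases "even n")
  case True
  then obtain k where k: "n = 2 * k" by (elim evenE)
  have s: "Suc (Suc n) = 2 * Suc k" by (simp add: k)
  have "fact (2 * Suc k) / (2 ^ Suc k * fact (Suc k)) = real (Suc (2 * k)) * (fact (2 * k) / (2 ^ k * fact k))"
  proof -
    have "(fact (2 * Suc k) :: real) = 2 * real (Suc k) * (real (Suc (2 * k)) * fact (2 * k))"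
      by (simp add: algebra_simps)
    moreover have "(2 ^ Suc k * fact (Suc k) :: real) = 2 * real (Suc k) * (2 ^ k * fact k)"
      by (simp add: algebra_simps)
    ultimately show ?thesis
      by (simp only: times_divide_eq_right mult_divide_mult_cancel_left) (simp del: of_nat_Suc fact_Suc)
  qed
  then show ?thesis
    unfolding s unfolding k by (simp only: std_normal_distribution_even_moments(1))
next
  case False
  then show ?thesis by (simp add: integral_std_normal_distribution_moment_odd del: power_Suc)
qed

text \<open>By linearity the identity for polynomials is the moment recursion E[x^(n+2)] = (n+1)
  E[x^n], together with E[x] = 0 for the constant term. The density never has to be
  differentiated.\<close>

lemma normal_integration_by_parts:
  "(\<integral>x. x * poly P x \<partial>std_normal_distribution) = (\<integral>x. poly (pderiv P) x \<partial>std_normal_distribution)"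
proof -
  have i: "integrable std_normal_distribution (\<lambda>x. x ^ k)" for k
    using has_moments_power_integrable[OF has_moments_normal_id] .
  have "(\<integral>x. x * poly P x \<partial>std_normal_distribution) = (\<integral>x. (\<Sum>k\<le>degree P. coeff P k * x ^ Suc k) \<partial>std_normal_distribution)"
    by (simp add: poly_altdef sum_distrib_left mult_ac)
  also have "\<dots> = (\<Sum>k\<le>degree P. coeff P k * (\<integral>x. x ^ Suc k \<partial>std_normal_distribution))"
    using i by (subst Bochner_Integration.integral_sum) (auto simp del: power_Suc)
  \<comment> \<open>For \<open>k = 0\<close> the truncated \<open>k - 1\<close> is harmless: the
    factor \<open>real k\<close> vanishes, and so does the first moment on the other side.\<close>
  also have "\<dots> = (\<Sum>k\<le>degree P. coeff P k * (real k * (\<integral>x. x ^ (k - 1) \<partial>std_normal_distribution)))"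
  proof (intro sum.cong refl, goal_cases)
    case (1 k)
    show ?case
    proof (cases k)
      case 0
      then show ?thesis using integral_std_normal_distribution_moment_odd[of 1] by simp
    next
      case (Suc m)
      then show ?thesis using normal_moment_rec[of m] by simp
    qed
  qed
  also have "\<dots> = (\<integral>x. (\<Sum>k\<le>degree P. coeff P k * (real k * x ^ (k - 1))) \<partial>std_normal_distribution)"
    using i by (subst Bochner_Integration.integral_sum) auto
  also have "(\<lambda>x. \<Sum>k\<le>degree P. coeff P k * (real k * x ^ (k - 1))) = poly (pderiv P)"
  proof
    fix x
    have "((\<lambda>x. \<Sum>k\<le>degree P. coeff P k * x ^ k) has_real_derivative (\<Sum>k\<le>degree P. coeff P k * (real k * x ^ (k - 1)))) (at x)"
      by (auto intro!: derivative_eq_intros simp: mult_ac)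
    then have "(poly P has_real_derivative (\<Sum>k\<le>degree P. coeff P k * (real k * x ^ (k - 1)))) (at x)"
      by (simp add: poly_altdef[abs_def])
    then show "(\<Sum>k\<le>degree P. coeff P k * (real k * x ^ (k - 1))) = poly (pderiv P) x"
      using poly_DERIV DERIV_unique by blast
  qed
  finally show ?thesis .
qed

text \<open>Under the Gaussian measure x - d/dx is the adjoint of d/dx. Integrating x times
  \<open>hpoly n * P\<close> by parts yields two terms, one of which cancels against the derivative
  term of the recursion.\<close>

lemma hpoly_adjoint:
  "(\<integral>x. poly (hpoly (Suc n)) x * poly P x \<partial>std_normal_distribution) =
   (\<integral>x. poly (hpoly n) x * poly (pderiv P) x \<partial>std_normal_distribution)"
proof -
  have "(\<integral>x. poly (hpoly (Suc n)) x * poly P x \<partial>std_normal_distribution) =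
     (\<integral>x. x * poly (hpoly n * P) x - poly (pderiv (hpoly n) * P) x \<partial>std_normal_distribution)"
    by (simp add: algebra_simps)
  also have "\<dots> = (\<integral>x. x * poly (hpoly n * P) x \<partial>std_normal_distribution) - (\<integral>x. poly (pderiv (hpoly n) * P) x \<partial>std_normal_distribution)"
    by (intro Bochner_Integration.integral_diff) (auto intro: integrable_normal_poly')
  also have "(\<integral>x. x * poly (hpoly n * P) x \<partial>std_normal_distribution) = (\<integral>x. poly (pderiv (hpoly n) * P) x + poly (hpoly n * pderiv P) x \<partial>std_normal_distribution)"
    unfolding normal_integration_by_parts
    by (intro Bochner_Integration.integral_cong refl) (simp add: pderiv_mult algebra_simps)
  also have "\<dots> = (\<integral>x. poly (pderiv (hpoly n) * P) x \<partial>std_normal_distribution) + (\<integral>x. poly (hpoly n * pderiv P) x \<partial>std_normal_distribution)"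
    by (intro Bochner_Integration.integral_add integrable_normal_poly)
  finally show ?thesis by simp
qed

text \<open>The adjoint relation lowers the left index, and the derivative formula lowers the right
  one at the cost of the factor \<open>Suc k\<close>. These factors accumulate to the factorial on
  the diagonal; off the diagonal a constant is eventually differentiated.\<close>

lemma hpoly_orthogonal:
  "(\<integral>x. poly (hpoly n) x * poly (hpoly m) x \<partial>std_normal_distribution) = (if n = m then fact n else 0)"
proof (induction n arbitrary: m)
  case 0
  show ?case
  proof (cases m)
    case 0
    then show ?thesis using N.prob_space by simp
  next
    case (Suc k)
    then show ?thesis using hpoly_adjoint[of k 1] by simp
  qed
next
  case (Suc n)
  show ?case
  proof (cases m)
    case 0
    then show ?thesis using hpoly_adjoint[of n 1] by simp
  next
    case (Suc k)
    have "(\<integral>x. poly (hpoly (Suc n)) x * poly (hpoly (Suc k)) x \<partial>std_normal_distribution) =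
       (\<integral>x. real (Suc k) * (poly (hpoly n) x * poly (hpoly k) x) \<partial>std_normal_distribution)"
      unfolding hpoly_adjoint pderiv_hpoly_Suc by (simp add: algebra_simps)
    then show ?thesis unfolding Suc by (simp only: Bochner_Integration.integral_mult_right_zero Suc.IH) simp
  qed
qed

lemma hnorm_orthonormal:
  "(\<integral>x. hnorm n x * hnorm m x \<partial>std_normal_distribution) = (if n = m then 1 else 0)"
proof -
  have "(\<integral>x. hnorm n x * hnorm m x \<partial>std_normal_distribution) =
     (\<integral>x. (poly (hpoly n) x * poly (hpoly m) x) / (sqrt (fact n) * sqrt (fact m)) \<partial>std_normal_distribution)"
    by (simp add: hnorm_def hermite_eq_poly)
  then show ?thesis by (simp only: Bochner_Integration.integral_divide_zero hpoly_orthogonal) auto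
qed

text \<open>The recursion writes the integrand as (c x + s y) H_m - H_m' at c x + s y. Integration
  by parts in y turns the term with s y into s^2 times the integral of H_m', and s^2 - 1 = - c^2
  leaves c x H_m - c^2 H_m'. As H_m' is a multiple of a Hermite polynomial two degrees below n, the
  induction is a strong one.\<close>

lemma hpoly_mehler:
  assumes "c\<^sup>2 + s\<^sup>2 = (1::real)"
  shows "(\<integral>y. poly (hpoly n) (c * x + s * y) \<partial>std_normal_distribution) = c ^ n * poly (hpoly n) x"
proof (induction n rule: less_induct)
  case (less n)
  show ?case
  proof (cases n)
    case 0
    then show ?thesis using N.prob_space by simp
  next
    case (Suc m)
    define Q where "Q = [:c * x, s:]"
    have Q: "poly (pcompose P Q) y = poly P (c * x + s * y)" for P y
      by (simp add: poly_pcompose Q_def mult.commute)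
    have dQ: "pderiv (pcompose P Q) = smult s (pcompose (pderiv P) Q)" for P
      by (simp add: pderiv_pcompose Q_def pderiv_pCons)
    let ?D = "\<integral>y. poly (pcompose (pderiv (hpoly m)) Q) y \<partial>std_normal_distribution"
    let ?A = "\<integral>y. poly (pcompose (hpoly m) Q) y \<partial>std_normal_distribution"
    have "(\<integral>y. poly (hpoly n) (c * x + s * y) \<partial>std_normal_distribution) =
       (\<integral>y. c * x * poly (pcompose (hpoly m) Q) y + s * (y * poly (pcompose (hpoly m) Q) y) - poly (pcompose (pderiv (hpoly m)) Q) y \<partial>std_normal_distribution)"
      by (simp add: Suc Q algebra_simps)
    also have "\<dots> = c * x * ?A + s * (\<integral>y. y * poly (pcompose (hpoly m) Q) y \<partial>std_normal_distribution) - ?D"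
      using integrable_normal_poly'(1)[of "pcompose (hpoly m) Q"] integrable_normal_poly[of "pcompose (hpoly m) Q"]
        integrable_normal_poly[of "pcompose (pderiv (hpoly m)) Q"]
      by (simp add: Bochner_Integration.integral_diff Bochner_Integration.integral_add)
    also have "(\<integral>y. y * poly (pcompose (hpoly m) Q) y \<partial>std_normal_distribution) = s * ?D"
      unfolding normal_integration_by_parts dQ poly_smult[abs_def] by (simp only: poly_smult Bochner_Integration.integral_mult_right_zero)
    also have "c * x * ?A + s * (s * ?D) - ?D = c * x * ?A - c\<^sup>2 * ?D"
    proof -
      have "s * (s * ?D) = (1 - c\<^sup>2) * ?D" using assms by (simp add: power2_eq_square[of s] mult.assoc[symmetric] eq_diff_eq[symmetric])
      then show ?thesis by (simp add: algebra_simps)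
    qed
    also have "?A = c ^ m * poly (hpoly m) x" using less[of m] by (simp add: Suc Q)
    also have "c\<^sup>2 * ?D = c ^ n * poly (pderiv (hpoly m)) x"
    proof (cases m)
      case 0
      then show ?thesis by simp
    next
      case (Suc k)
      have "?D = real (Suc k) * (\<integral>y. poly (hpoly k) (c * x + s * y) \<partial>std_normal_distribution)"
        unfolding Suc pderiv_hpoly_Suc by (simp only: pcompose_smult poly_smult Q) simp
      then show ?thesis
        using less[of k] \<open>n = Suc m\<close> Suc pderiv_hpoly_Suc[of k] by (simp add: power2_eq_square del: hpoly.simps)
    qed
    finally show ?thesis by (simp add: Suc algebra_simps)
  qed
qed

lemma hnorm_mehler:
  assumes "c\<^sup>2 + s\<^sup>2 = (1::real)"
  shows "(\<integral>y. hnorm n (c * x + s * y) \<partial>std_normal_distribution) = c ^ n * hnorm n x"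
  using hpoly_mehler[OF assms] by (simp add: hnorm_def hermite_eq_poly)

subsection \<open>Independent standard normal families\<close>

text \<open>For a nonnegative weight this is uniqueness of characteristic functions: after division
  by its total mass m, \<open>R\<close> is the density of a probability measure under which
  \<open>X\<close> has the standard normal characteristic function. Mass zero cannot be normalised,
  but then \<open>R\<close> vanishes almost surely.\<close>

lemma (in prob_space) weighted_normal_law_nonneg:
  assumes X [measurable]: "X \<in> borel_measurable M" and R: "integrable M R" "\<And>w. 0 \<le> (R w :: real)"
    and char: "\<And>t::real. (\<integral>w. R w *\<^sub>R iexp (t * X w) \<partial>M) = (\<integral>w. R w \<partial>M) *\<^sub>R complex_of_real (exp (- t\<^sup>2 / 2))"
    and A [measurable]: "A \<in> sets borel"
  shows "(\<integral>w. indicator A (X w) * R w \<partial>M) = measure std_normal_distribution A * (\<integral>w. R w \<partial>M)"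
proof (cases "(\<integral>w. R w \<partial>M) = 0")
  case True
  then have "AE w in M. R w = 0"
    using integral_nonneg_eq_0_iff_AE[OF R(1)] R(2) by simp
  then have "(\<integral>w. indicator A (X w) * R w \<partial>M) = (\<integral>w. 0 \<partial>M)"
    using R(1) by (intro integral_cong_AE) auto
  then show ?thesis using True by simp
next
  case False
  define m where "m = (\<integral>w. R w \<partial>M)"
  have m: "m > 0" using False R(2) by (simp add: m_def less_le)
  have [measurable]: "R \<in> borel_measurable M" using R(1) by auto
  define Q where "Q = density M (\<lambda>w. ennreal (R w / m))"
  have Q1: "emeasure Q B = ennreal (\<integral>w. indicator B w * (R w / m) \<partial>M)" if "B \<in> sets M" for B
  proof -
    have "emeasure Q B = (\<integral>\<^sup>+w. ennreal (R w / m) * indicator B w \<partial>M)"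
      using that by (simp add: Q_def emeasure_density)
    also have "\<dots> = (\<integral>\<^sup>+w. ennreal (indicator B w * (R w / m)) \<partial>M)"
      by (intro nn_integral_cong) (auto split: split_indicator)
    also have "\<dots> = ennreal (\<integral>w. indicator B w * (R w / m) \<partial>M)"
      using R m that by (intro nn_integral_eq_integral) (auto intro!: integrable_real_mult_indicator simp: mult.commute)
    finally show ?thesis .
  qed
  have "prob_space Q"
  proof
    have "emeasure Q (space M) = ennreal (\<integral>w. indicator (space M) w * (R w / m) \<partial>M)"
      by (rule Q1) simp
    also have "(\<integral>w. indicator (space M) w * (R w / m) \<partial>M) = (\<integral>w. R w / m \<partial>M)"
      by (intro Bochner_Integration.integral_cong) auto
    also have "\<dots> = 1" using m by (simp add: m_def)
    finally show "emeasure Q (space Q) = 1" by (simp add: Q_def)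
  qed
  then interpret Q: prob_space Q .
  have XQ [measurable]: "X \<in> borel_measurable Q" by (simp add: Q_def)
  have "char (distr Q borel X) t = char std_normal_distribution t" for t
  proof -
    have "char (distr Q borel X) t = (\<integral>w. iexp (t * X w) \<partial>Q)"
      by (simp add: char_def integral_distr)
    also have "\<dots> = (\<integral>w. (R w / m) *\<^sub>R iexp (t * X w) \<partial>M)"
      unfolding Q_def using R m by (intro integral_density) auto
    also have "\<dots> = (\<integral>w. (1 / m) *\<^sub>R (R w *\<^sub>R iexp (t * X w)) \<partial>M)" by simp
    also have "\<dots> = (1 / m) *\<^sub>R (m *\<^sub>R complex_of_real (exp (- t\<^sup>2 / 2)))"
      by (simp only: Bochner_Integration.integral_scaleR_right char m_def)
    also have "\<dots> = char std_normal_distribution t"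
      using m by (simp add: char_std_normal_distribution)
    finally show ?thesis .
  qed
  then have eq: "distr Q borel X = std_normal_distribution"
    by (intro Levy_uniqueness real_dist_normal_dist ext) (auto simp: Q.real_distribution_distr)
  have "emeasure std_normal_distribution A = emeasure Q (X -` A \<inter> space M)"
    unfolding eq[symmetric] by (subst emeasure_distr) (auto simp: Q_def)
  also have "\<dots> = ennreal (\<integral>w. indicator (X -` A \<inter> space M) w * (R w / m) \<partial>M)"
    by (rule Q1) measurable
  also have "(\<integral>w. indicator (X -` A \<inter> space M) w * (R w / m) \<partial>M) = (\<integral>w. (indicator A (X w) * R w) / m \<partial>M)"
    by (intro Bochner_Integration.integral_cong) (auto split: split_indicator)
  also have "\<dots> = (\<integral>w. indicator A (X w) * R w \<partial>M) / m" by simp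
  finally have "ennreal (measure std_normal_distribution A) = ennreal ((\<integral>w. indicator A (X w) * R w \<partial>M) / m)"
    by (simp add: N.emeasure_eq_measure)
  then have "measure std_normal_distribution A = (\<integral>w. indicator A (X w) * R w \<partial>M) / m"
    using m R(2) by (simp add: integral_nonneg)
  then show ?thesis using m by (simp add: m_def[symmetric])
qed

text \<open>A complex weight is not a density, but the real and imaginary parts of \<open>Z\<close>
  lie between -1 and 1 and become nonnegative when 1 is added. The nonnegative case is applied to 1
  + r and to 1, and the results are subtracted.\<close>

lemma (in prob_space) weighted_normal_law:
  fixes Z :: "'a \<Rightarrow> complex"
  assumes X [measurable]: "X \<in> borel_measurable M"
    and Z [measurable]: "Z \<in> borel_measurable M" and bound: "\<And>w. cmod (Z w) \<le> 1"
    and char: "\<And>t::real. (\<integral>w. iexp (t * X w) * Z w \<partial>M) = complex_of_real (exp (- t\<^sup>2 / 2)) * (\<integral>w. Z w \<partial>M)"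
    and char1: "\<And>t::real. (\<integral>w. iexp (t * X w) \<partial>M) = complex_of_real (exp (- t\<^sup>2 / 2))"
    and A [measurable]: "A \<in> sets borel"
  shows "(\<integral>w. indicator A (X w) *\<^sub>R Z w \<partial>M) = measure std_normal_distribution A *\<^sub>R (\<integral>w. Z w \<partial>M)"
proof -
  have bdd: "integrable M f" if "f \<in> borel_measurable M" "\<And>w. norm (f w) \<le> 1" for f :: "'a \<Rightarrow> 'b::{banach, second_countable_topology}"
    using that by (intro integrable_const_bound[of _ 1]) auto
  have [measurable]: "(\<lambda>w. cnj (Z w)) \<in> borel_measurable M"
    by (rule measurable_compose[OF Z]) (intro borel_measurable_continuous_onI continuous_intros)
  \<comment> \<open>Real and imaginary parts involve the conjugate of \<open>Z\<close> as well. Its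
    hypothesis is the conjugate of the one for \<open>Z\<close> at -t, because the Gaussian factor
    is real and even in t.\<close>
  have char_cnj: "(\<integral>w. iexp (t * X w) * cnj (Z w) \<partial>M) = complex_of_real (exp (- t\<^sup>2 / 2)) * (\<integral>w. cnj (Z w) \<partial>M)" for t :: real
  proof -
    have "(\<integral>w. iexp (t * X w) * cnj (Z w) \<partial>M) = (\<integral>w. cnj (iexp (- t * X w) * Z w) \<partial>M)"
      by (intro Bochner_Integration.integral_cong refl) (simp add: exp_cnj)
    also have "\<dots> = cnj (\<integral>w. iexp (- t * X w) * Z w \<partial>M)"
      by (rule Bochner_Integration.integral_cnj)
    also have "\<dots> = complex_of_real (exp (- t\<^sup>2 / 2)) * cnj (\<integral>w. Z w \<partial>M)"
      unfolding char by simp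
    finally show ?thesis by (simp add: Bochner_Integration.integral_cnj)
  qed
  have iZ [simp]: "integrable M Z" "integrable M (\<lambda>w. cnj (Z w))" using bound by (auto intro!: bdd)
  have step: "(\<integral>w. indicator A (X w) * r w \<partial>M) = measure std_normal_distribution A * (\<integral>w. r w \<partial>M)"
    if r: "\<And>w. complex_of_real (r w) = a * Z w + b * cnj (Z w)" "\<And>w. \<bar>r w\<bar> \<le> 1" "r \<in> borel_measurable M" for r a b
  proof -
    have [measurable]: "r \<in> borel_measurable M" by fact
    have ir: "integrable M r" by (rule bdd) (use r in auto)
    have "(\<integral>w. indicator A (X w) * (1 + r w) \<partial>M) = measure std_normal_distribution A * (\<integral>w. 1 + r w \<partial>M)"
    proof (rule weighted_normal_law_nonneg)
      show "0 \<le> 1 + r w" for w using r(2)[of w] by linarith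
      fix t :: real
      have "(\<integral>w. (1 + r w) *\<^sub>R iexp (t * X w) \<partial>M) =
        (\<integral>w. iexp (t * X w) + (a * (iexp (t * X w) * Z w) + b * (iexp (t * X w) * cnj (Z w))) \<partial>M)"
        by (intro Bochner_Integration.integral_cong refl) (simp add: scaleR_conv_of_real r(1) algebra_simps)
      also have "\<dots> = (\<integral>w. iexp (t * X w) \<partial>M) + (a * (\<integral>w. iexp (t * X w) * Z w \<partial>M) + b * (\<integral>w. iexp (t * X w) * cnj (Z w) \<partial>M))"
      proof -
        have "integrable M (\<lambda>w. iexp (t * X w))"
          "integrable M (\<lambda>w. iexp (t * X w) * Z w)" "integrable M (\<lambda>w. iexp (t * X w) * cnj (Z w))"
          using bound by (auto intro!: bdd simp: norm_mult simp del: of_real_mult)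
        then show ?thesis by simp
      qed
      also have "\<dots> = complex_of_real (exp (- t\<^sup>2 / 2)) * (1 + (a * (\<integral>w. Z w \<partial>M) + b * (\<integral>w. cnj (Z w) \<partial>M)))"
        unfolding char char1 char_cnj by (simp only: distrib_left mult_ac mult_1_left mult_1_right)
      also have "1 + (a * (\<integral>w. Z w \<partial>M) + b * (\<integral>w. cnj (Z w) \<partial>M)) = (\<integral>w. 1 + (a * Z w + b * cnj (Z w)) \<partial>M)"
      proof -
        have "(\<integral>w. 1 + (a * Z w + b * cnj (Z w)) \<partial>M) = (\<integral>w. 1 \<partial>M) + (\<integral>w. a * Z w + b * cnj (Z w) \<partial>M)"
          by (intro Bochner_Integration.integral_add) (auto intro!: Bochner_Integration.integrable_add integrable_mult_right iZ)
        also have "(\<integral>w. a * Z w + b * cnj (Z w) \<partial>M) = (\<integral>w. a * Z w \<partial>M) + (\<integral>w. b * cnj (Z w) \<partial>M)"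
          by (intro Bochner_Integration.integral_add) (auto intro!: integrable_mult_right iZ)
        finally show ?thesis by (simp add: prob_space)
      qed
      also have "\<dots> = (\<integral>w. complex_of_real (1 + r w) \<partial>M)" by (simp add: r(1))
      also have "\<dots> = complex_of_real (\<integral>w. 1 + r w \<partial>M)" by (rule integral_complex_of_real)
      finally show "(\<integral>w. (1 + r w) *\<^sub>R iexp (t * X w) \<partial>M) = (\<integral>w. 1 + r w \<partial>M) *\<^sub>R complex_of_real (exp (- t\<^sup>2 / 2))"
        by (simp add: scaleR_conv_of_real mult.commute)
    qed (use ir in auto)
    moreover have "(\<integral>w. indicator A (X w) * 1 \<partial>M) = measure std_normal_distribution A * (\<integral>w. 1 \<partial>M)"
      by (rule weighted_normal_law_nonneg) (use char1 in \<open>auto simp: prob_space\<close>)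
    moreover have "(\<integral>w. indicator A (X w) * (1 + r w) \<partial>M) = (\<integral>w. indicator A (X w) * 1 \<partial>M) + (\<integral>w. indicator A (X w) * r w \<partial>M)"
    proof -
      have "integrable M (\<lambda>w. indicator A (X w) * 1 :: real)" "integrable M (\<lambda>w. indicator A (X w) * r w)"
        using r(2) by (auto intro!: bdd split: split_indicator simp: indicator_def)
      then show ?thesis by (subst Bochner_Integration.integral_add[symmetric]) (auto simp: algebra_simps)
    qed
    moreover have "(\<integral>w. 1 + r w \<partial>M) = 1 + (\<integral>w. r w \<partial>M)"
      using ir by (simp add: prob_space)
    ultimately show ?thesis by (simp add: prob_space algebra_simps)
  qed
  \<comment> \<open>The coefficients come from Re Z = (Z + cnj Z)/2 and Im Z = (-\<i> Z + \<i> cnj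
    Z)/2.\<close>
  have re: "(\<integral>w. indicator A (X w) * Re (Z w) \<partial>M) = measure std_normal_distribution A * (\<integral>w. Re (Z w) \<partial>M)"
    by (rule step[of _ "1/2" "1/2"]) (use bound abs_Re_le_cmod order_trans in \<open>auto simp: complex_eq_iff intro: order_trans[OF abs_Re_le_cmod]\<close>)
  have im: "(\<integral>w. indicator A (X w) * Im (Z w) \<partial>M) = measure std_normal_distribution A * (\<integral>w. Im (Z w) \<partial>M)"
    by (rule step[of _ "- \<i>/2" "\<i>/2"]) (use bound abs_Im_le_cmod order_trans in \<open>auto simp: complex_eq_iff intro: order_trans[OF abs_Im_le_cmod]\<close>)
  have iI: "integrable M (\<lambda>w. indicator A (X w) *\<^sub>R Z w)"
    using bound by (intro bdd) (auto split: split_indicator)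
  show ?thesis
  proof (rule complex_eqI)
    show "Re (\<integral>w. indicator A (X w) *\<^sub>R Z w \<partial>M) = Re (measure std_normal_distribution A *\<^sub>R (\<integral>w. Z w \<partial>M))"
      using re iI iZ by (simp flip: Bochner_Integration.integral_Re)
    show "Im (\<integral>w. indicator A (X w) *\<^sub>R Z w \<partial>M) = Im (measure std_normal_distribution A *\<^sub>R (\<integral>w. Z w \<partial>M))"
      using im iI iZ by (simp flip: Bochner_Integration.integral_Im)
  qed
qed

definition iid_normal :: "'w measure \<Rightarrow> ('i \<Rightarrow> 'w \<Rightarrow> real) \<Rightarrow> 'i set \<Rightarrow> bool" where
  "iid_normal M V B \<longleftrightarrow> prob_space M \<and> prob_space.indep_vars M (\<lambda>_. borel) V B \<and>
     (\<forall>e\<in>B. distr M borel (V e) = std_normal_distribution)"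

lemma iid_normal_measurable: "iid_normal M V B \<Longrightarrow> e \<in> B \<Longrightarrow> V e \<in> borel_measurable M"
  by (auto simp: iid_normal_def prob_space.indep_vars_def2)

text \<open>The exponential factors are traded for indicator functions one index at a time,
  which needs only the one-dimensional uniqueness theorem for characteristic functions.\<close>

lemma (in prob_space) iid_normal_charI:
  assumes V: "\<And>e. e \<in> B \<Longrightarrow> V e \<in> borel_measurable M"
    and char: "\<And>I s. finite I \<Longrightarrow> I \<subseteq> B \<Longrightarrow>
      (\<integral>w. iexp (\<Sum>e\<in>I. s e * V e w) \<partial>M) = complex_of_real (exp (- (\<Sum>e\<in>I. (s e)\<^sup>2) / 2))"
  shows "iid_normal M V B"
proof -
  have char1: "(\<integral>w. iexp (t * V e w) \<partial>M) = complex_of_real (exp (- t\<^sup>2 / 2))" if "e \<in> B" for t :: real and e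
    using char[of "{e}" "\<lambda>_. t"] that by simp
  \<comment> \<open>The mixed statement is the induction invariant: indices in \<open>J\<close>
    already carry indicators, those in the disjoint set \<open>I\<close> still carry exponentials.
    \<open>I\<close> and \<open>s\<close> stay arbitrary because the next index is inserted into
    \<open>I\<close> before it moves to \<open>J\<close>.\<close>
  have key: "(\<integral>w. (\<Prod>e\<in>J. indicator (A e) (V e w)) *\<^sub>R iexp (\<Sum>e\<in>I. s e * V e w) \<partial>M) =
      (\<Prod>e\<in>J. measure std_normal_distribution (A e)) *\<^sub>R complex_of_real (exp (- (\<Sum>e\<in>I. (s e)\<^sup>2) / 2))"
    if "finite J" "J \<subseteq> B" "finite I" "I \<subseteq> B" "I \<inter> J = {}" "\<And>e. A e \<in> sets borel" for J I s and A :: "_ \<Rightarrow> real set"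
    using that
  proof (induction J arbitrary: I s rule: finite_induct)
    case empty
    then show ?case using char by simp
  next
    case (insert e J)
    define Z where "Z w = (\<Prod>e\<in>J. indicator (A e) (V e w) :: real) *\<^sub>R iexp (\<Sum>e\<in>I. s e * V e w)" for w
    have [measurable]: "V e \<in> borel_measurable M" using insert.prems V by auto
    have meas: "(\<lambda>w. indicator (A e) (V e w) :: real) \<in> borel_measurable M" if "e \<in> J" for e
    proof -
      have [measurable]: "V e \<in> borel_measurable M" "A e \<in> sets borel" using that insert.prems V by auto
      show ?thesis by measurable
    qed
    have meas2: "(\<lambda>w. s e * V e w) \<in> borel_measurable M" if "e \<in> I" for e
      using that insert.prems V[of e] by (auto intro!: borel_measurable_times)
    have [measurable]: "Z \<in> borel_measurable M"
      unfolding Z_def using meas meas2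
      by (intro borel_measurable_scaleR borel_measurable_prod measurable_compose[OF borel_measurable_sum, of I _ M iexp]) auto
    have "(\<integral>w. indicator (A e) (V e w) *\<^sub>R Z w \<partial>M) = measure std_normal_distribution (A e) *\<^sub>R (\<integral>w. Z w \<partial>M)"
    proof (rule weighted_normal_law)
      show "cmod (Z w) \<le> 1" for w
      proof -
        have "\<bar>\<Prod>e\<in>J. indicator (A e) (V e w) :: real\<bar> \<le> 1"
          unfolding abs_prod by (intro prod_le_1) (auto split: split_indicator)
        then show ?thesis by (simp add: Z_def del: of_real_sum)
      qed
      fix t :: real
      \<comment> \<open>The test exponential at \<open>e\<close> only adds \<open>e\<close> to the
        exponential indices with frequency \<open>t\<close>, so its integral is again an instance of
        the induction hypothesis.\<close>
      have ex: "iexp (t * V e w) * Z w = (\<Prod>e\<in>J. indicator (A e) (V e w)) *\<^sub>R iexp (\<Sum>d\<in>insert e I. (s(e := t)) d * V d w)" for w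
      proof -
        have "(\<Sum>d\<in>insert e I. (s(e := t)) d * V d w) = t * V e w + (\<Sum>d\<in>I. s d * V d w)"
          using insert.prems by (subst sum.insert) (auto intro!: sum.cong)
        then show ?thesis
          by (simp add: Z_def exp_add distrib_left del: of_real_sum)
      qed
      have sq: "(\<Sum>d\<in>insert e I. ((s(e := t)) d)\<^sup>2) = t\<^sup>2 + (\<Sum>d\<in>I. (s d)\<^sup>2)"
        using insert.prems by (subst sum.insert) (auto intro!: sum.cong)
      have Z0: "(\<integral>w. Z w \<partial>M) = (\<Prod>e\<in>J. measure std_normal_distribution (A e)) *\<^sub>R complex_of_real (exp (- (\<Sum>e\<in>I. (s e)\<^sup>2) / 2))"
        unfolding Z_def by (rule insert.IH) (use insert in auto)
      have Zt: "(\<integral>w. iexp (t * V e w) * Z w \<partial>M) = (\<Prod>e\<in>J. measure std_normal_distribution (A e)) *\<^sub>R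
          complex_of_real (exp (- (\<Sum>d\<in>insert e I. ((s(e := t)) d)\<^sup>2) / 2))"
        unfolding ex by (rule insert.IH) (use insert in auto)
      then show "(\<integral>w. iexp (t * V e w) * Z w \<partial>M) = complex_of_real (exp (- t\<^sup>2 / 2)) * (\<integral>w. Z w \<partial>M)"
      proof -
        have "exp (- (t\<^sup>2 + b) / 2) = exp (- t\<^sup>2 / 2) * exp (- b / 2)" for b :: real
          by (simp add: exp_add[symmetric] field_simps)
        then show ?thesis
          unfolding Z0 Zt sq by (simp add: scaleR_conv_of_real mult_ac)
      qed
    qed (use insert.prems char1 in auto)
    also have "(\<integral>w. Z w \<partial>M) = (\<Prod>e\<in>J. measure std_normal_distribution (A e)) *\<^sub>R complex_of_real (exp (- (\<Sum>e\<in>I. (s e)\<^sup>2) / 2))"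
      unfolding Z_def by (rule insert.IH) (use insert in auto)
    finally show ?case using insert.hyps by (simp add: Z_def)
  qed
  have joint: "prob (\<Inter>e\<in>J. V e -` A e \<inter> space M) = (\<Prod>e\<in>J. measure std_normal_distribution (A e))"
    if J: "finite J" "J \<noteq> {}" "J \<subseteq> B" and A: "\<And>e. e \<in> J \<Longrightarrow> A e \<in> sets borel" for J and A :: "_ \<Rightarrow> real set"
  proof -
    \<comment> \<open>\<open>key\<close> asks for Borel sets at every index, so the family is
      completed by empty sets outside \<open>J\<close>.\<close>
    define A' where "A' e = (if e \<in> J then A e else {})" for e
    have "complex_of_real (prob (\<Inter>e\<in>J. V e -` A e \<inter> space M)) = complex_of_real (\<integral>w. indicator (\<Inter>e\<in>J. V e -` A e \<inter> space M) w \<partial>M)"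
    proof -
      have "(\<Inter>e\<in>J. V e -` A e \<inter> space M) \<in> sets M"
        using J A V by (intro sets.finite_INT) (auto intro!: measurable_sets)
      then show ?thesis by simp
    qed
    also have "\<dots> = (\<integral>w. complex_of_real (indicator (\<Inter>e\<in>J. V e -` A e \<inter> space M) w) \<partial>M)"
      by (rule integral_complex_of_real[symmetric])
    also have "\<dots> = (\<integral>w. (\<Prod>e\<in>J. indicator (A' e) (V e w)) *\<^sub>R iexp (\<Sum>e\<in>{}. 0 * V e w) \<partial>M)"
    proof (intro Bochner_Integration.integral_cong refl)
      fix w assume w: "w \<in> space M"
      have "indicator (\<Inter>e\<in>J. V e -` A e \<inter> space M) w = (\<Prod>e\<in>J. indicator (A' e) (V e w) :: real)"
        using J w by (auto simp: indicator_def A'_def prod_zero_iff)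
      then show "complex_of_real (indicator (\<Inter>e\<in>J. V e -` A e \<inter> space M) w) = (\<Prod>e\<in>J. indicator (A' e) (V e w)) *\<^sub>R iexp (\<Sum>e\<in>{}. 0 * V e w)"
        by (simp add: scaleR_conv_of_real)
    qed
    also have "\<dots> = (\<Prod>e\<in>J. measure std_normal_distribution (A' e)) *\<^sub>R complex_of_real (exp (- (\<Sum>e\<in>{}. (0::real)\<^sup>2) / 2))"
      using key[of J "{}" A' "\<lambda>_. 0"] J A by (auto simp: A'_def)
    finally have "complex_of_real (prob (\<Inter>e\<in>J. V e -` A e \<inter> space M)) = complex_of_real (\<Prod>e\<in>J. measure std_normal_distribution (A' e))"
      by (simp add: scaleR_conv_of_real)
    then show ?thesis by (simp only: of_real_eq_iff) (simp add: A'_def)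
  qed
  have single: "prob (V e -` A \<inter> space M) = measure std_normal_distribution A" if "e \<in> B" "A \<in> sets borel" for e A
    using joint[of "{e}" "\<lambda>_. A"] that by simp
  have "distr M borel (V e) = std_normal_distribution" if e: "e \<in> B" for e
  proof (rule measure_eqI)
    fix A assume "A \<in> sets (distr M borel (V e))"
    then show "emeasure (distr M borel (V e)) A = emeasure std_normal_distribution A"
      using single[OF e] V[OF e] by (simp add: emeasure_distr emeasure_eq_measure N.emeasure_eq_measure)
  qed simp
  moreover have "indep_vars (\<lambda>_. borel) V B"
    unfolding indep_vars_def2 indep_sets_def
  proof (intro conjI ballI allI impI)
    fix J C assume J: "J \<subseteq> B" "J \<noteq> {}" "finite J" and C: "C \<in> (\<Pi> e\<in>J. {V e -` A \<inter> space M |A. A \<in> sets borel})"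
    then have "\<forall>e\<in>J. \<exists>A. A \<in> sets borel \<and> C e = V e -` A \<inter> space M" by (auto simp: Pi_iff)
    then obtain A where A: "\<And>e. e \<in> J \<Longrightarrow> A e \<in> sets borel" "\<And>e. e \<in> J \<Longrightarrow> C e = V e -` A e \<inter> space M" by metis
    have "prob (\<Inter>e\<in>J. C e) = prob (\<Inter>e\<in>J. V e -` A e \<inter> space M)" using A(2) by simp
    also have "\<dots> = (\<Prod>e\<in>J. measure std_normal_distribution (A e))" using joint J A by blast
    also have "\<dots> = (\<Prod>e\<in>J. prob (C e))" using A single J by (intro prod.cong) auto
    finally show "prob (\<Inter>e\<in>J. C e) = (\<Prod>e\<in>J. prob (C e))" .
  qed (use V in \<open>auto intro: measurable_sets\<close>)
  ultimately show ?thesis using prob_space_axioms by (auto simp: iid_normal_def)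
qed

lemma iid_normal_prod_integral:
  fixes f :: "'i \<Rightarrow> real \<Rightarrow> 'b::{real_normed_field, banach, second_countable_topology}"
  assumes V: "iid_normal M V B" and J: "finite J" "J \<subseteq> B"
    and f: "\<And>e. e \<in> J \<Longrightarrow> f e \<in> borel_measurable borel"
    and int: "\<And>e. e \<in> J \<Longrightarrow> integrable std_normal_distribution (f e)"
  shows "(\<integral>w. (\<Prod>e\<in>J. f e (V e w)) \<partial>M) = (\<Prod>e\<in>J. \<integral>x. f e x \<partial>std_normal_distribution)"
    and "integrable M (\<lambda>w. \<Prod>e\<in>J. f e (V e w))"
proof -
  interpret prob_space M using V by (simp add: iid_normal_def)
  have d: "distr M borel (V e) = std_normal_distribution" if "e \<in> J" for e
    using V J that by (auto simp: iid_normal_def)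
  have rv [measurable]: "V e \<in> borel_measurable M" if "e \<in> J" for e
    using iid_normal_measurable[OF V] J that by auto
  have ind: "indep_vars (\<lambda>_. borel) (\<lambda>e w. f e (V e w)) J"
  proof (rule indep_vars_compose2[where X = V and M' = "\<lambda>_. borel" and Y = f])
    show "indep_vars (\<lambda>_. borel) V J"
      by (rule indep_vars_subset) (use V J in \<open>auto simp: iid_normal_def\<close>)
  qed (use f in auto)
  have i: "integrable M (\<lambda>w. f e (V e w))" if "e \<in> J" for e
    using int[OF that] integrable_distr_eq[OF rv[OF that] f[OF that]] d[OF that] by simp
  have e: "(\<integral>w. f e (V e w) \<partial>M) = (\<integral>x. f e x \<partial>std_normal_distribution)" if "e \<in> J" for e
    using integral_distr[OF rv[OF that] f[OF that]] d[OF that] by simp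
  show "(\<integral>w. (\<Prod>e\<in>J. f e (V e w)) \<partial>M) = (\<Prod>e\<in>J. \<integral>x. f e x \<partial>std_normal_distribution)"
    using indep_vars_lebesgue_integral[OF J(1) ind i] e by simp
  show "integrable M (\<lambda>w. \<Prod>e\<in>J. f e (V e w))"
    using indep_vars_integrable[OF J(1) ind i] .
qed

lemma iid_normal_char:
  assumes V: "iid_normal M V B" and J: "finite J" "J \<subseteq> B"
  shows "(\<integral>w. iexp (\<Sum>e\<in>J. s e * V e w) \<partial>M) = complex_of_real (exp (- (\<Sum>e\<in>J. (s e)\<^sup>2) / 2))"
proof -
  have "(\<integral>w. iexp (\<Sum>e\<in>J. s e * V e w) \<partial>M) = (\<integral>w. (\<Prod>e\<in>J. iexp (s e * V e w)) \<partial>M)"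
    using J by (simp add: exp_sum sum_distrib_left)
  also have "\<dots> = (\<Prod>e\<in>J. \<integral>x. iexp (s e * x) \<partial>std_normal_distribution)"
    using iid_normal_prod_integral(1)[OF V J, of "\<lambda>e x. iexp (s e * x)"]
    by (simp add: N.integrable_iexp del: of_real_mult)
  also have "\<dots> = (\<Prod>e\<in>J. complex_of_real (exp (- (s e)\<^sup>2 / 2)))"
    using char_std_normal_distribution by (simp add: char_def fun_eq_iff)
  also have "\<dots> = complex_of_real (exp (\<Sum>e\<in>J. - (s e)\<^sup>2 / 2))"
    using J by (simp add: exp_sum)
  also have "(\<Sum>e\<in>J. - (s e)\<^sup>2 / 2) = - (\<Sum>e\<in>J. (s e)\<^sup>2) / 2"
    by (simp add: sum_negf sum_divide_distrib)
  finally show ?thesis .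
qed

text \<open>On the product space the characteristic function splits into one factor per copy. With
  |r|^2 the sum of the squared frequencies, the exponents carry c^2 |r|^2 and s^2 |r|^2, which add
  up to |r|^2.\<close>

lemma iid_normal_rotate:
  assumes V: "iid_normal M V B" and cs: "c\<^sup>2 + s\<^sup>2 = (1::real)"
  shows "iid_normal (M \<Otimes>\<^sub>M M) (\<lambda>e z. c * V e (fst z) + s * V e (snd z)) B"
proof -
  interpret prob_space M using V by (simp add: iid_normal_def)
  interpret P: pair_prob_space M M ..
  show ?thesis
  proof (rule P.iid_normal_charI)
    show "(\<lambda>z. c * V e (fst z) + s * V e (snd z)) \<in> borel_measurable (M \<Otimes>\<^sub>M M)" if "e \<in> B" for e
      using iid_normal_measurable[OF V that] by measurable
    fix I and r :: "_ \<Rightarrow> real" assume I: "finite I" "I \<subseteq> B"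
    define f where "f a w = iexp (\<Sum>e\<in>I. a * r e * V e w)" for a w
    have fm: "f a \<in> borel_measurable M" for a
    proof -
      have "(\<lambda>w. \<Sum>e\<in>I. a * r e * V e w) \<in> borel_measurable M"
        using iid_normal_measurable[OF V] I by (intro borel_measurable_sum borel_measurable_times borel_measurable_const) auto
      then show ?thesis unfolding f_def by measurable
    qed
    have fi: "integrable M (f a)" for a
      using fm[of a] by (intro integrable_const_bound[of _ 1]) (auto simp: f_def simp del: of_real_sum)
    have fv: "(\<integral>w. f a w \<partial>M) = complex_of_real (exp (- (a\<^sup>2 * (\<Sum>e\<in>I. (r e)\<^sup>2)) / 2))" for a
      unfolding f_def using iid_normal_char[OF V I, of "\<lambda>e. a * r e"]
      by (simp add: power_mult_distrib sum_distrib_left)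
    have "(\<integral>z. iexp (\<Sum>e\<in>I. r e * (c * V e (fst z) + s * V e (snd z))) \<partial>(M \<Otimes>\<^sub>M M)) = (\<integral>z. f c (fst z) * f s (snd z) \<partial>(M \<Otimes>\<^sub>M M))"
      by (intro Bochner_Integration.integral_cong refl)
        (simp add: f_def exp_add[symmetric] distrib_left sum.distrib sum_distrib_left mult_ac)
    also have "\<dots> = (\<integral>w. f c w \<partial>M) * (\<integral>w. f s w \<partial>M)"
    proof -
      have i: "integrable (M \<Otimes>\<^sub>M M) (\<lambda>z. f c (fst z) * f s (snd z))"
      proof (rule P.integrable_const_bound[of _ 1])
        show "(\<lambda>z. f c (fst z) * f s (snd z)) \<in> borel_measurable (M \<Otimes>\<^sub>M M)"
          using fm by measurable
      qed (auto simp: f_def norm_mult simp del: of_real_sum)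
      have "(\<integral>z. f c (fst z) * f s (snd z) \<partial>(M \<Otimes>\<^sub>M M)) = (\<integral>x. (\<integral>y. f c x * f s y \<partial>M) \<partial>M)"
        using P.integral_fst'[OF i] by simp
      then show ?thesis by simp
    qed
    also have "\<dots> = complex_of_real (exp (- (c\<^sup>2 * (\<Sum>e\<in>I. (r e)\<^sup>2)) / 2 + - (s\<^sup>2 * (\<Sum>e\<in>I. (r e)\<^sup>2)) / 2))"
      unfolding fv exp_add by simp
    also have "- (c\<^sup>2 * (\<Sum>e\<in>I. (r e)\<^sup>2)) / 2 + - (s\<^sup>2 * (\<Sum>e\<in>I. (r e)\<^sup>2)) / 2 = - ((c\<^sup>2 + s\<^sup>2) * (\<Sum>e\<in>I. (r e)\<^sup>2)) / 2"
      by (simp add: field_simps)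
    finally show "(\<integral>z. iexp (\<Sum>e\<in>I. r e * (c * V e (fst z) + s * V e (snd z))) \<partial>(M \<Otimes>\<^sub>M M)) =
        complex_of_real (exp (- (\<Sum>e\<in>I. (r e)\<^sup>2) / 2))"
      by (simp add: cs)
  qed
qed

text \<open>Independence gives agreement on cylinders over finitely many coordinates, and these
  determine a measure on the product space. Since the right-hand side mentions only
  \<open>B\<close>, two families indexed by \<open>B\<close> have the same law even when they live
  on different probability spaces.\<close>

lemma iid_normal_distr:
  assumes V: "iid_normal M V B"
  shows "distr M (PiM B (\<lambda>_. std_normal_distribution)) (\<lambda>w. \<lambda>e\<in>B. V e w) = PiM B (\<lambda>_. std_normal_distribution)"
proof -
  interpret prob_space M using V by (simp add: iid_normal_def)
  interpret G: product_prob_space "\<lambda>_. std_normal_distribution" B by standard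
  have m: "(\<lambda>w. \<lambda>e\<in>B. V e w) \<in> measurable M (PiM B (\<lambda>_. std_normal_distribution))"
    using iid_normal_measurable[OF V] by (intro measurable_restrict) simp
  show ?thesis
  proof (rule G.PiM_eq)
    fix J and F :: "'b \<Rightarrow> real set" assume J: "finite J" "J \<subseteq> B" and F: "\<And>j. j \<in> J \<Longrightarrow> F j \<in> sets std_normal_distribution"
    have emb: "prod_emb B (\<lambda>_. std_normal_distribution) J (Pi\<^sub>E J F) \<in> sets (PiM B (\<lambda>_. std_normal_distribution))"
      using J F by (intro sets_PiM_I) auto
    have "emeasure (distr M (PiM B (\<lambda>_. std_normal_distribution)) (\<lambda>w. \<lambda>e\<in>B. V e w)) (prod_emb B (\<lambda>_. std_normal_distribution) J (Pi\<^sub>E J F))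
      = ennreal (prob {w \<in> space M. \<forall>e\<in>J. V e w \<in> F e})"
    proof -
      have "(\<lambda>w. \<lambda>e\<in>B. V e w) -` prod_emb B (\<lambda>_. std_normal_distribution) J (Pi\<^sub>E J F) \<inter> space M = {w \<in> space M. \<forall>e\<in>J. V e w \<in> F e}"
        using J by (fastforce simp: prod_emb_def PiE_iff restrict_def extensional_def)
      then show ?thesis by (simp only: emeasure_distr[OF m emb] emeasure_eq_measure)
    qed
    also have "prob {w \<in> space M. \<forall>e\<in>J. V e w \<in> F e} = (\<integral>w. (\<Prod>e\<in>J. indicator (F e) (V e w)) \<partial>M)"
    proof -
      have "{w \<in> space M. \<forall>e\<in>J. V e w \<in> F e} = (\<Inter>e\<in>J. V e -` F e \<inter> space M) \<inter> space M" by auto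
      also have "\<dots> \<in> sets M"
      proof (cases "J = {}")
        case False
        have "(\<Inter>e\<in>J. V e -` F e \<inter> space M) \<in> sets M"
          using J False F iid_normal_measurable[OF V] by (intro sets.finite_INT) (auto intro!: measurable_sets)
        then show ?thesis by auto
      qed simp
      finally have "prob {w \<in> space M. \<forall>e\<in>J. V e w \<in> F e} = (\<integral>w. indicator {w \<in> space M. \<forall>e\<in>J. V e w \<in> F e} w \<partial>M)"
        by simp
      also have "\<dots> = (\<integral>w. (\<Prod>e\<in>J. indicator (F e) (V e w)) \<partial>M)"
        using J by (intro Bochner_Integration.integral_cong refl) (auto simp: indicator_def prod_zero_iff)
      finally show ?thesis .
    qed
    also have "\<dots> = (\<Prod>e\<in>J. \<integral>x. indicator (F e) x \<partial>std_normal_distribution)"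
      using F by (intro iid_normal_prod_integral(1)[OF V J]) (auto intro!: N.integrable_const_bound[of _ 1])
    also have "ennreal \<dots> = (\<Prod>j\<in>J. emeasure std_normal_distribution (F j))"
      using F by (simp add: prod_ennreal N.emeasure_eq_measure)
    finally show "emeasure (distr M (PiM B (\<lambda>_. std_normal_distribution)) (\<lambda>w. \<lambda>e\<in>B. V e w)) (prod_emb B (\<lambda>_. std_normal_distribution) J (Pi\<^sub>E J F))
      = (\<Prod>j\<in>J. emeasure std_normal_distribution (F j))" .
  qed simp
qed

text \<open>The definition of a Gaussian variable only asserts that some mu and sigma exist.
  Uniqueness of characteristic functions identifies the law of \<open>X\<close> with that of mu +
  sigma N, N standard normal, and its first two moments then give mu = 0 and sigma^2 =
  E[X^2].\<close>

lemma gaussian_rv_moments: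
  assumes "prob_space M" "gaussian_rv M X" "integrable M X" "(\<integral>w. X w \<partial>M) = 0" "integrable M (\<lambda>w. (X w)\<^sup>2)"
  shows "(\<integral>w. iexp (X w) \<partial>M) = complex_of_real (exp (- (\<integral>w. (X w)\<^sup>2 \<partial>M) / 2))"
proof -
  interpret prob_space M by fact
  have X [measurable]: "X \<in> borel_measurable M" using assms(2) by (simp add: gaussian_rv_def)
  obtain mu sigma :: real where ch: "\<And>t. char (distr M borel X) t = iexp (mu * t) * complex_of_real (exp (- (sigma\<^sup>2 * t\<^sup>2) / 2))"
    using assms(2) by (auto simp: gaussian_rv_def)
  \<comment> \<open>Taking an affine image of the standard normal law, rather than a density, also
    covers sigma = 0.\<close>
  let ?Y = "\<lambda>x. mu + sigma * x"
  let ?N = "distr std_normal_distribution borel ?Y"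
  have "char ?N t = char (distr M borel X) t" for t
  proof -
    have "char ?N t = (\<integral>x. iexp (mu * t) * iexp (sigma * t * x) \<partial>std_normal_distribution)"
      unfolding char_def by (subst integral_distr) (auto simp: exp_add[symmetric] algebra_simps)
    also have "\<dots> = iexp (mu * t) * char std_normal_distribution (sigma * t)"
      by (simp add: char_def)
    finally show ?thesis unfolding ch char_std_normal_distribution by (simp add: power_mult_distrib)
  qed
  then have eq: "distr M borel X = ?N"
    by (intro Levy_uniqueness ext real_distribution_distr N.real_distribution_distr) auto
  have i: "integrable std_normal_distribution (\<lambda>x. x)" "integrable std_normal_distribution (\<lambda>x. x\<^sup>2)"
    using has_moments_power_integrable[OF has_moments_normal_id, of 1] has_moments_power_integrable[OF has_moments_normal_id, of 2] by auto
  have m1: "(\<integral>x. x \<partial>std_normal_distribution) = 0" and m2: "(\<integral>x. x\<^sup>2 \<partial>std_normal_distribution) = 1"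
    using integral_std_normal_distribution_moment_odd[of 1] std_normal_distribution_even_moments(1)[of 1] by auto
  have "0 = (\<integral>x. x \<partial>distr M borel X)" using assms(4) by (subst integral_distr) auto
  also have "\<dots> = (\<integral>x. mu + sigma * x \<partial>std_normal_distribution)" unfolding eq by (subst integral_distr) auto
  also have "\<dots> = mu" using i m1 N.prob_space by simp
  finally have mu: "mu = 0" by simp
  have "(\<integral>w. (X w)\<^sup>2 \<partial>M) = (\<integral>x. x\<^sup>2 \<partial>distr M borel X)" by (subst integral_distr) auto
  also have "\<dots> = (\<integral>x. (mu + sigma * x)\<^sup>2 \<partial>std_normal_distribution)" unfolding eq by (subst integral_distr) auto
  also have "\<dots> = sigma\<^sup>2" using m2 by (simp add: mu power_mult_distrib)
  finally have sigma: "(\<integral>w. (X w)\<^sup>2 \<partial>M) = sigma\<^sup>2" .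
  have "(\<integral>w. iexp (X w) \<partial>M) = char (distr M borel X) 1"
    unfolding char_def by (subst integral_distr) auto
  then show ?thesis unfolding ch sigma mu by simp
qed

text \<open>Every finite linear combination is centred Gaussian, and orthonormality of
  \<open>B\<close> makes its variance the sum of the squared coefficients. This is exactly the joint
  characteristic function of independent standard normals.\<close>

lemma isonormal_iid_normal:
  assumes "prob_space M" and W: "isonormal M W" and B: "countable_onb B"
  shows "iid_normal M W B"
proof -
  interpret prob_space M by fact
  show ?thesis
  proof (rule iid_normal_charI)
    show "W e \<in> borel_measurable M" for e using W by (simp add: isonormal_def)
    fix I and s :: "'b \<Rightarrow> real" assume I: "finite I" "I \<subseteq> B"
    define X where "X w = (\<Sum>e\<in>I. s e * W e w)" for w
    \<comment> \<open>\<open>isonormal\<close> speaks of sums over an initial segment of the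
      naturals, so the finite index set is enumerated.\<close>
    obtain n and h where h: "bij_betw h {..<n::nat} I"
      using ex_bij_betw_nat_finite[OF I(1)] by (metis atLeast0LessThan)
    have Xh: "X w = (\<Sum>i<n. (s \<circ> h) i * W (h i) w)" for w
      unfolding X_def using sum.reindex_bij_betw[OF h, of "\<lambda>e. s e * W e w"] by simp
    have g: "gaussian_rv M X"
      using W unfolding isonormal_def by (auto simp: Xh[abs_def])
    have iW: "integrable M (W h)" "integrable M (\<lambda>w. W h w * W g w)" "(\<integral>w. W h w \<partial>M) = 0"
      "(\<integral>w. W h w * W g w \<partial>M) = inner h g" for h g
      using W by (auto simp: isonormal_def)
    have sq: "(X w)\<^sup>2 = (\<Sum>d\<in>I. \<Sum>e\<in>I. s d * s e * (W d w * W e w))" for w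
      unfolding X_def power2_eq_square sum_product by (simp add: mult_ac)
    have "(\<integral>w. (X w)\<^sup>2 \<partial>M) = (\<Sum>d\<in>I. \<Sum>e\<in>I. s d * s e * inner d e)"
      unfolding sq using iW by (simp add: Bochner_Integration.integral_sum)
    also have "\<dots> = (\<Sum>d\<in>I. \<Sum>e\<in>I. if e = d then (s d)\<^sup>2 else 0)"
    proof (intro sum.cong refl)
      fix d e assume "d \<in> I" "e \<in> I"
      then have "d \<in> B" "e \<in> B" using I by auto
      then show "s d * s e * inner d e = (if e = d then (s d)\<^sup>2 else 0)"
        using B by (auto simp: countable_onb_def power2_eq_square norm_eq_1)
    qed
    also have "\<dots> = (\<Sum>e\<in>I. (s e)\<^sup>2)" using I by simp
    finally have v: "(\<integral>w. (X w)\<^sup>2 \<partial>M) = (\<Sum>e\<in>I. (s e)\<^sup>2)" .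
    have "(\<integral>w. iexp (X w) \<partial>M) = complex_of_real (exp (- (\<integral>w. (X w)\<^sup>2 \<partial>M) / 2))"
    proof (rule gaussian_rv_moments[OF \<open>prob_space M\<close> g])
      show "integrable M X" "(\<integral>w. X w \<partial>M) = 0" unfolding X_def using iW by (auto simp: Bochner_Integration.integral_sum)
      show "integrable M (\<lambda>w. (X w)\<^sup>2)" unfolding sq using iW by auto
    qed
    then show "(\<integral>w. iexp (\<Sum>e\<in>I. s e * W e w) \<partial>M) = complex_of_real (exp (- (\<Sum>e\<in>I. (s e)\<^sup>2) / 2))"
      unfolding v unfolding X_def .
  qed
qed

subsection \<open>Hypercontractivity\<close>

lemma has_moments_hnorm_normal: "has_moments std_normal_distribution (hnorm n)"
  unfolding hnorm_eq_poly[abs_def] by (rule N.has_moments_poly[OF has_moments_normal_id])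

lemma hnorm_measurable [measurable]: "hnorm n \<in> borel_measurable borel"
  using has_moments_measurable[OF has_moments_hnorm_normal[of n]] by simp

lemma hnorm_integral: "(\<integral>x. hnorm n x \<partial>std_normal_distribution) = (if n = 0 then 1 else 0)"
  using hnorm_orthonormal[of n 0] by simp

text \<open>A positive r depending on q alone is all that the later steps ask for. Splitting off the
  constant term b 0 leaves r u with u centred; the term linear in u integrates to zero, and every
  other correction carries at least r^2, so a small r makes it fit under the square on the
  right.\<close>

lemma hypercontractive_1d:
  "\<exists>r::real. 0 < r \<and> r \<le> 1 \<and>
    (\<forall>b. (\<integral>x. (\<Sum>i\<le>q. r ^ i * hnorm i x * b i) ^ 4 \<partial>std_normal_distribution) \<le> (\<Sum>i\<le>q. (b i)\<^sup>2)\<^sup>2)"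
proof -
  define T where "T x = (\<Sum>i=1..q. (hnorm i x)\<^sup>2)" for x
  define M1 where "M1 = (\<integral>x. T x \<partial>std_normal_distribution)"
  define M2 where "M2 = (\<integral>x. (T x)\<^sup>2 \<partial>std_normal_distribution)"
  have T0: "0 \<le> T x" for x by (simp add: T_def sum_nonneg)
  have mT: "has_moments std_normal_distribution T"
    unfolding T_def[abs_def] by (intro N.has_moments_sum N.has_moments_power has_moments_hnorm_normal)
  have M0: "0 \<le> M1" "0 \<le> M2" using T0 by (auto simp: M1_def M2_def)
  \<comment> \<open>The choice ensures 4 r^2 M1 <= 1 and 3 r^4 M2 <= 1. The final bound is then at
    most b0^4 + 2 b0^2 S + S^2 = (b0^2 + S)^2.\<close>
  define r where "r = 1 / (2 + 4 * M1 + 3 * M2)"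
  have r: "0 < r" "r \<le> 1" using M0 by (auto simp: r_def field_simps)
  have r2: "r\<^sup>2 \<le> r" and r4: "r ^ 4 \<le> r"
    using power_decreasing[of 1 2 r] power_decreasing[of 1 4 r] r by auto
  have "r * (4 * M1) \<le> 1" "r * (3 * M2) \<le> 1" using M0 by (auto simp: r_def field_simps)
  then have k1: "4 * r\<^sup>2 * M1 \<le> 1" and k2: "3 * r ^ 4 * M2 \<le> 1"
    using mult_right_mono[OF r2, of "4 * M1"] mult_right_mono[OF r4, of "3 * M2"] M0 by auto
  show ?thesis
  proof (intro exI conjI allI)
    fix b :: "nat \<Rightarrow> real"
    define S where "S = (\<Sum>i=1..q. (b i)\<^sup>2)"
    \<comment> \<open>One factor r is taken out of every term with i >= 1; the remaining powers of r
      are at most 1, so Cauchy-Schwarz gives u^2 <= S T.\<close>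
    define u where "u x = (\<Sum>i=1..q. r ^ (i - 1) * b i * hnorm i x)" for x
    have S0: "0 \<le> S" by (simp add: S_def sum_nonneg)
    have mu: "has_moments std_normal_distribution u"
      unfolding u_def[abs_def] by (intro N.has_moments_sum N.has_moments_cmult has_moments_hnorm_normal)
    have split: "(\<Sum>i\<le>q. f i) = f 0 + (\<Sum>i=1..q. f i)" for f :: "nat \<Rightarrow> real"
      by (simp add: atMost_atLeast0 sum.atLeast_Suc_atMost)
    have eq: "(\<Sum>i\<le>q. r ^ i * hnorm i x * b i) = b 0 + r * u x" for x
    proof -
      have "(\<Sum>i=1..q. r ^ i * hnorm i x * b i) = r * u x"
        unfolding u_def sum_distrib_left
        by (intro sum.cong refl) (auto simp: power_eq_if)
      then show ?thesis by (simp add: split)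
    qed
    have u2: "(u x)\<^sup>2 \<le> S * T x" for x
    proof -
      have "(u x)\<^sup>2 \<le> (\<Sum>i=1..q. (r ^ (i - 1) * b i)\<^sup>2) * (\<Sum>i=1..q. (hnorm i x)\<^sup>2)"
        unfolding u_def by (rule Cauchy_Schwarz_ineq_sum)
      also have "(\<Sum>i=1..q. (r ^ (i - 1) * b i)\<^sup>2) \<le> S"
        unfolding S_def
      proof (intro sum_mono)
        fix i
        have "(r ^ (i - 1))\<^sup>2 \<le> 1\<^sup>2" using r by (intro power_mono power_le_one) auto
        then show "(r ^ (i - 1) * b i)\<^sup>2 \<le> (b i)\<^sup>2"
          using mult_right_mono[of "(r ^ (i - 1))\<^sup>2" 1 "(b i)\<^sup>2"] by (simp add: power_mult_distrib)
      qed
      finally show ?thesis using T0[of x] unfolding T_def by (meson mult_right_mono order_trans sum_nonneg zero_le_power2)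
    qed
    have u4: "u x ^ 4 \<le> S\<^sup>2 * (T x)\<^sup>2" for x
    proof -
      have "u x ^ 4 = ((u x)\<^sup>2)\<^sup>2" by simp
      also have "\<dots> \<le> (S * T x)\<^sup>2" by (rule power_mono[OF u2]) simp
      finally show ?thesis by (simp add: power_mult_distrib)
    qed
    have pw: "(b 0 + r * u x) ^ 4 \<le> b 0 ^ 4 + 4 * b 0 ^ 3 * r * u x + 8 * r\<^sup>2 * (b 0)\<^sup>2 * S * T x + 3 * r ^ 4 * S\<^sup>2 * (T x)\<^sup>2" for x
    proof -
      \<comment> \<open>In the binomial expansion the mixed term 4 a v^3 has no sign; it is absorbed
        by 4 a v^3 <= 2 a^2 v^2 + 2 v^4, whose defect is the square on the right.\<close>
      have "a ^ 4 + 4 * a ^ 3 * v + 8 * a\<^sup>2 * v\<^sup>2 + 3 * v ^ 4 - (a + v) ^ 4 = 2 * (v * (a - v))\<^sup>2" for a v :: real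
        by algebra
      from this[of "b 0" "r * u x"]
      have "(b 0 + r * u x) ^ 4 \<le> b 0 ^ 4 + 4 * b 0 ^ 3 * (r * u x) + 8 * (b 0)\<^sup>2 * (r * u x)\<^sup>2 + 3 * (r * u x) ^ 4"
        using zero_le_power2[of "r * u x * (b 0 - r * u x)"] by linarith
      moreover have "8 * (b 0)\<^sup>2 * (r * u x)\<^sup>2 \<le> 8 * r\<^sup>2 * (b 0)\<^sup>2 * S * T x"
        using mult_left_mono[OF u2[of x], of "8 * r\<^sup>2 * (b 0)\<^sup>2"] by (simp add: power_mult_distrib mult_ac)
      moreover have "3 * (r * u x) ^ 4 \<le> 3 * r ^ 4 * S\<^sup>2 * (T x)\<^sup>2"
        using mult_left_mono[OF u4[of x], of "3 * r ^ 4"] r by (simp add: power_mult_distrib mult_ac)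
      ultimately show ?thesis by (simp add: mult_ac)
    qed
    have iu: "integrable std_normal_distribution u" and iT: "integrable std_normal_distribution T"
      and iT2: "integrable std_normal_distribution (\<lambda>x. (T x)\<^sup>2)"
      using has_moments_integrable[OF mu] has_moments_integrable[OF mT] has_moments_power_integrable[OF mT] by auto
    have u0: "(\<integral>x. u x \<partial>std_normal_distribution) = 0"
      unfolding u_def using has_moments_integrable[OF has_moments_hnorm_normal]
      by (subst Bochner_Integration.integral_sum) (auto simp: hnorm_integral)
    have "(\<integral>x. (\<Sum>i\<le>q. r ^ i * hnorm i x * b i) ^ 4 \<partial>std_normal_distribution) \<le>
      (\<integral>x. b 0 ^ 4 + 4 * b 0 ^ 3 * r * u x + 8 * r\<^sup>2 * (b 0)\<^sup>2 * S * T x + 3 * r ^ 4 * S\<^sup>2 * (T x)\<^sup>2 \<partial>std_normal_distribution)"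
      unfolding eq
    proof (rule integral_mono)
      show "integrable std_normal_distribution (\<lambda>x. (b 0 + r * u x) ^ 4)"
        by (intro has_moments_power_integrable has_moments_add N.has_moments_const N.has_moments_cmult mu)
    qed (use iu iT iT2 pw in auto)
    also have "\<dots> = b 0 ^ 4 + 8 * r\<^sup>2 * (b 0)\<^sup>2 * S * M1 + 3 * r ^ 4 * S\<^sup>2 * M2"
      using iu iT iT2 u0 N.prob_space by (simp add: M1_def M2_def)
    also have "\<dots> \<le> b 0 ^ 4 + 2 * (b 0)\<^sup>2 * S + S\<^sup>2"
    proof -
      have "4 * r\<^sup>2 * M1 * (2 * (b 0)\<^sup>2 * S) \<le> 1 * (2 * (b 0)\<^sup>2 * S)"
        using S0 by (intro mult_right_mono k1) auto
      moreover have "3 * r ^ 4 * M2 * S\<^sup>2 \<le> 1 * S\<^sup>2"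
        by (intro mult_right_mono k2) auto
      ultimately show ?thesis by (simp add: mult_ac)
    qed
    also have "\<dots> = ((b 0)\<^sup>2 + S)\<^sup>2" by (simp add: power2_eq_square power4_eq_xxxx algebra_simps)
    also have "(b 0)\<^sup>2 + S = (\<Sum>i\<le>q. (b i)\<^sup>2)" by (simp add: split S_def)
    finally show "(\<integral>x. (\<Sum>i\<le>q. r ^ i * hnorm i x * b i) ^ 4 \<partial>std_normal_distribution) \<le> (\<Sum>i\<le>q. (b i)\<^sup>2)\<^sup>2" .
  qed (use r in auto)
qed

section \<open>Products of square-integrable functions\<close>

lemma L2_mult_integrable:
  fixes f g :: "'w \<Rightarrow> real"
  assumes [measurable]: "f \<in> borel_measurable M" "g \<in> borel_measurable M"
    and "integrable M (\<lambda>w. (f w)\<^sup>2)" "integrable M (\<lambda>w. (g w)\<^sup>2)"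
  shows "integrable M (\<lambda>w. f w * g w)"
proof (rule Bochner_Integration.integrable_bound[where f = "\<lambda>w. (f w)\<^sup>2 + (g w)\<^sup>2"])
  have "\<bar>x * y\<bar> \<le> x\<^sup>2 + y\<^sup>2" for x y :: real
    using sum_squares_bound[of "\<bar>x\<bar>" "\<bar>y\<bar>"] abs_ge_zero[of "x * y"]
    unfolding abs_mult power2_abs mult.assoc by linarith
  then show "AE w in M. norm (f w * g w) \<le> norm ((f w)\<^sup>2 + (g w)\<^sup>2)" by simp
qed (use assms in auto)

text \<open>This is Cauchy-Schwarz with prescribed bounds, obtained by integrating X Y <= (a/2) X^2
  + (1/(2a)) Y^2. The optimal weight is a = D/C; adding e to both bounds keeps it meaningful when C
  or D is zero, and e tends to 0 at the end.\<close>

lemma integral_mult_le_of_squares: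
  fixes X Y :: "'w \<Rightarrow> real"
  assumes X: "X \<in> borel_measurable M" and iX: "integrable M (\<lambda>w. (X w)\<^sup>2)"
    and Y: "Y \<in> borel_measurable M" and iY: "integrable M (\<lambda>w. (Y w)\<^sup>2)" and CD: "0 \<le> C" "0 \<le> D"
    and XC: "(\<integral>w. (X w)\<^sup>2 \<partial>M) \<le> C\<^sup>2" and YD: "(\<integral>w. (Y w)\<^sup>2 \<partial>M) \<le> D\<^sup>2"
  shows "(\<integral>w. X w * Y w \<partial>M) \<le> C * D"
proof -
  have iXY: "integrable M (\<lambda>w. X w * Y w)"
    by (rule L2_mult_integrable[OF X Y iX iY])
  have bnd: "(\<integral>w. X w * Y w \<partial>M) \<le> (C + e) * (D + e)" if e: "e > 0" for e
  proof -
    define a where "a = (D + e) / (C + e)"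
    have a: "a > 0" using CD e by (simp add: a_def)
    have pw: "X w * Y w \<le> a / 2 * (X w)\<^sup>2 + 1 / (2 * a) * (Y w)\<^sup>2" for w
    proof -
      have "0 \<le> (a * X w - Y w)\<^sup>2 / (2 * a)" using a by simp
      also have "\<dots> = a / 2 * (X w)\<^sup>2 + 1 / (2 * a) * (Y w)\<^sup>2 - X w * Y w"
        using a by (simp add: power2_eq_square field_simps)
      finally show ?thesis by simp
    qed
    have "(\<integral>w. X w * Y w \<partial>M) \<le> (\<integral>w. a / 2 * (X w)\<^sup>2 + 1 / (2 * a) * (Y w)\<^sup>2 \<partial>M)"
      using iX iY iXY pw by (intro integral_mono) auto
    also have "\<dots> = a / 2 * (\<integral>w. (X w)\<^sup>2 \<partial>M) + 1 / (2 * a) * (\<integral>w. (Y w)\<^sup>2 \<partial>M)"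
      using iX iY by simp
    also have "\<dots> \<le> a / 2 * (C + e)\<^sup>2 + 1 / (2 * a) * (D + e)\<^sup>2"
    proof -
      have "C\<^sup>2 \<le> (C + e)\<^sup>2" "D\<^sup>2 \<le> (D + e)\<^sup>2" using CD e by (auto intro!: power_mono)
      then show ?thesis using a XC YD by (intro add_mono mult_left_mono) auto
    qed
    also have "\<dots> = (C + e) * (D + e)"
    proof -
      have "y / x / 2 * x\<^sup>2 + 1 / (2 * (y / x)) * y\<^sup>2 = x * y" if "x > 0" "y > 0" for x y :: real
        using that by (simp add: power2_eq_square field_simps)
      from this[of "C + e" "D + e"] show ?thesis unfolding a_def using CD e by simp
    qed
    finally show ?thesis .
  qed
  have "((\<lambda>e. (C + e) * (D + e)) \<longlongrightarrow> (C + 0) * (D + 0)) (at_right 0)"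
    by (intro tendsto_intros)
  moreover have "\<forall>\<^sub>F e in at_right (0::real). (\<integral>w. X w * Y w \<partial>M) \<le> (C + e) * (D + e)"
    using bnd by (auto simp: eventually_at_right_less intro!: eventually_at_rightI[of 0 1])
  ultimately show ?thesis
    using tendsto_lowerbound[of "\<lambda>e. (C + e) * (D + e)" _ "at_right 0"] by simp
qed

text \<open>Each exponent is bounded separately, instead of the total degree, so that the index set
  is a Cartesian product over the coordinates and one coordinate can be peeled off at a time.
  Indices of total degree at most q form a subset of the box.\<close>

definition index_box :: "'i set \<Rightarrow> nat \<Rightarrow> ('i \<Rightarrow> nat) set" where
  "index_box E q = {a. (\<forall>e. e \<notin> E \<longrightarrow> a e = 0) \<and> (\<forall>e. a e \<le> q)}"

lemma index_box_empty: "index_box {} q = {\<lambda>_. 0}"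
  by (auto simp: index_box_def)

lemma index_box_insert:
  assumes "e \<notin> E"
  shows "inj_on (\<lambda>(i, a). a(e := i)) ({..q} \<times> index_box E q)"
    and "index_box (insert e E) q = (\<lambda>(i, a). a(e := i)) ` ({..q} \<times> index_box E q)"
proof -
  show "inj_on (\<lambda>(i, a). a(e := i)) ({..q} \<times> index_box E q)"
  proof (rule inj_onI, clarify)
    fix i j and a b :: "'a \<Rightarrow> nat"
    assume ab: "a \<in> index_box E q" "b \<in> index_box E q" and eq: "a(e := i) = b(e := j)"
    have "a d = b d" for d
      using fun_cong[OF eq, of d] ab assms by (cases "d = e") (auto simp: index_box_def)
    then show "i = j \<and> a = b" using fun_cong[OF eq, of e] by auto
  qed
  show "index_box (insert e E) q = (\<lambda>(i, a). a(e := i)) ` ({..q} \<times> index_box E q)"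
  proof (intro equalityI subsetI)
    fix a assume a: "a \<in> index_box (insert e E) q"
    then have "a = (\<lambda>(i, a). a(e := i)) (a e, a(e := 0))" "(a e, a(e := 0)) \<in> {..q} \<times> index_box E q"
      by (auto simp: index_box_def)
    then show "a \<in> (\<lambda>(i, a). a(e := i)) ` ({..q} \<times> index_box E q)" by blast
  qed (auto simp: index_box_def)
qed

lemma finite_index_box: "finite E \<Longrightarrow> finite (index_box E q)"
  by (induction E rule: finite_induct) (simp_all add: index_box_empty index_box_insert(2))

lemma sum_index_box_insert:
  assumes "e \<notin> E"
  shows "(\<Sum>a\<in>index_box (insert e E) q. f a) = (\<Sum>i\<le>q. \<Sum>a\<in>index_box E q. f (a(e := i)))"
  unfolding index_box_insert(2)[OF assms] sum.reindex[OF index_box_insert(1)[OF assms]]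
  by (simp add: sum.cartesian_product case_prod_unfold)

section \<open>Chaos elements as products over finitely many coordinates\<close>

lemma chaos_elem_prod:
  assumes "finite E" "{e. a e \<noteq> 0} \<subseteq> E"
  shows "chaos_elem V a w = (\<Prod>e\<in>E. hnorm (a e) (V e w))"
  unfolding chaos_elem_def hnorm_def[symmetric]
  by (rule prod.mono_neutral_left) (use assms in auto)

lemma iid_normal_has_moments_hnorm:
  assumes "iid_normal M V B" "e \<in> B"
  shows "has_moments M (\<lambda>w. hnorm n (V e w))"
  using assms has_moments_hnorm_normal[of n] has_moments_distr[of "V e" M "hnorm n"]
  by (simp add: iid_normal_def iid_normal_measurable[OF assms])

lemma chaos_elem_has_moments:
  assumes V: "iid_normal M V B" and a: "finite {e. a e \<noteq> 0}" "{e. a e \<noteq> 0} \<subseteq> B"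
  shows "has_moments M (chaos_elem V a)"
proof -
  interpret prob_space M using V by (simp add: iid_normal_def)
  show ?thesis
    unfolding chaos_elem_prod[OF a(1) subset_refl, abs_def]
    using a V by (intro has_moments_prod iid_normal_has_moments_hnorm[of M V B]) auto
qed

lemma chaos_elem_orthonormal:
  assumes V: "iid_normal M V B" and a: "finite {e. a e \<noteq> 0}" "{e. a e \<noteq> 0} \<subseteq> B"
    and b: "finite {e. b e \<noteq> 0}" "{e. b e \<noteq> 0} \<subseteq> B"
  shows "(\<integral>w. chaos_elem V a w * chaos_elem V b w \<partial>M) = (if a = b then 1 else 0)"
proof -
  define E where "E = {e. a e \<noteq> 0} \<union> {e. b e \<noteq> 0}"
  have E: "finite E" "E \<subseteq> B" "{e. a e \<noteq> 0} \<subseteq> E" "{e. b e \<noteq> 0} \<subseteq> E" using a b by (auto simp: E_def)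
  have "(\<integral>w. chaos_elem V a w * chaos_elem V b w \<partial>M) = (\<integral>w. (\<Prod>e\<in>E. hnorm (a e) (V e w) * hnorm (b e) (V e w)) \<partial>M)"
    by (simp add: chaos_elem_prod[OF E(1) E(3)] chaos_elem_prod[OF E(1) E(4)] prod.distrib)
  also have "\<dots> = (\<Prod>e\<in>E. \<integral>x. hnorm (a e) x * hnorm (b e) x \<partial>std_normal_distribution)"
    by (rule iid_normal_prod_integral(1)[OF V E(1,2)])
      (auto intro!: has_moments_integrable has_moments_mult has_moments_hnorm_normal)
  also have "\<dots> = (\<Prod>e\<in>E. if a e = b e then 1 else 0)"
    by (simp only: hnorm_orthonormal)
  also have "\<dots> = (if a = b then 1 else 0)"
  proof (cases "a = b")
    case False
    then obtain e where e: "a e \<noteq> b e" by auto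
    then have "e \<in> E" by (auto simp: E_def)
    then show ?thesis using E(1) e False by (auto simp: prod_zero_iff)
  qed auto
  finally show ?thesis .
qed

lemma chaos_elem_upd:
  assumes "finite E" "e \<notin> E" "a \<in> index_box E q"
  shows "chaos_elem V (a(e := i)) w = hnorm i (V e w) * chaos_elem V a w"
proof -
  have "chaos_elem V (a(e := i)) w = (\<Prod>d\<in>insert e E. hnorm ((a(e := i)) d) (V d w))"
    using assms by (intro chaos_elem_prod) (auto simp: index_box_def)
  also have "\<dots> = hnorm i (V e w) * (\<Prod>d\<in>E. hnorm (a d) (V d w))"
    using assms by (subst prod.insert) (auto intro!: prod.cong)
  also have "(\<Prod>d\<in>E. hnorm (a d) (V d w)) = chaos_elem V a w"
    using assms by (intro chaos_elem_prod[symmetric]) (auto simp: index_box_def)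
  finally show ?thesis .
qed

text \<open>The coordinate \<open>e\<close> is independent of the block \<open>E\<close>, so the
  joint law is a product and the integral over coordinate \<open>e\<close> can be done for fixed
  values y of the others. There the one-dimensional inequality applies with coefficients
  \<open>g i y\<close>.\<close>

lemma iid_normal_fourth_moment_step:
  fixes g :: "nat \<Rightarrow> ('i \<Rightarrow> real) \<Rightarrow> real"
  assumes V: "iid_normal M V B" and E: "insert e E \<subseteq> B" "e \<notin> E"
    and g [measurable]: "\<And>i. g i \<in> borel_measurable (PiM E (\<lambda>_. borel))"
    and gm: "\<And>i. has_moments M (\<lambda>w. g i (\<lambda>d\<in>E. V d w))"
    and r: "\<And>b. (\<integral>x. (\<Sum>i\<le>q. r ^ i * hnorm i x * b i) ^ 4 \<partial>std_normal_distribution) \<le> (\<Sum>i\<le>q. (b i)\<^sup>2)\<^sup>2"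
  shows "(\<integral>w. (\<Sum>i\<le>q. r ^ i * hnorm i (V e w) * g i (\<lambda>d\<in>E. V d w)) ^ 4 \<partial>M) \<le>
    (\<integral>w. (\<Sum>i\<le>q. (g i (\<lambda>d\<in>E. V d w))\<^sup>2)\<^sup>2 \<partial>M)"
proof -
  interpret prob_space M using V by (simp add: iid_normal_def)
  have rv [measurable]: "V d \<in> borel_measurable M" if "d \<in> insert e E" for d
    using iid_normal_measurable[OF V] E that by auto
  define Y where "Y w = (\<lambda>d\<in>E. V d w)" for w
  have Y [measurable]: "Y \<in> measurable M (PiM E (\<lambda>_. borel))"
    unfolding Y_def[abs_def] by (intro measurable_restrict) (use rv in auto)
  have X [measurable]: "(\<lambda>w. \<lambda>d\<in>{e}. V d w) \<in> measurable M (PiM {e} (\<lambda>_. borel))"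
    by (intro measurable_restrict) (use rv in auto)
  have c: "(\<lambda>x. x e) \<in> measurable (PiM {e} (\<lambda>_. borel :: real measure)) borel"
    by (rule measurable_component_singleton) simp
  have "indep_var (PiM {e} (\<lambda>_. borel)) (\<lambda>w. \<lambda>d\<in>{e}. V d w) (PiM E (\<lambda>_. borel)) Y"
    unfolding Y_def[abs_def] using V E by (intro indep_var_restrict[where I = B]) (auto simp: iid_normal_def)
  then have J: "distr M (PiM {e} (\<lambda>_. borel)) (\<lambda>w. \<lambda>d\<in>{e}. V d w) \<Otimes>\<^sub>M distr M (PiM E (\<lambda>_. borel)) Y =
      distr M (PiM {e} (\<lambda>_. borel) \<Otimes>\<^sub>M PiM E (\<lambda>_. borel)) (\<lambda>w. (\<lambda>d\<in>{e}. V d w, Y w))"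
    unfolding indep_var_distribution_eq by simp
  let ?X = "distr M (PiM {e} (\<lambda>_. borel)) (\<lambda>w. \<lambda>d\<in>{e}. V d w)" and ?Y = "distr M (PiM E (\<lambda>_. borel)) Y"
  interpret X: prob_space ?X by (rule prob_space_distr) measurable
  interpret Y: prob_space ?Y by (rule prob_space_distr) measurable
  interpret P: pair_prob_space ?X ?Y ..
  define h where "h x y = (\<Sum>i\<le>q. r ^ i * hnorm i (x e) * g i y) ^ 4" for x :: "'i \<Rightarrow> real" and y
  have hm [measurable]: "case_prod h \<in> borel_measurable (PiM {e} (\<lambda>_. borel) \<Otimes>\<^sub>M PiM E (\<lambda>_. borel))"
    unfolding h_def[abs_def] case_prod_unfold by measurable
  have pm: "(\<lambda>w. (\<lambda>d\<in>{e}. V d w, Y w)) \<in> measurable M (PiM {e} (\<lambda>_. borel) \<Otimes>\<^sub>M PiM E (\<lambda>_. borel))" by measurable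
  have hN: "(\<integral>x. h x y \<partial>?X) = (\<integral>x. (\<Sum>i\<le>q. r ^ i * hnorm i x * g i y) ^ 4 \<partial>std_normal_distribution)" for y
  proof -
    have "(\<integral>x. h x y \<partial>?X) = (\<integral>w. (\<Sum>i\<le>q. r ^ i * hnorm i (V e w) * g i y) ^ 4 \<partial>M)"
      unfolding h_def by (subst integral_distr) auto
    also have "\<dots> = (\<integral>x. (\<Sum>i\<le>q. r ^ i * hnorm i x * g i y) ^ 4 \<partial>distr M borel (V e))"
      using rv[of e] by (subst integral_distr) auto
    also have "distr M borel (V e) = std_normal_distribution" using V E by (auto simp: iid_normal_def)
    finally show ?thesis .
  qed
  have mom: "has_moments M (\<lambda>w. \<Sum>i\<le>q. r ^ i * hnorm i (V e w) * g i (Y w))"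
    using V E gm unfolding Y_def
    by (intro has_moments_sum has_moments_mult has_moments_const iid_normal_has_moments_hnorm[of M V B]) auto
  have i: "integrable (?X \<Otimes>\<^sub>M ?Y) (case_prod h)"
    unfolding J using has_moments_power_integrable[OF mom, of 4]
    by (subst integrable_distr_eq[OF pm hm]) (simp add: h_def)
  have "(\<integral>w. (\<Sum>i\<le>q. r ^ i * hnorm i (V e w) * g i (Y w)) ^ 4 \<partial>M) = integral\<^sup>L (?X \<Otimes>\<^sub>M ?Y) (case_prod h)"
    unfolding J by (subst integral_distr[OF pm hm]) (simp add: h_def)
  also have "\<dots> = (\<integral>y. (\<integral>x. h x y \<partial>?X) \<partial>?Y)"
    by (rule P.integral_snd[OF i, symmetric])
  also have "\<dots> \<le> (\<integral>y. (\<Sum>i\<le>q. (g i y)\<^sup>2)\<^sup>2 \<partial>?Y)"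
  proof (rule integral_mono)
    show "integrable ?Y (\<lambda>y. \<integral>x. h x y \<partial>?X)" by (rule P.integrable_snd[OF i])
    have "has_moments M (\<lambda>w. \<Sum>i\<le>q. (g i (Y w))\<^sup>2)"
      unfolding Y_def by (intro has_moments_sum has_moments_power gm)
    then show "integrable ?Y (\<lambda>y. (\<Sum>i\<le>q. (g i y)\<^sup>2)\<^sup>2)"
      by (subst integrable_distr_eq) (auto dest: has_moments_power_integrable)
    show "(\<integral>x. h x y \<partial>?X) \<le> (\<Sum>i\<le>q. (g i y)\<^sup>2)\<^sup>2" for y
      unfolding hN by (rule r)
  qed
  also have "\<dots> = (\<integral>w. (\<Sum>i\<le>q. (g i (Y w))\<^sup>2)\<^sup>2 \<partial>M)"
    by (subst integral_distr) auto
  finally show ?thesis unfolding Y_def .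
qed

text \<open>Tensorisation by induction on the coordinates. The step lemma bounds the fourth moment
  by E[(sum of g_i^2)^2]; expanding the square gives terms E[g_i^2 g_j^2], Cauchy-Schwarz separates
  them into fourth moments, and the induction hypothesis bounds E[g_i^4] by C_i^2. The sum of C_i
  C_j is the square of the total coefficient sum.\<close>

lemma hypercontractive_box:
  assumes V: "iid_normal M V B" and E: "finite E" "E \<subseteq> B"
    and r: "\<And>b. (\<integral>x. (\<Sum>i\<le>q. r ^ i * hnorm i x * b i) ^ 4 \<partial>std_normal_distribution) \<le> (\<Sum>i\<le>q. (b i)\<^sup>2)\<^sup>2"
  shows "(\<integral>w. (\<Sum>a\<in>index_box E q. r ^ (\<Sum>e\<in>E. a e) * c a * chaos_elem V a w) ^ 4 \<partial>M) \<le> (\<Sum>a\<in>index_box E q. (c a)\<^sup>2)\<^sup>2"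
  using E
proof (induction E arbitrary: c rule: finite_induct)
  case empty
  interpret prob_space M using V by (simp add: iid_normal_def)
  show ?case by (simp add: index_box_empty chaos_elem_def prob_space)
next
  case (insert e E)
  interpret prob_space M using V by (simp add: iid_normal_def)
  have EB: "E \<subseteq> B" using insert.prems by auto
  \<comment> \<open>This is the coefficient of the i-th Hermite factor in the new coordinate. It is
    a function of a point y of the product space, with the coordinate maps as process, so that it
    can be frozen under the integral.\<close>
  define g where "g i y = (\<Sum>a\<in>index_box E q. r ^ (\<Sum>d\<in>E. a d) * c (a(e := i)) * chaos_elem (\<lambda>d y. y d) a y)" for i and y :: "'b \<Rightarrow> real"
  have supp: "{d. a d \<noteq> 0} \<subseteq> E" if "a \<in> index_box E q" for a using that by (auto simp: index_box_def)
  have ce: "chaos_elem (\<lambda>d y. y d) a (\<lambda>d\<in>E. V d w) = chaos_elem V a w" if "a \<in> index_box E q" for a w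
    unfolding chaos_elem_prod[OF insert.hyps(1) supp[OF that]] by simp
  have gV: "g i (\<lambda>d\<in>E. V d w) = (\<Sum>a\<in>index_box E q. r ^ (\<Sum>d\<in>E. a d) * c (a(e := i)) * chaos_elem V a w)" for i w
    unfolding g_def by (intro sum.cong refl) (simp add: ce)
  have gmeas: "g i \<in> borel_measurable (PiM E (\<lambda>_. borel))" for i
    unfolding g_def[abs_def]
  proof (intro borel_measurable_sum borel_measurable_times borel_measurable_const)
    fix a assume "a \<in> index_box E q"
    then have *: "chaos_elem (\<lambda>d y. y d) a = (\<lambda>y. \<Prod>d\<in>E. hnorm (a d) (y d))"
      by (intro ext chaos_elem_prod insert.hyps(1) supp)
    show "chaos_elem (\<lambda>d y. y d) a \<in> borel_measurable (PiM E (\<lambda>_. borel))"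
      unfolding *
      by (intro borel_measurable_prod measurable_compose[OF _ hnorm_measurable] measurable_component_singleton)
  qed
  have gm: "has_moments M (\<lambda>w. g i (\<lambda>d\<in>E. V d w))" for i
    unfolding gV using insert.hyps supp EB
    by (intro has_moments_sum has_moments_cmult chaos_elem_has_moments[OF V]) (auto intro: finite_subset)
  define C where "C i = (\<Sum>a\<in>index_box E q. (c (a(e := i)))\<^sup>2)" for i
  have C0: "0 \<le> C i" for i by (simp add: C_def sum_nonneg)
  have sumV: "(\<Sum>a\<in>index_box (insert e E) q. r ^ (\<Sum>d\<in>insert e E. a d) * c a * chaos_elem V a w) =
      (\<Sum>i\<le>q. r ^ i * hnorm i (V e w) * g i (\<lambda>d\<in>E. V d w))" for w
  proof -
    have "(\<Sum>a\<in>index_box (insert e E) q. r ^ (\<Sum>d\<in>insert e E. a d) * c a * chaos_elem V a w) =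
      (\<Sum>i\<le>q. \<Sum>a\<in>index_box E q. r ^ (\<Sum>d\<in>insert e E. (a(e := i)) d) * c (a(e := i)) * chaos_elem V (a(e := i)) w)"
      by (rule sum_index_box_insert[OF insert.hyps(2)])
    also have "\<dots> = (\<Sum>i\<le>q. \<Sum>a\<in>index_box E q. r ^ i * hnorm i (V e w) * (r ^ (\<Sum>d\<in>E. a d) * c (a(e := i)) * chaos_elem V a w))"
    proof (intro sum.cong refl)
      fix i a assume a: "a \<in> index_box E q"
      have "(\<Sum>d\<in>insert e E. (a(e := i)) d) = i + (\<Sum>d\<in>E. a d)"
        using insert.hyps by (subst sum.insert) (auto intro!: sum.cong)
      then show "r ^ (\<Sum>d\<in>insert e E. (a(e := i)) d) * c (a(e := i)) * chaos_elem V (a(e := i)) w =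
        r ^ i * hnorm i (V e w) * (r ^ (\<Sum>d\<in>E. a d) * c (a(e := i)) * chaos_elem V a w)"
        by (simp add: chaos_elem_upd[OF insert.hyps(1,2) a] power_add mult_ac del: fun_upd_apply)
    qed
    finally show ?thesis unfolding gV sum_distrib_left .
  qed
  have "(\<integral>w. (\<Sum>a\<in>index_box (insert e E) q. r ^ (\<Sum>d\<in>insert e E. a d) * c a * chaos_elem V a w) ^ 4 \<partial>M) \<le>
    (\<integral>w. (\<Sum>i\<le>q. (g i (\<lambda>d\<in>E. V d w))\<^sup>2)\<^sup>2 \<partial>M)"
    unfolding sumV by (rule iid_normal_fourth_moment_step[OF V insert.prems insert.hyps(2) gmeas gm r])
  also have "\<dots> = (\<integral>w. (\<Sum>i\<le>q. \<Sum>j\<le>q. (g i (\<lambda>d\<in>E. V d w))\<^sup>2 * (g j (\<lambda>d\<in>E. V d w))\<^sup>2) \<partial>M)"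
    by (simp add: power2_eq_square[of "sum _ _"] sum_product)
  also have "\<dots> = (\<Sum>i\<le>q. \<Sum>j\<le>q. \<integral>w. (g i (\<lambda>d\<in>E. V d w))\<^sup>2 * (g j (\<lambda>d\<in>E. V d w))\<^sup>2 \<partial>M)"
  proof -
    have "integrable M (\<lambda>w. (g i (\<lambda>d\<in>E. V d w))\<^sup>2 * (g j (\<lambda>d\<in>E. V d w))\<^sup>2)" for i j
      by (intro has_moments_integrable has_moments_mult has_moments_power gm)
    then show ?thesis by (subst Bochner_Integration.integral_sum; simp)
  qed
  also have "\<dots> \<le> (\<Sum>i\<le>q. \<Sum>j\<le>q. C i * C j)"
  proof (intro sum_mono integral_mult_le_of_squares C0 has_moments_measurable[OF has_moments_power[OF gm]]
      has_moments_power_integrable[OF has_moments_power[OF gm]])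
    fix i
    show "(\<integral>w. ((g i (\<lambda>d\<in>E. V d w))\<^sup>2)\<^sup>2 \<partial>M) \<le> (C i)\<^sup>2"
      using insert.IH[OF EB, of "\<lambda>a. c (a(e := i))"] unfolding gV C_def by simp
    show "(\<integral>w. ((g i (\<lambda>d\<in>E. V d w))\<^sup>2)\<^sup>2 \<partial>M) \<le> (C i)\<^sup>2"
      using insert.IH[OF EB, of "\<lambda>a. c (a(e := i))"] unfolding gV C_def by simp
  qed
  also have "\<dots> = (\<Sum>i\<le>q. C i)\<^sup>2" by (simp add: power2_eq_square sum_product)
  also have "(\<Sum>i\<le>q. C i) = (\<Sum>a\<in>index_box (insert e E) q. (c a)\<^sup>2)"
    unfolding C_def by (rule sum_index_box_insert[OF insert.hyps(2), symmetric])
  finally show ?case .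
qed

subsection \<open>Almost sure convergence of finite chaos expansions\<close>

definition finite_indices :: "'i set \<Rightarrow> ('i \<Rightarrow> nat) set" where
  "finite_indices B = {a. finite {e. a e \<noteq> 0} \<and> {e. a e \<noteq> 0} \<subseteq> B}"

definition indices_upto :: "'i set \<Rightarrow> nat \<Rightarrow> ('i \<Rightarrow> nat) set" where
  "indices_upto B q = (\<Union>p\<le>q. multi_indices B p)"

text \<open>An arbitrary index set \<open>I\<close> covers both a single chaos and all degrees up to
  q at once; the latter is what remains when a chaos element is shifted by frozen values.\<close>

definition chaos_comb :: "('i \<Rightarrow> 'w \<Rightarrow> real) \<Rightarrow> ('i \<Rightarrow> nat) set \<Rightarrow> ('w \<Rightarrow> real) set" where
  "chaos_comb V I = {Y. \<exists>A c. finite A \<and> A \<subseteq> I \<and> Y = (\<lambda>w. \<Sum>a\<in>A. c a * chaos_elem V a w)}"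

lemma chaos_span_eq_comb: "chaos_span V B p = chaos_comb V (multi_indices B p)"
  by (simp add: chaos_span_def chaos_comb_def)

lemma multi_indices_finite_indices: "multi_indices B p \<subseteq> finite_indices B"
  by (auto simp: multi_indices_def finite_indices_def)

lemma multi_indices_upto: "p \<le> q \<Longrightarrow> multi_indices B p \<subseteq> indices_upto B q"
  by (auto simp: indices_upto_def)

lemma indices_upto_finite_indices: "indices_upto B q \<subseteq> finite_indices B"
  by (auto simp: indices_upto_def multi_indices_def finite_indices_def)

lemma sum_multi_index:
  assumes "a \<in> multi_indices B p" "finite E" "{e. a e \<noteq> 0} \<subseteq> E"
  shows "(\<Sum>e\<in>E. a e) = p"
proof -
  have "(\<Sum>e\<in>{e. a e \<noteq> 0}. a e) = (\<Sum>e\<in>E. a e)"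
    by (rule sum.mono_neutral_left) (use assms in auto)
  then show ?thesis using assms(1) by (simp add: multi_indices_def)
qed

lemma chaos_comb_mono: "I \<subseteq> J \<Longrightarrow> chaos_comb V I \<subseteq> chaos_comb V J"
  unfolding chaos_comb_def by blast

lemma chaos_comb_elem: "a \<in> I \<Longrightarrow> chaos_elem V a \<in> chaos_comb V I"
  unfolding chaos_comb_def by (auto intro!: exI[of _ "{a}"] exI[of _ "\<lambda>_. 1"])

lemma chaos_comb_zero: "(\<lambda>_. 0) \<in> chaos_comb V I"
  unfolding chaos_comb_def by (auto intro!: exI[of _ "{}"])

lemma chaos_comb_cmult: "f \<in> chaos_comb V I \<Longrightarrow> (\<lambda>w. k * f w) \<in> chaos_comb V I"
proof -
  assume "f \<in> chaos_comb V I"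
  then obtain A c where "finite A" "A \<subseteq> I" "f = (\<lambda>w. \<Sum>a\<in>A. c a * chaos_elem V a w)"
    by (auto simp: chaos_comb_def)
  then show ?thesis
    unfolding chaos_comb_def
    by (auto intro!: exI[of _ A] exI[of _ "\<lambda>a. k * c a"] simp: sum_distrib_left mult_ac)
qed

lemma chaos_comb_add:
  assumes "f \<in> chaos_comb V I" "g \<in> chaos_comb V I"
  shows "(\<lambda>w. f w + g w) \<in> chaos_comb V I"
proof -
  obtain A c where A: "finite A" "A \<subseteq> I" "f = (\<lambda>w. \<Sum>a\<in>A. c a * chaos_elem V a w)"
    using assms(1) by (auto simp: chaos_comb_def)
  obtain A' c' where A': "finite A'" "A' \<subseteq> I" "g = (\<lambda>w. \<Sum>a\<in>A'. c' a * chaos_elem V a w)"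
    using assms(2) by (auto simp: chaos_comb_def)
  define d where "d a = (if a \<in> A then c a else 0) + (if a \<in> A' then c' a else 0)" for a
  have 1: "(\<Sum>a\<in>A. c a * chaos_elem V a w) = (\<Sum>a\<in>A \<union> A'. (if a \<in> A then c a else 0) * chaos_elem V a w)" for w
    by (intro sum.mono_neutral_cong_left) (use A A' in auto)
  have 2: "(\<Sum>a\<in>A'. c' a * chaos_elem V a w) = (\<Sum>a\<in>A \<union> A'. (if a \<in> A' then c' a else 0) * chaos_elem V a w)" for w
    by (intro sum.mono_neutral_cong_left) (use A A' in auto)
  have "(\<lambda>w. f w + g w) = (\<lambda>w. \<Sum>a\<in>A \<union> A'. d a * chaos_elem V a w)"
    unfolding A(3) A'(3) 1 2 by (simp add: d_def sum.distrib[symmetric] distrib_right)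
  then show ?thesis using A A' unfolding chaos_comb_def by blast
qed

lemma chaos_comb_diff:
  "f \<in> chaos_comb V I \<Longrightarrow> g \<in> chaos_comb V I \<Longrightarrow> (\<lambda>w. f w - g w) \<in> chaos_comb V I"
  using chaos_comb_add[of f V I "\<lambda>w. (-1) * g w"] chaos_comb_cmult[of g V I "-1"] by simp

lemma chaos_comb_sum:
  "(\<And>i. i \<in> S \<Longrightarrow> f i \<in> chaos_comb V I) \<Longrightarrow> (\<lambda>w. \<Sum>i\<in>S. f i w) \<in> chaos_comb V I"
  by (induction S rule: infinite_finite_induct) (auto intro: chaos_comb_zero chaos_comb_add)

lemma chaos_comb_has_moments:
  assumes V: "iid_normal M V B" and f: "f \<in> chaos_comb V I" and I: "I \<subseteq> finite_indices B"
  shows "has_moments M f"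
proof -
  interpret prob_space M using V by (simp add: iid_normal_def)
  obtain A c where A: "finite A" "A \<subseteq> I" "f = (\<lambda>w. \<Sum>a\<in>A. c a * chaos_elem V a w)"
    using f by (auto simp: chaos_comb_def)
  show ?thesis
    unfolding A(3) using A(2) I
    by (intro has_moments_sum has_moments_cmult chaos_elem_has_moments[OF V]) (auto simp: finite_indices_def)
qed

lemma chaos_comb_inner:
  assumes V: "iid_normal M V B" and A: "finite A" "A \<subseteq> finite_indices B" and A': "finite A'" "A' \<subseteq> finite_indices B"
  shows "(\<integral>w. (\<Sum>a\<in>A. c a * chaos_elem V a w) * (\<Sum>a\<in>A'. d a * chaos_elem V a w) \<partial>M) = (\<Sum>a\<in>A \<inter> A'. c a * d a)"
proof -
  have i: "integrable M (\<lambda>w. chaos_elem V a w * chaos_elem V b w)" if "a \<in> A" "b \<in> A'" for a b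
    using that A A' by (intro has_moments_integrable has_moments_mult chaos_elem_has_moments[OF V]) (auto simp: finite_indices_def)
  have "(\<integral>w. (\<Sum>a\<in>A. c a * chaos_elem V a w) * (\<Sum>a\<in>A'. d a * chaos_elem V a w) \<partial>M) =
    (\<integral>w. (\<Sum>a\<in>A. \<Sum>b\<in>A'. c a * d b * (chaos_elem V a w * chaos_elem V b w)) \<partial>M)"
    by (simp add: sum_product mult_ac)
  also have "\<dots> = (\<Sum>a\<in>A. \<Sum>b\<in>A'. c a * d b * (\<integral>w. chaos_elem V a w * chaos_elem V b w \<partial>M))"
    using i by (subst Bochner_Integration.integral_sum; simp)+
  also have "\<dots> = (\<Sum>a\<in>A. \<Sum>b\<in>A'. if b = a then c a * d b else 0)"
  proof (intro sum.cong refl)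
    fix a b assume "a \<in> A" "b \<in> A'"
    then show "c a * d b * (\<integral>w. chaos_elem V a w * chaos_elem V b w \<partial>M) = (if b = a then c a * d b else 0)"
      using A A' by (subst chaos_elem_orthonormal[OF V]) (auto simp: finite_indices_def)
  qed
  also have "\<dots> = (\<Sum>a\<in>A. if a \<in> A' then c a * d a else 0)"
    using A' by (intro sum.cong refl) (simp add: sum.delta)
  also have "\<dots> = (\<Sum>a\<in>A \<inter> A'. c a * d a)"
    using A by (simp add: sum.inter_restrict)
  finally show ?thesis .
qed

text \<open>Hypercontractivity bounds the fourth moment of a damped expansion. Undoing the damping
  divides the coefficient of a by r to the degree of a, which is at most q, so squared coefficients
  grow by at most r^(-2q). The quantifier order records that K is uniform in the process, the index
  set and f.\<close>

lemma chaos_comb_fourth_moment: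
  "\<exists>K>0. \<forall>(M :: 'w measure) (V :: 'i \<Rightarrow> 'w \<Rightarrow> real) B f. iid_normal M V B \<longrightarrow> f \<in> chaos_comb V (indices_upto B q) \<longrightarrow>
    (\<integral>w. f w ^ 4 \<partial>M) \<le> K * (\<integral>w. (f w)\<^sup>2 \<partial>M)\<^sup>2"
proof -
  obtain r :: real where r: "0 < r" "r \<le> 1"
    and r1: "\<And>b. (\<integral>x. (\<Sum>i\<le>q. r ^ i * hnorm i x * b i) ^ 4 \<partial>std_normal_distribution) \<le> (\<Sum>i\<le>q. (b i)\<^sup>2)\<^sup>2"
    using hypercontractive_1d[of q] by blast
  show ?thesis
  proof (intro exI[of _ "(1 / r ^ (2 * q))\<^sup>2"] conjI allI impI)
    fix M :: "'w measure" and V :: "'i \<Rightarrow> 'w \<Rightarrow> real" and B f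
    assume V: "iid_normal M V B" and f: "f \<in> chaos_comb V (indices_upto B q)"
    then obtain A c where A: "finite A" "A \<subseteq> indices_upto B q" "f = (\<lambda>w. \<Sum>a\<in>A. c a * chaos_elem V a w)"
      by (auto simp: chaos_comb_def)
    define E where "E = (\<Union>a\<in>A. {e. a e \<noteq> 0})"
    have E: "finite E" "E \<subseteq> B" and supp: "\<And>a. a \<in> A \<Longrightarrow> {e. a e \<noteq> 0} \<subseteq> E"
      using A by (auto simp: E_def indices_upto_def multi_indices_def)
    have deg: "(\<Sum>e\<in>E. a e) \<le> q" if "a \<in> A" for a
      using sum_multi_index[OF _ E(1) supp[OF that]] A(2) that by (auto simp: indices_upto_def)
    have box: "A \<subseteq> index_box E q"
    proof
      fix a assume a: "a \<in> A"
      have "a e \<le> q" for e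
      proof (cases "e \<in> E")
        case True
        then show ?thesis using member_le_sum[of e E a] E(1) deg[OF a] by auto
      next
        case False
        then have "a e = 0" using supp[OF a] by blast
        then show ?thesis by simp
      qed
      then show "a \<in> index_box E q" using supp[OF a] by (auto simp: index_box_def)
    qed
    \<comment> \<open>The division compensates the damping factor in
      \<open>hypercontractive_box\<close>, and zeros extend the expansion from \<open>A\<close> to
      the whole box.\<close>
    define c' where "c' a = (if a \<in> A then c a / r ^ (\<Sum>e\<in>E. a e) else 0)" for a
    have feq: "f w = (\<Sum>a\<in>index_box E q. r ^ (\<Sum>e\<in>E. a e) * c' a * chaos_elem V a w)" for w
      unfolding A(3) by (rule sum.mono_neutral_cong_left) (use finite_index_box[OF E(1)] box r in \<open>auto simp: c'_def\<close>)
    have f2: "(\<integral>w. (f w)\<^sup>2 \<partial>M) = (\<Sum>a\<in>A. (c a)\<^sup>2)"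
      using chaos_comb_inner[OF V A(1) _ A(1), of c c] A(2) indices_upto_finite_indices[of B q]
      by (auto simp: A(3) power2_eq_square)
    have "(\<integral>w. f w ^ 4 \<partial>M) \<le> (\<Sum>a\<in>index_box E q. (c' a)\<^sup>2)\<^sup>2"
      unfolding feq by (rule hypercontractive_box[OF V E r1])
    also have "(\<Sum>a\<in>index_box E q. (c' a)\<^sup>2) = (\<Sum>a\<in>A. (c a / r ^ (\<Sum>e\<in>E. a e))\<^sup>2)"
      by (rule sum.mono_neutral_cong_right) (use finite_index_box[OF E(1)] box in \<open>auto simp: c'_def\<close>)
    also have "\<dots>\<^sup>2 \<le> (\<Sum>a\<in>A. 1 / r ^ (2 * q) * (c a)\<^sup>2)\<^sup>2"
    proof (intro power_mono sum_mono sum_nonneg)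
      fix a assume "a \<in> A"
      then have "r ^ (2 * q) \<le> r ^ (2 * (\<Sum>e\<in>E. a e))"
        using r deg by (intro power_decreasing) auto
      then have "(c a)\<^sup>2 / r ^ (2 * (\<Sum>e\<in>E. a e)) \<le> (c a)\<^sup>2 / r ^ (2 * q)"
        using r by (intro divide_left_mono) auto
      then show "(c a / r ^ (\<Sum>e\<in>E. a e))\<^sup>2 \<le> 1 / r ^ (2 * q) * (c a)\<^sup>2"
        by (simp add: power_divide power_even_eq)
    qed auto
    also have "\<dots> = (1 / r ^ (2 * q))\<^sup>2 * (\<integral>w. (f w)\<^sup>2 \<partial>M)\<^sup>2"
      unfolding f2 by (simp only: sum_distrib_left[symmetric] power_mult_distrib)
    finally show "(\<integral>w. f w ^ 4 \<partial>M) \<le> (1 / r ^ (2 * q))\<^sup>2 * (\<integral>w. (f w)\<^sup>2 \<partial>M)\<^sup>2" .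
  qed (use r in auto)
qed

text \<open>A Paley--Zygmund argument: by the fourth moment bound, half of the second moment of \<open>f\<close> is
  carried by any event of probability close to 1, in particular by the event \<open>\<bar>f\<bar> \<le> e\<close>.\<close>

lemma chaos_comb_small_second_moment:
  "\<exists>\<delta>>0. \<forall>(M :: 'w measure) (V :: 'i \<Rightarrow> 'w \<Rightarrow> real) B f e. iid_normal M V B \<longrightarrow> f \<in> chaos_comb V (indices_upto B q) \<longrightarrow>
    measure M {w \<in> space M. \<bar>f w\<bar> > e} \<le> \<delta> \<longrightarrow> (\<integral>w. (f w)\<^sup>2 \<partial>M) \<le> 2 * e\<^sup>2"
proof -
  obtain K where K: "K > 0" and K4: "\<And>(M :: 'w measure) (V :: 'i \<Rightarrow> 'w \<Rightarrow> real) B f. iid_normal M V B \<Longrightarrow>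
    f \<in> chaos_comb V (indices_upto B q) \<Longrightarrow> (\<integral>w. f w ^ 4 \<partial>M) \<le> K * (\<integral>w. (f w)\<^sup>2 \<partial>M)\<^sup>2"
    using chaos_comb_fourth_moment[of q, where 'w = 'w and 'i = 'i] by blast
  show ?thesis
  proof (intro exI[of _ "1 / (4 * K)"] conjI allI impI)
    fix M :: "'w measure" and V :: "'i \<Rightarrow> 'w \<Rightarrow> real" and B f e
    assume V: "iid_normal M V B" and f: "f \<in> chaos_comb V (indices_upto B q)"
      and P: "measure M {w \<in> space M. \<bar>f w\<bar> > e} \<le> 1 / (4 * K)"
    interpret prob_space M using V by (simp add: iid_normal_def)
    have mom: "has_moments M f" by (rule chaos_comb_has_moments[OF V f indices_upto_finite_indices])
    have [measurable]: "f \<in> borel_measurable M" using mom by (rule has_moments_measurable)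
    have i2: "integrable M (\<lambda>w. (f w)\<^sup>2)" and i4: "integrable M (\<lambda>w. f w ^ 4)"
      using mom by (auto intro: has_moments_power_integrable)
    define m where "m = (\<integral>w. (f w)\<^sup>2 \<partial>M)"
    let ?S = "{w \<in> space M. \<bar>f w\<bar> > e}"
    show "m \<le> 2 * e\<^sup>2"
    proof (cases "m > 0")
      case True
      \<comment> \<open>With this weight the fourth moment term and the probability term are each at
        most m/4, given the threshold 1/(4K). Together they give m <= e^2 + m/2.\<close>
      define t where "t = 1 / (2 * K * m)"
      have t: "t > 0" using K True by (simp add: t_def)
      have pw: "(f w)\<^sup>2 \<le> e\<^sup>2 + (t / 2 * f w ^ 4 + 1 / (2 * t) * indicator ?S w)" if "w \<in> space M" for w
      proof (cases "\<bar>f w\<bar> > e")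
        case True
        have "0 \<le> (t * (f w)\<^sup>2 - 1)\<^sup>2 / (2 * t)" using t by simp
        also have "\<dots> = t / 2 * f w ^ 4 + 1 / (2 * t) - (f w)\<^sup>2"
          using t by (simp add: power2_eq_square power4_eq_xxxx field_simps)
        finally have "(f w)\<^sup>2 \<le> e\<^sup>2 + (t / 2 * f w ^ 4 + 1 / (2 * t))"
          using zero_le_power2[of e] by linarith
        then show ?thesis using True that by simp
      next
        case False
        then have "(f w)\<^sup>2 \<le> e\<^sup>2" using power_mono[of "\<bar>f w\<bar>" e 2] by simp
        moreover have "0 \<le> t / 2 * f w ^ 4" using t by simp
        ultimately show ?thesis using False by simp
      qed
      have iS: "integrable M (indicator ?S :: _ \<Rightarrow> real)"
        by (rule integrable_const_bound[of _ 1]) auto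
      have "m \<le> (\<integral>w. e\<^sup>2 + (t / 2 * f w ^ 4 + 1 / (2 * t) * indicator ?S w) \<partial>M)"
        unfolding m_def using i2 i4 pw iS
        by (intro integral_mono Bochner_Integration.integrable_add integrable_mult_right integrable_const) auto
      also have "\<dots> = e\<^sup>2 + (t / 2 * (\<integral>w. f w ^ 4 \<partial>M) + 1 / (2 * t) * prob ?S)"
        using i4 iS by (simp add: prob_space)
      also have "\<dots> \<le> e\<^sup>2 + (t / 2 * (K * m\<^sup>2) + 1 / (2 * t) * (1 / (4 * K)))"
        using K4[OF V f] P t unfolding m_def by (intro add_mono mult_left_mono) auto
      also have "\<dots> = e\<^sup>2 + m / 2"
        using K True by (simp add: t_def power2_eq_square field_simps)
      finally show ?thesis by simp
    next
      case False
      then show ?thesis using zero_le_power2[of e] by linarith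
    qed
  qed (use K in auto)
qed

lemma (in prob_space) AE_convergent_in_probability:
  assumes f: "\<And>n. f n \<in> borel_measurable M" and conv: "AE w in M. convergent (\<lambda>n. f n w :: real)" and e: "e > 0" and d: "d > 0"
  shows "\<exists>N. \<forall>m\<ge>N. \<forall>n\<ge>N. prob {w \<in> space M. \<bar>f m w - f n w\<bar> > e} \<le> d"
proof -
  note [measurable] = f
  define u where "u w = lim (\<lambda>n. f n w)" for w
  have [measurable]: "u \<in> borel_measurable M" unfolding u_def[abs_def] by (rule borel_measurable_lim_metric) (rule f)
  have lim: "AE w in M. (\<lambda>n. f n w) \<longlonglongrightarrow> u w" using conv by eventually_elim (simp add: convergent_LIMSEQ_iff u_def)
  let ?S = "\<lambda>n. {w \<in> space M. \<bar>f n w - u w\<bar> > e / 2}"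
  have "(\<lambda>n. \<integral>w. indicator (?S n) w \<partial>M) \<longlonglongrightarrow> (\<integral>w. 0 \<partial>M :: real)"
  proof (rule integral_dominated_convergence[where w = "\<lambda>_. 1"])
    show "AE w in M. (\<lambda>n. indicator (?S n) w :: real) \<longlonglongrightarrow> 0"
      using lim
    proof eventually_elim
      fix w assume "(\<lambda>n. f n w) \<longlonglongrightarrow> u w"
      then have "\<forall>\<^sub>F n in sequentially. dist (f n w) (u w) < e / 2" using e by (intro tendstoD) auto
      then show "(\<lambda>n. indicator (?S n) w :: real) \<longlonglongrightarrow> 0"
        by (intro tendsto_eventually) (auto elim!: eventually_mono simp: dist_real_def indicator_def)
    qed
  qed auto
  then have "(\<lambda>n. prob (?S n)) \<longlonglongrightarrow> 0" by simp
  then have "\<forall>\<^sub>F n in sequentially. prob (?S n) < d / 2" using d by (intro order_tendstoD) auto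
  then obtain N where N: "\<And>n. n \<ge> N \<Longrightarrow> prob (?S n) < d / 2" by (auto simp: eventually_sequentially)
  show ?thesis
  proof (intro exI[of _ N] allI impI)
    fix m n assume mn: "m \<ge> N" "n \<ge> N"
    have "prob {w \<in> space M. \<bar>f m w - f n w\<bar> > e} \<le> prob (?S m \<union> ?S n)"
    proof (intro finite_measure_mono subsetI)
      fix w assume w: "w \<in> {w \<in> space M. \<bar>f m w - f n w\<bar> > e}"
      moreover have "\<bar>f m w - f n w\<bar> \<le> \<bar>f m w - u w\<bar> + \<bar>f n w - u w\<bar>" by linarith
      ultimately have "\<bar>f m w - u w\<bar> > e / 2 \<or> \<bar>f n w - u w\<bar> > e / 2" by auto
      then show "w \<in> ?S m \<union> ?S n" using w by auto
    qed measurable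
    also have "\<dots> \<le> prob (?S m) + prob (?S n)" by (intro measure_Un_le) auto
    finally show "prob {w \<in> space M. \<bar>f m w - f n w\<bar> > e} \<le> d" using N[OF mn(1)] N[OF mn(2)] by simp
  qed
qed

text \<open>Differences of the sequence again have degree at most q, so one threshold d serves all
  of them, and almost sure convergence makes the probability of a large difference fall below it.
  The level sqrt(e/2) is chosen so that twice its square is e.\<close>

lemma chaos_comb_L2_Cauchy:
  assumes V: "iid_normal M V B" and f: "\<And>n::nat. f n \<in> chaos_comb V (indices_upto B q)"
    and conv: "AE w in M. convergent (\<lambda>n. f n w)" and e: "e > 0"
  shows "\<exists>N. \<forall>m\<ge>N. \<forall>n\<ge>N. (\<integral>w. (f m w - f n w)\<^sup>2 \<partial>M) \<le> e"
proof -
  interpret prob_space M using V by (simp add: iid_normal_def)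
  obtain d where d: "d > 0" and d2: "\<forall>(M :: 'a measure) (V :: 'b \<Rightarrow> 'a \<Rightarrow> real) B f e. iid_normal M V B \<longrightarrow>
      f \<in> chaos_comb V (indices_upto B q) \<longrightarrow> measure M {w \<in> space M. \<bar>f w\<bar> > e} \<le> d \<longrightarrow> (\<integral>w. (f w)\<^sup>2 \<partial>M) \<le> 2 * e\<^sup>2"
    using chaos_comb_small_second_moment[of q, where 'w = 'a and 'i = 'b] by blast
  note small = d2[rule_format, OF V]
  have fm: "f n \<in> borel_measurable M" for n
    by (rule has_moments_measurable[OF chaos_comb_has_moments[OF V f indices_upto_finite_indices]])
  obtain N where N: "\<And>m n. m \<ge> N \<Longrightarrow> n \<ge> N \<Longrightarrow> prob {w \<in> space M. \<bar>f m w - f n w\<bar> > sqrt (e / 2)} \<le> d"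
    using AE_convergent_in_probability[OF fm conv, of "sqrt (e / 2)" d] e d by auto
  have "(\<integral>w. (f m w - f n w)\<^sup>2 \<partial>M) \<le> e" if "m \<ge> N" "n \<ge> N" for m n
    using small[OF chaos_comb_diff[OF f f] N[OF that]] e by simp
  then show ?thesis by blast
qed

text \<open>The mean of f m - f n is its inner product with the constant 1 and is controlled by the
  \<open>L\<^sup>2\<close> norm; exchanging m and n gives the absolute value. The lemma will be
  applied to the independent copy for one frozen sample point at a time.\<close>

lemma chaos_comb_integral_convergent:
  assumes V: "iid_normal M V B" and f: "\<And>n::nat. f n \<in> chaos_comb V (indices_upto B q)"
    and conv: "AE w in M. convergent (\<lambda>n. f n w)"
  shows "convergent (\<lambda>n. \<integral>w. f n w \<partial>M)"
proof -
  interpret prob_space M using V by (simp add: iid_normal_def)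
  have mom: "has_moments M (f n)" for n
    by (rule chaos_comb_has_moments[OF V f indices_upto_finite_indices])
  have "Cauchy (\<lambda>n. \<integral>w. f n w \<partial>M)"
  proof (rule metric_CauchyI)
    fix e :: real assume e: "e > 0"
    then obtain N where N: "\<And>m n. m \<ge> N \<Longrightarrow> n \<ge> N \<Longrightarrow> (\<integral>w. (f m w - f n w)\<^sup>2 \<partial>M) \<le> (e / 2)\<^sup>2"
      using chaos_comb_L2_Cauchy[OF V f conv, of "(e / 2)\<^sup>2"] by auto
    show "\<exists>N. \<forall>m\<ge>N. \<forall>n\<ge>N. dist (\<integral>w. f m w \<partial>M) (\<integral>w. f n w \<partial>M) < e"
    proof (intro exI[of _ N] allI impI)
      fix m n assume mn: "m \<ge> N" "n \<ge> N"
      have "(\<integral>w. f k w - f l w \<partial>M) \<le> e / 2" if "k \<ge> N" "l \<ge> N" for k l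
        using integral_mult_le_of_squares[of "\<lambda>w. f k w - f l w" M "\<lambda>_. 1" "e / 2" 1]
          N[OF that] has_moments_diff[OF mom[of k] mom[of l]] e
        by (simp add: prob_space has_moments_measurable has_moments_power_integrable)
      note bnd = this
      have df: "(\<integral>w. f k w - f l w \<partial>M) = (\<integral>w. f k w \<partial>M) - (\<integral>w. f l w \<partial>M)" for k l
        by (intro Bochner_Integration.integral_diff has_moments_integrable[OF mom])
      have "\<bar>(\<integral>w. f m w \<partial>M) - (\<integral>w. f n w \<partial>M)\<bar> \<le> e / 2"
        using bnd[OF mn] bnd[OF mn(2,1)] unfolding df abs_le_iff by linarith
      then show "dist (\<integral>w. f m w \<partial>M) (\<integral>w. f n w \<partial>M) < e" using e by (simp add: dist_real_def)
    qed
  qed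
  then show ?thesis by (rule Cauchy_convergent)
qed

section \<open>Chaos elements of the rotated process\<close>

lemma chaos_elem_cong:
  "(\<And>e. a e \<noteq> 0 \<Longrightarrow> V e w = V' e w') \<Longrightarrow> chaos_elem V a w = chaos_elem V' a w'"
  by (simp add: chaos_elem_def)

lemma chaos_comb_mult_hnorm:
  assumes f: "f \<in> chaos_comb V (indices_upto E p)" and e: "e \<notin> E"
  shows "(\<lambda>w. hnorm i (V e w) * f w) \<in> chaos_comb V (indices_upto (insert e E) (i + p))"
proof -
  obtain A c where A: "finite A" "A \<subseteq> indices_upto E p" "f = (\<lambda>w. \<Sum>a\<in>A. c a * chaos_elem V a w)"
    using f by (auto simp: chaos_comb_def)
  have 1: "a(e := i) \<in> indices_upto (insert e E) (i + p) \<and> chaos_elem V (a(e := i)) w = hnorm i (V e w) * chaos_elem V a w"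
    if a: "a \<in> A" for a w
  proof
    let ?S = "{d. a d \<noteq> 0}"
    obtain p' where p': "p' \<le> p" "a \<in> multi_indices E p'" using a A(2) by (auto simp: indices_upto_def)
    then have S: "finite ?S" "?S \<subseteq> E" "e \<notin> ?S" using e by (auto simp: multi_indices_def)
    \<comment> \<open>Only an inclusion holds, because for \<open>i = 0\<close> the new index does
      not enter the support; sums and products over the larger set are unchanged.\<close>
    have S': "{d. (a(e := i)) d \<noteq> 0} \<subseteq> insert e ?S" by auto
    then have fin: "finite {d. (a(e := i)) d \<noteq> 0}" using S(1) by (meson finite.insertI finite_subset)
    have "(\<Sum>d\<in>{d. (a(e := i)) d \<noteq> 0}. (a(e := i)) d) = (\<Sum>d\<in>insert e ?S. (a(e := i)) d)"
      by (rule sum.mono_neutral_left) (use S S' in auto)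
    also have "\<dots> = i + (\<Sum>d\<in>?S. a d)"
      using S by (subst sum.insert) (auto intro!: sum.cong)
    also have "(\<Sum>d\<in>?S. a d) = p'" using p' by (simp add: multi_indices_def)
    finally have "a(e := i) \<in> multi_indices (insert e E) (i + p')"
      using fin S' S by (auto simp: multi_indices_def)
    then show "a(e := i) \<in> indices_upto (insert e E) (i + p)"
      using p'(1) unfolding indices_upto_def by (intro UN_I[of "i + p'"]) auto
    have "chaos_elem V (a(e := i)) w = (\<Prod>d\<in>insert e ?S. hnorm ((a(e := i)) d) (V d w))"
      by (rule chaos_elem_prod) (use S S' in auto)
    also have "\<dots> = hnorm i (V e w) * (\<Prod>d\<in>?S. hnorm (a d) (V d w))"
      using S by (subst prod.insert) (auto intro!: prod.cong)
    also have "(\<Prod>d\<in>?S. hnorm (a d) (V d w)) = chaos_elem V a w"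
      by (rule chaos_elem_prod[symmetric]) (use S in auto)
    finally show "chaos_elem V (a(e := i)) w = hnorm i (V e w) * chaos_elem V a w" .
  qed
  have "(\<lambda>w. hnorm i (V e w) * f w) = (\<lambda>w. \<Sum>a\<in>A. c a * chaos_elem V (a(e := i)) w)"
    unfolding A(3) sum_distrib_left
    by (intro ext sum.cong refl) (simp only: conjunct2[OF 1] mult_ac)
  also have "\<dots> \<in> chaos_comb V (indices_upto (insert e E) (i + p))"
    by (intro chaos_comb_sum chaos_comb_cmult chaos_comb_elem conjunct1[OF 1])
  finally show ?thesis .
qed

lemma indices_upto_mono: "p \<le> q \<Longrightarrow> E \<subseteq> B \<Longrightarrow> indices_upto E p \<subseteq> indices_upto B q"
  by (fastforce simp: indices_upto_def multi_indices_def)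

text \<open>For fixed numbers \<open>x e\<close>, the factor in coordinate \<open>e\<close> is a
  polynomial of degree at most \<open>a e\<close> in \<open>V e\<close>, hence a combination of
  Hermite polynomials of that degree or lower. The shift creates lower degrees, so the product lies
  in the sum of the chaoses up to the total degree and not in a single one.\<close>

lemma prod_hnorm_affine_comb:
  assumes "finite E"
  shows "(\<lambda>w. \<Prod>e\<in>E. hnorm (a e) (x e + s * V e w)) \<in> chaos_comb V (indices_upto E (\<Sum>e\<in>E. a e))"
  using assms
proof (induction E rule: finite_induct)
  case empty
  have "(\<lambda>_. 0) \<in> indices_upto {} 0" by (auto simp: indices_upto_def multi_indices_def)
  moreover have "chaos_elem V (\<lambda>_. 0) = (\<lambda>_. 1)" by (simp add: chaos_elem_def fun_eq_iff)
  ultimately show ?case using chaos_comb_elem[of "\<lambda>_. 0" "indices_upto {} 0" V] by simp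
next
  case (insert e E)
  let ?f = "\<lambda>w. \<Prod>e\<in>E. hnorm (a e) (x e + s * V e w)"
  let ?Q = "pcompose (smult (1 / sqrt (fact (a e))) (hpoly (a e))) [:x e, s:]"
  have "degree ?Q \<le> degree (smult (1 / sqrt (fact (a e))) (hpoly (a e))) * degree [:x e, s:]"
    by (rule degree_pcompose_le)
  also have "\<dots> \<le> a e"
    using degree_hpoly[of "a e"] by auto
  finally obtain b where b: "\<And>y. poly ?Q y = (\<Sum>i\<le>a e. b i * hnorm i y)"
    using poly_hnorm_expansion by blast
  have "hnorm (a e) (x e + s * y) = (\<Sum>i\<le>a e. b i * hnorm i y)" for y
    unfolding b[symmetric] by (simp add: hnorm_eq_poly poly_pcompose mult.commute)
  then have "(\<lambda>w. \<Prod>e\<in>insert e E. hnorm (a e) (x e + s * V e w)) = (\<lambda>w. \<Sum>i\<le>a e. b i * (hnorm i (V e w) * ?f w))"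
    by (simp only: prod.insert[OF insert.hyps] sum_distrib_right mult.assoc)
  also have "\<dots> \<in> chaos_comb V (indices_upto (insert e E) (\<Sum>e\<in>insert e E. a e))"
  proof (intro chaos_comb_sum chaos_comb_cmult)
    fix i assume "i \<in> {..a e}"
    then have "indices_upto (insert e E) (i + (\<Sum>e\<in>E. a e)) \<subseteq> indices_upto (insert e E) (\<Sum>e\<in>insert e E. a e)"
      using insert.hyps by (intro indices_upto_mono) auto
    with chaos_comb_mult_hnorm[OF insert.IH insert.hyps(2), of i]
    show "(\<lambda>w. hnorm i (V e w) * ?f w) \<in> chaos_comb V (indices_upto (insert e E) (\<Sum>e\<in>insert e E. a e))"
      using chaos_comb_mono by blast
  qed
  finally show ?case .
qed

lemma chaos_elem_affine_comb:
  assumes a: "a \<in> multi_indices B p"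
  shows "chaos_elem (\<lambda>e w. x e + s * V e w) a \<in> chaos_comb V (indices_upto B p)"
proof -
  let ?E = "{e. a e \<noteq> 0}"
  have E: "finite ?E" "?E \<subseteq> B" and p: "(\<Sum>e\<in>?E. a e) = p" using a by (auto simp: multi_indices_def)
  have "chaos_elem (\<lambda>e w. x e + s * V e w) a = (\<lambda>w. \<Prod>e\<in>?E. hnorm (a e) (x e + s * V e w))"
    by (intro ext chaos_elem_prod E(1) subset_refl)
  also have "\<dots> \<in> chaos_comb V (indices_upto ?E (\<Sum>e\<in>?E. a e))"
    by (rule prod_hnorm_affine_comb[OF E(1)])
  also have "\<dots> \<subseteq> chaos_comb V (indices_upto B p)"
    unfolding p by (intro chaos_comb_mono indices_upto_mono E(2) order_refl)
  finally show ?thesis .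
qed

text \<open>With w frozen, independence turns the integral over w' into a product of one-dimensional
  Mehler integrals. The powers of c from the coordinates multiply to the total degree p.\<close>

lemma chaos_elem_mehler:
  assumes V: "iid_normal M V B" and a: "a \<in> multi_indices B p" and cs: "c\<^sup>2 + s\<^sup>2 = (1::real)"
  shows "(\<integral>w'. chaos_elem (\<lambda>e w'. c * V e w + s * V e w') a w' \<partial>M) = c ^ p * chaos_elem V a w"
proof -
  let ?E = "{e. a e \<noteq> 0}"
  have E: "finite ?E" "?E \<subseteq> B" and p: "(\<Sum>e\<in>?E. a e) = p" using a by (auto simp: multi_indices_def)
  have m: "has_moments std_normal_distribution (\<lambda>y. hnorm n (x + s * y))" for n x
    unfolding hnorm_eq_poly
    by (intro N.has_moments_poly has_moments_add N.has_moments_const N.has_moments_cmult has_moments_normal_id)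
  have "(\<integral>w'. chaos_elem (\<lambda>e w'. c * V e w + s * V e w') a w' \<partial>M) =
    (\<integral>w'. (\<Prod>e\<in>?E. hnorm (a e) (c * V e w + s * V e w')) \<partial>M)"
    by (simp only: chaos_elem_prod[OF E(1) subset_refl])
  also have "\<dots> = (\<Prod>e\<in>?E. \<integral>y. hnorm (a e) (c * V e w + s * y) \<partial>std_normal_distribution)"
    using iid_normal_prod_integral(1)[OF V E, of "\<lambda>e y. hnorm (a e) (c * V e w + s * y)"] has_moments_integrable[OF m] by simp
  also have "\<dots> = (\<Prod>e\<in>?E. c ^ a e * hnorm (a e) (V e w))"
    by (simp only: hnorm_mehler[OF cs])
  also have "\<dots> = c ^ p * chaos_elem V a w"
    unfolding chaos_elem_prod[OF E(1) subset_refl] prod.distrib p[symmetric] by (simp add: power_sum)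
  finally show ?thesis .
qed

text \<open>Convergence of the expansions is an event in the product space of coordinate values, and
  both families induce the same law there.\<close>

lemma AE_convergent_transfer:
  assumes V: "iid_normal M V B" and V': "iid_normal M' V' B"
    and A: "\<And>n::nat. A n \<subseteq> finite_indices B"
    and conv: "AE w in M. convergent (\<lambda>n. \<Sum>a\<in>A n. c n a * chaos_elem V a w)"
  shows "AE w in M'. convergent (\<lambda>n. \<Sum>a\<in>A n. c n a * chaos_elem V' a w)"
proof -
  let ?G = "PiM B (\<lambda>_. std_normal_distribution)"
  define h where "h n y = (\<Sum>a\<in>A n. c n a * chaos_elem (\<lambda>e y. y e) a y)" for n and y :: "'b \<Rightarrow> real"
  have hm: "h n \<in> borel_measurable ?G" for n
    unfolding h_def[abs_def]
  proof (intro borel_measurable_sum borel_measurable_times borel_measurable_const)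
    fix a assume "a \<in> A n"
    then have a: "finite {e. a e \<noteq> 0}" "{e. a e \<noteq> 0} \<subseteq> B" using A[of n] by (auto simp: finite_indices_def)
    have *: "chaos_elem (\<lambda>e y. y e) a = (\<lambda>y. \<Prod>d\<in>{e. a e \<noteq> 0}. hnorm (a d) (y d))"
      by (intro ext chaos_elem_prod a(1) subset_refl)
    have "(\<lambda>y. y d) \<in> borel_measurable ?G" if "d \<in> B" for d
      using measurable_component_singleton[OF that, of "\<lambda>_. std_normal_distribution"] by simp
    then show "chaos_elem (\<lambda>e y. y e) a \<in> borel_measurable ?G"
      unfolding * using a by (intro borel_measurable_prod measurable_compose[OF _ hnorm_measurable]) auto
  qed
  \<comment> \<open>Rewriting convergence as the Cauchy property gives a condition measurable
    without reference to a limit.\<close>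
  have S: "{y \<in> space ?G. convergent (\<lambda>n. h n y)} \<in> sets ?G"
    unfolding Cauchy_convergent_iff[symmetric] using hm by (rule sets_Collect_Cauchy)
  have hU: "h n (\<lambda>e\<in>B. U e w) = (\<Sum>a\<in>A n. c n a * chaos_elem U a w)" for n and U :: "'b \<Rightarrow> 'x \<Rightarrow> real" and w
    unfolding h_def
  proof (intro sum.cong refl arg_cong2[where f = "(*)"] chaos_elem_cong)
    fix a e assume "a \<in> A n" "a e \<noteq> 0"
    then have "e \<in> B" using A[of n] by (auto simp: finite_indices_def)
    then show "(\<lambda>e\<in>B. U e w) e = U e w" by simp
  qed
  have m: "(\<lambda>w. \<lambda>e\<in>B. V e w) \<in> measurable M ?G" 
    using iid_normal_measurable[OF V] by (intro measurable_restrict) simp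
  have m': "(\<lambda>w. \<lambda>e\<in>B. V' e w) \<in> measurable M' ?G"
    using iid_normal_measurable[OF V'] by (intro measurable_restrict) simp
  have "AE y in distr M ?G (\<lambda>w. \<lambda>e\<in>B. V e w). convergent (\<lambda>n. h n y)"
    using conv by (subst AE_distr_iff[OF m S]) (simp add: hU)
  then have "AE y in distr M' ?G (\<lambda>w. \<lambda>e\<in>B. V' e w). convergent (\<lambda>n. h n y)"
    unfolding iid_normal_distr[OF V] iid_normal_distr[OF V'] .
  then show ?thesis
    unfolding AE_distr_iff[OF m' S] by (simp add: hU)
qed

text \<open>The step \<open>P(t) - 2\<^sup>q P(t/2)\<close> removes the leading coefficient of a polynomial of degree \<open>q\<close>.\<close>

lemma convergent_coefficients:
  fixes u :: "nat \<Rightarrow> nat \<Rightarrow> real"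
  assumes "\<And>k. convergent (\<lambda>n. \<Sum>p\<le>q. (1 / 2 ^ k) ^ p * u n p)" "p \<le> q"
  shows "convergent (\<lambda>n. u n p)"
  using assms
proof (induction q arbitrary: u p)
  case 0
  then show ?case using "0.prems"(1)[of 0] by simp
next
  case (Suc q)
  have lower: "convergent (\<lambda>n. u n p)" if p: "p \<le> q" for p
  proof -
    \<comment> \<open>The subtraction multiplies the p-th coefficient by
      \<open>1 - 2 ^ (Suc q - p)\<close>: zero for p = \<open>Suc q\<close>, nonzero below. The
      induction hypothesis is therefore used on rescaled coefficients.\<close>
    have "convergent (\<lambda>n. (1 - 2 ^ (Suc q - p)) * u n p)"
    proof (rule Suc.IH[OF _ p])
      fix k
      have "convergent (\<lambda>n. (\<Sum>p\<le>Suc q. (1 / 2 ^ k) ^ p * u n p) - 2 ^ Suc q * (\<Sum>p\<le>Suc q. (1 / 2 ^ Suc k) ^ p * u n p))"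
        by (intro convergent_diff convergent_mult convergent_const Suc.prems(1))
      also have "(\<lambda>n. (\<Sum>p\<le>Suc q. (1 / 2 ^ k) ^ p * u n p) - 2 ^ Suc q * (\<Sum>p\<le>Suc q. (1 / 2 ^ Suc k) ^ p * u n p)) =
        (\<lambda>n. \<Sum>p\<le>q. (1 / 2 ^ k) ^ p * ((1 - 2 ^ (Suc q - p)) * u n p))"
      proof
        fix n
        have "(1 / 2 ^ k) ^ p * u n p - 2 ^ Suc q * ((1 / 2 ^ Suc k) ^ p * u n p) = (1 / 2 ^ k) ^ p * ((1 - 2 ^ (Suc q - p)) * u n p)"
          if "p \<le> Suc q" for p
        proof -
          have "(2::real) ^ Suc q = 2 ^ (Suc q - p) * 2 ^ p" using that by (simp only: power_add[symmetric]) simp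
          moreover have "(1 / 2 ^ Suc k :: real) ^ p = (1 / 2 ^ k) ^ p / 2 ^ p" by (simp add: power_divide power_mult_distrib)
          ultimately show ?thesis by (simp only:) (simp add: algebra_simps)
        qed
        then have "(\<Sum>p\<le>Suc q. (1 / 2 ^ k) ^ p * u n p) - 2 ^ Suc q * (\<Sum>p\<le>Suc q. (1 / 2 ^ Suc k) ^ p * u n p) =
          (\<Sum>p\<le>Suc q. (1 / 2 ^ k) ^ p * ((1 - 2 ^ (Suc q - p)) * u n p))"
          unfolding sum_distrib_left sum_subtractf[symmetric] by (intro sum.cong refl) simp
        then show "(\<Sum>p\<le>Suc q. (1 / 2 ^ k) ^ p * u n p) - 2 ^ Suc q * (\<Sum>p\<le>Suc q. (1 / 2 ^ Suc k) ^ p * u n p) =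
          (\<Sum>p\<le>q. (1 / 2 ^ k) ^ p * ((1 - 2 ^ (Suc q - p)) * u n p))" by simp
      qed
      finally show "convergent (\<lambda>n. \<Sum>p\<le>q. (1 / 2 ^ k) ^ p * ((1 - 2 ^ (Suc q - p)) * u n p))" .
    qed
    moreover have "(1 - 2 ^ (Suc q - p) :: real) \<noteq> 0"
    proof -
      have "(1::real) < 2 ^ (Suc q - p)" using p by (intro one_less_power) auto
      then show ?thesis by linarith
    qed
    ultimately show ?thesis
      using convergent_mult_const_iff[of "1 - 2 ^ (Suc q - p)" "\<lambda>n. u n p"] by blast
  qed
  show ?case
  proof (cases "p \<le> q")
    case False
    then have p: "p = Suc q" using Suc.prems(2) by simp
    have "convergent (\<lambda>n. (\<Sum>p\<le>Suc q. (1 / 2 ^ 0) ^ p * u n p) - (\<Sum>p\<le>q. u n p))"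
      by (intro convergent_diff Suc.prems(1) convergent_sum lower) simp
    then show ?thesis by (simp add: p)
  qed (rule lower)
qed

text \<open>The Ornstein--Uhlenbeck operator, averaging \<open>V'\<close> out of the rotated process \<open>c V + s V'\<close>,
  preserves almost sure convergence and acts on the \<open>p\<close>-th chaos as multiplication by \<open>c\<^sup>p\<close>.\<close>

lemma AE_convergent_components:
  assumes V: "iid_normal M V B" and g: "\<And>n p. p \<le> q \<Longrightarrow> g n p \<in> chaos_span V B p"
    and conv: "AE w in M. convergent (\<lambda>n. \<Sum>p\<le>q. g n p w)"
  shows "AE w in M. \<forall>p\<le>q. convergent (\<lambda>n. g n p w)"
proof -
  interpret prob_space M using V by (simp add: iid_normal_def)
  interpret P: pair_prob_space M M ..
  define Q where "Q n p Ac \<longleftrightarrow> (p \<le> q \<longrightarrow> finite (fst Ac) \<and> fst Ac \<subseteq> multi_indices B p \<and>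
      g n p = (\<lambda>w. \<Sum>a\<in>fst Ac. snd Ac a * chaos_elem V a w))" for n p Ac
  have "\<exists>Ac. Q n p Ac" for n p
  proof (cases "p \<le> q")
    case True
    then obtain A c where "finite A" "A \<subseteq> multi_indices B p" "g n p = (\<lambda>w. \<Sum>a\<in>A. c a * chaos_elem V a w)"
      using g[OF True, of n] unfolding chaos_span_def by blast
    then have "Q n p (A, c)" by (simp add: Q_def)
    then show ?thesis by blast
  qed (simp add: Q_def)
  then obtain Ac where Ac: "\<And>n p. Q n p (Ac n p)" by metis
  define A where "A n p = fst (Ac n p)" for n p
  define c where "c n p = snd (Ac n p)" for n p
  have A: "\<And>n p. p \<le> q \<Longrightarrow> finite (A n p)" "\<And>n p. p \<le> q \<Longrightarrow> A n p \<subseteq> multi_indices B p"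
    and geq: "\<And>n p. p \<le> q \<Longrightarrow> g n p = (\<lambda>w. \<Sum>a\<in>A n p. c n p a * chaos_elem V a w)"
    using Ac unfolding Q_def A_def c_def by blast+
  define D where "D n = (\<Union>p\<le>q. A n p)" for n
  \<comment> \<open>The q + 1 expansions are merged into one, as the transfer lemma expects. The
    degree of an index tells which chaos it came from, so the index sets are disjoint and the
    coefficients can be recovered.\<close>
  define d where "d n a = c n (\<Sum>e\<in>{e. a e \<noteq> 0}. a e) a" for n a
  have deg: "(\<Sum>e\<in>{e. a e \<noteq> 0}. a e) = p" if "a \<in> A n p" "p \<le> q" for a n p
    using A(2)[of p n] that by (auto simp: multi_indices_def)
  have D: "D n \<subseteq> finite_indices B" for n
    using A(2)[of _ n] multi_indices_finite_indices[of B] unfolding D_def by blast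
  have Dsum: "(\<Sum>a\<in>D n. d n a * x a) = (\<Sum>p\<le>q. \<Sum>a\<in>A n p. c n p a * x a)" for n and x :: "_ \<Rightarrow> real"
  proof -
    have "(\<Sum>a\<in>D n. d n a * x a) = (\<Sum>p\<le>q. \<Sum>a\<in>A n p. d n a * x a)"
      unfolding D_def by (rule sum.UNION_disjoint) (use A(1) deg in \<open>auto, metis\<close>)
    also have "\<dots> = (\<Sum>p\<le>q. \<Sum>a\<in>A n p. c n p a * x a)"
    proof (intro sum.cong refl)
      fix p a assume "p \<in> {..q}" "a \<in> A n p"
      then show "d n a * x a = c n p a * x a" using deg[of a n p] by (simp add: d_def)
    qed
    finally show ?thesis .
  qed
  have step: "AE w in M. convergent (\<lambda>n. \<Sum>p\<le>q. (1 / 2 ^ k) ^ p * g n p w)" for k :: nat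
  proof -
    define r where "r = (1 / 2 ^ k :: real)"
    define s where "s = sqrt (1 - r\<^sup>2)"
    have "r\<^sup>2 \<le> 1\<^sup>2" unfolding r_def by (intro power_mono) auto
    then have rs: "r\<^sup>2 + s\<^sup>2 = 1" by (simp add: s_def)
    have "AE w in M. convergent (\<lambda>n. \<Sum>a\<in>D n. d n a * chaos_elem V a w)"
    proof -
      have "(\<Sum>p\<le>q. g n p w) = (\<Sum>a\<in>D n. d n a * chaos_elem V a w)" for n w
        unfolding Dsum by (intro sum.cong refl) (simp add: geq)
      then show ?thesis using conv by simp
    qed
    from AE_convergent_transfer[OF V iid_normal_rotate[OF V rs] D this]
    have "AE z in M \<Otimes>\<^sub>M M. convergent (\<lambda>n. \<Sum>a\<in>D n. d n a * chaos_elem (\<lambda>e z. r * V e (fst z) + s * V e (snd z)) a z)" .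
    then have "AE w in M. AE w' in M. convergent (\<lambda>n. \<Sum>a\<in>D n. d n a * chaos_elem (\<lambda>e z. r * V e (fst z) + s * V e (snd z)) a (w, w'))"
      by (rule P.AE_pair)
    then show ?thesis
    proof eventually_elim
      fix w
      \<comment> \<open>From here on w is frozen outside a null set and \<open>f n\<close> is a
        function of the independent copy alone.\<close>
      define f where "f n w' = (\<Sum>p\<le>q. \<Sum>a\<in>A n p. c n p a * chaos_elem (\<lambda>e w'. r * V e w + s * V e w') a w')" for n w'
      assume "AE w' in M. convergent (\<lambda>n. \<Sum>a\<in>D n. d n a * chaos_elem (\<lambda>e z. r * V e (fst z) + s * V e (snd z)) a (w, w'))"
      moreover have "(\<Sum>a\<in>D n. d n a * chaos_elem (\<lambda>e z. r * V e (fst z) + s * V e (snd z)) a (w, w')) = f n w'" for n w'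
        unfolding Dsum f_def by (intro sum.cong refl arg_cong2[where f = "(*)"] chaos_elem_cong) simp
      ultimately have fc: "AE w' in M. convergent (\<lambda>n. f n w')" by simp
      have elem: "chaos_elem (\<lambda>e w'. r * V e w + s * V e w') a \<in> chaos_comb V (indices_upto B q)"
        if "p \<le> q" "a \<in> A n p" for n p a
        using chaos_elem_affine_comb[of a B p "\<lambda>e. r * V e w" s V] A(2)[of p n] that
          chaos_comb_mono[OF indices_upto_mono[OF that(1) subset_refl[of B]], of V] by blast
      have f: "f n \<in> chaos_comb V (indices_upto B q)" for n
        unfolding f_def by (intro chaos_comb_sum chaos_comb_cmult elem) auto
      have "convergent (\<lambda>n. \<integral>w'. f n w' \<partial>M)"
        by (rule chaos_comb_integral_convergent[OF V f fc])
      also have "(\<lambda>n. \<integral>w'. f n w' \<partial>M) = (\<lambda>n. \<Sum>p\<le>q. r ^ p * g n p w)"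
      proof
        fix n
        have i: "integrable M (chaos_elem (\<lambda>e w'. r * V e w + s * V e w') a)" if "p \<le> q" "a \<in> A n p" for p a
          by (rule has_moments_integrable[OF chaos_comb_has_moments[OF V elem[OF that] indices_upto_finite_indices]])
        have "(\<integral>w'. f n w' \<partial>M) = (\<Sum>p\<le>q. \<integral>w'. (\<Sum>a\<in>A n p. c n p a * chaos_elem (\<lambda>e w'. r * V e w + s * V e w') a w') \<partial>M)"
          unfolding f_def using i by (intro Bochner_Integration.integral_sum Bochner_Integration.integrable_sum integrable_mult_right) auto
        also have "\<dots> = (\<Sum>p\<le>q. \<Sum>a\<in>A n p. \<integral>w'. c n p a * chaos_elem (\<lambda>e w'. r * V e w + s * V e w') a w' \<partial>M)"
          using i by (intro sum.cong refl Bochner_Integration.integral_sum integrable_mult_right) auto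
        also have "\<dots> = (\<Sum>p\<le>q. \<Sum>a\<in>A n p. c n p a * (r ^ p * chaos_elem V a w))"
        proof (intro sum.cong refl)
          fix p a assume "p \<in> {..q}" "a \<in> A n p"
          then have "a \<in> multi_indices B p" using A(2)[of p n] by auto
          then show "(\<integral>w'. c n p a * chaos_elem (\<lambda>e w'. r * V e w + s * V e w') a w' \<partial>M) = c n p a * (r ^ p * chaos_elem V a w)"
            using chaos_elem_mehler[OF V _ rs] by simp
        qed
        also have "\<dots> = (\<Sum>p\<le>q. r ^ p * g n p w)"
          by (intro sum.cong refl) (simp add: geq sum_distrib_left mult_ac)
        finally show "(\<integral>w'. f n w' \<partial>M) = (\<Sum>p\<le>q. r ^ p * g n p w)" .
      qed
      finally show "convergent (\<lambda>n. \<Sum>p\<le>q. (1 / 2 ^ k) ^ p * g n p w)" unfolding r_def .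
    qed
  qed
  then have "AE w in M. \<forall>k::nat. convergent (\<lambda>n. \<Sum>p\<le>q. (1 / 2 ^ k) ^ p * g n p w)"
    by (simp add: AE_all_countable)
  then show ?thesis
  proof eventually_elim
    fix w assume "\<forall>k::nat. convergent (\<lambda>n. \<Sum>p\<le>q. (1 / 2 ^ k) ^ p * g n p w)"
    then show "\<forall>p\<le>q. convergent (\<lambda>n. g n p w)"
      using convergent_coefficients[where q = q and u = "\<lambda>n p. g n p w"] by blast
  qed
qed

subsection \<open>Passage to the closed chaoses\<close>

lemma L2_diff_integrable:
  fixes f g :: "'w \<Rightarrow> real"
  assumes [measurable]: "f \<in> borel_measurable M" "g \<in> borel_measurable M"
    and f: "integrable M (\<lambda>w. (f w)\<^sup>2)" and g: "integrable M (\<lambda>w. (g w)\<^sup>2)"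
  shows "integrable M (\<lambda>w. (f w - g w)\<^sup>2)"
    and "(\<integral>w. (f w - g w)\<^sup>2 \<partial>M) \<le> 2 * (\<integral>w. (f w)\<^sup>2 \<partial>M) + 2 * (\<integral>w. (g w)\<^sup>2 \<partial>M)"
proof -
  have fg: "integrable M (\<lambda>w. f w * g w)" by (rule L2_mult_integrable) (use assms in auto)
  then show i: "integrable M (\<lambda>w. (f w - g w)\<^sup>2)" using f g by (simp add: power2_diff mult.assoc)
  have "(\<integral>w. (f w - g w)\<^sup>2 \<partial>M) \<le> (\<integral>w. 2 * (f w)\<^sup>2 + 2 * (g w)\<^sup>2 \<partial>M)"
  proof (rule integral_mono[OF i])
    show "(f w - g w)\<^sup>2 \<le> 2 * (f w)\<^sup>2 + 2 * (g w)\<^sup>2" for w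
      using zero_le_power2[of "f w + g w"] unfolding power2_sum power2_diff by linarith
  qed (use f g in auto)
  also have "\<dots> = 2 * (\<integral>w. (f w)\<^sup>2 \<partial>M) + 2 * (\<integral>w. (g w)\<^sup>2 \<partial>M)" using f g by simp
  finally show "(\<integral>w. (f w - g w)\<^sup>2 \<partial>M) \<le> 2 * (\<integral>w. (f w)\<^sup>2 \<partial>M) + 2 * (\<integral>w. (g w)\<^sup>2 \<partial>M)" .
qed

lemma L2_mult_tendsto_zero:
  fixes f :: "nat \<Rightarrow> 'w \<Rightarrow> real"
  assumes f: "\<And>k. f k \<in> borel_measurable M" "\<And>k. integrable M (\<lambda>w. (f k w)\<^sup>2)"
    and g: "g \<in> borel_measurable M" "integrable M (\<lambda>w. (g w)\<^sup>2)"
    and lim: "(\<lambda>k. \<integral>w. (f k w)\<^sup>2 \<partial>M) \<longlonglongrightarrow> 0"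
  shows "(\<lambda>k. \<integral>w. f k w * g w \<partial>M) \<longlonglongrightarrow> 0"
proof (rule Lim_null_comparison)
  let ?b = "\<lambda>k. sqrt (\<integral>w. (f k w)\<^sup>2 \<partial>M) * sqrt (\<integral>w. (g w)\<^sup>2 \<partial>M)"
  have "norm (\<integral>w. f k w * g w \<partial>M) \<le> ?b k" for k
  proof -
    have "(\<integral>w. (t * f k w) * g w \<partial>M) \<le> ?b k" if "t\<^sup>2 = 1" for t
      by (rule integral_mult_le_of_squares) (use f g that in \<open>auto simp: power_mult_distrib\<close>)
    from this[of 1] this[of "-1"] show ?thesis by (simp add: abs_le_iff)
  qed
  then show "\<forall>\<^sub>F k in sequentially. norm (\<integral>w. f k w * g w \<partial>M) \<le> ?b k" by simp
  have "?b \<longlonglongrightarrow> sqrt 0 * sqrt (\<integral>w. (g w)\<^sup>2 \<partial>M)" by (intro tendsto_intros lim)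
  then show "?b \<longlonglongrightarrow> 0" by simp
qed

lemma chaos_span_moments:
  "iid_normal M V B \<Longrightarrow> Y \<in> chaos_span V B p \<Longrightarrow> has_moments M Y"
  unfolding chaos_span_eq_comb by (rule chaos_comb_has_moments[OF _ _ multi_indices_finite_indices])

lemma chaos_span_L2:
  assumes "iid_normal M V B" "Y \<in> chaos_span V B p"
  shows "Y \<in> borel_measurable M" "integrable M (\<lambda>w. (Y w)\<^sup>2)"
  using chaos_span_moments[OF assms] by (auto intro: has_moments_measurable has_moments_power_integrable)

lemma chaos_span_orthogonal:
  assumes V: "iid_normal M V B" and Y: "Y \<in> chaos_span V B p" and Z: "Z \<in> chaos_span V B r" and pr: "p \<noteq> r"
  shows "(\<integral>w. Y w * Z w \<partial>M) = 0"
proof -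
  obtain A c where A: "finite A" "A \<subseteq> multi_indices B p" "Y = (\<lambda>w. \<Sum>a\<in>A. c a * chaos_elem V a w)"
    using Y by (auto simp: chaos_span_def)
  obtain A' d where A': "finite A'" "A' \<subseteq> multi_indices B r" "Z = (\<lambda>w. \<Sum>a\<in>A'. d a * chaos_elem V a w)"
    using Z by (auto simp: chaos_span_def)
  have "A \<inter> A' = {}" using A(2) A'(2) pr by (auto simp: multi_indices_def)
  moreover have "(\<integral>w. Y w * Z w \<partial>M) = (\<Sum>a\<in>A \<inter> A'. c a * d a)"
    unfolding A(3) A'(3) using A A' multi_indices_finite_indices by (intro chaos_comb_inner[OF V]) blast+
  ultimately show ?thesis by simp
qed

section \<open>Orthogonality and projections for the closed chaoses\<close>

lemma wiener_chaos_L2: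
  assumes "X \<in> wiener_chaos M V B p"
  shows "X \<in> borel_measurable M" "integrable M (\<lambda>w. (X w)\<^sup>2)"
  using assms by (auto simp: wiener_chaos_def)

lemma wiener_chaos_diff:
  assumes V: "iid_normal M V B" and X: "X \<in> wiener_chaos M V B p" and Y: "Y \<in> wiener_chaos M V B p"
  shows "(\<lambda>w. X w - Y w) \<in> wiener_chaos M V B p"
proof -
  obtain x where x: "\<And>k. x k \<in> chaos_span V B p" "(\<lambda>k. \<integral>w. (X w - x k w)\<^sup>2 \<partial>M) \<longlonglongrightarrow> 0"
    using X by (auto simp: wiener_chaos_def)
  obtain y where y: "\<And>k. y k \<in> chaos_span V B p" "(\<lambda>k. \<integral>w. (Y w - y k w)\<^sup>2 \<partial>M) \<longlonglongrightarrow> 0"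
    using Y by (auto simp: wiener_chaos_def)
  note L2 = wiener_chaos_L2[OF X] wiener_chaos_L2[OF Y] chaos_span_L2[OF V x(1)] chaos_span_L2[OF V y(1)]
  have sp: "(\<lambda>w. x k w - y k w) \<in> chaos_span V B p" for k
    using x(1) y(1) unfolding chaos_span_eq_comb by (intro chaos_comb_diff)
  have bnd: "(\<integral>w. ((X w - Y w) - (x k w - y k w))\<^sup>2 \<partial>M) \<le>
      2 * (\<integral>w. (X w - x k w)\<^sup>2 \<partial>M) + 2 * (\<integral>w. (Y w - y k w)\<^sup>2 \<partial>M)" for k
  proof -
    have eq: "(X w - Y w) - (x k w - y k w) = (X w - x k w) - (Y w - y k w)" for w by simp
    show ?thesis
      unfolding eq by (rule L2_diff_integrable(2)) (use L2 in \<open>auto intro!: L2_diff_integrable(1)\<close>)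
  qed
  have "(\<lambda>k. \<integral>w. ((X w - Y w) - (x k w - y k w))\<^sup>2 \<partial>M) \<longlonglongrightarrow> 0"
  proof (rule tendsto_sandwich[OF _ _ tendsto_const])
    show "(\<lambda>k. 2 * (\<integral>w. (X w - x k w)\<^sup>2 \<partial>M) + 2 * (\<integral>w. (Y w - y k w)\<^sup>2 \<partial>M)) \<longlonglongrightarrow> 0"
      using tendsto_add[OF tendsto_mult[OF tendsto_const[of 2] x(2)] tendsto_mult[OF tendsto_const[of 2] y(2)]] by simp
  qed (use bnd in auto)
  then show ?thesis
    unfolding wiener_chaos_def using L2 sp L2_diff_integrable(1)[of X M Y]
    by (auto intro!: borel_measurable_diff exI[of _ "\<lambda>k w. x k w - y k w"])
qed

text \<open>Orthogonality of the spans is passed to the \<open>L\<^sup>2\<close> limit in one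
  argument at a time: \<open>half\<close> is used once to replace a span element by \<open>Z\<close>
  and once more to replace the other by \<open>X\<close>.\<close>

lemma wiener_chaos_orthogonal:
  assumes V: "iid_normal M V B" and X: "X \<in> wiener_chaos M V B p" and Z: "Z \<in> wiener_chaos M V B r" and pr: "p \<noteq> r"
  shows "(\<integral>w. X w * Z w \<partial>M) = 0"
proof -
  have half: "(\<integral>w. X w * Y w \<partial>M) = 0"
    if X: "X \<in> wiener_chaos M V B p" and Y: "Y \<in> borel_measurable M" "integrable M (\<lambda>w. (Y w)\<^sup>2)"
      and orth: "\<And>x. x \<in> chaos_span V B p \<Longrightarrow> (\<integral>w. x w * Y w \<partial>M) = 0" for X Y p
  proof -
    obtain x where x: "\<And>k. x k \<in> chaos_span V B p" "(\<lambda>k. \<integral>w. (X w - x k w)\<^sup>2 \<partial>M) \<longlonglongrightarrow> 0"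
      using X by (auto simp: wiener_chaos_def)
    note L2 = wiener_chaos_L2[OF X] chaos_span_L2[OF V x(1)]
    have "(\<lambda>k. \<integral>w. (X w - x k w) * Y w \<partial>M) \<longlonglongrightarrow> 0"
      by (rule L2_mult_tendsto_zero) (use L2 Y x(2) in \<open>auto intro!: L2_diff_integrable(1)\<close>)
    moreover have "(\<integral>w. (X w - x k w) * Y w \<partial>M) = (\<integral>w. X w * Y w \<partial>M)" for k
    proof -
      have "integrable M (\<lambda>w. X w * Y w)" "integrable M (\<lambda>w. x k w * Y w)"
        using L2 Y by (auto intro!: L2_mult_integrable)
      then show ?thesis using orth[OF x(1)] by (simp add: left_diff_distrib)
    qed
    ultimately show ?thesis by (simp add: LIMSEQ_const_iff)
  qed
  show ?thesis
  proof (rule half[OF X wiener_chaos_L2[OF Z]])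
    fix x assume x: "x \<in> chaos_span V B p"
    have "(\<integral>w. Z w * x w \<partial>M) = 0"
      by (rule half[OF Z chaos_span_L2[OF V x]]) (use chaos_span_orthogonal[OF V _ x] pr in auto)
    then show "(\<integral>w. x w * Z w \<partial>M) = 0" by (simp add: mult.commute)
  qed
qed

text \<open>Orthogonality reduces inner products of \<open>X\<close> with the p-th chaos to those of
  \<open>Xs p\<close>, so \<open>Xs p\<close> is a witness for the choice in
  \<open>chaos_proj\<close>. The chosen representative differs from \<open>Xs p\<close> by an
  element of the chaos that is orthogonal to itself, hence almost surely zero.\<close>

lemma chaos_proj_component:
  assumes V: "iid_normal M V B" and X: "X \<in> borel_measurable M"
    and Xs: "\<And>r. r \<le> q \<Longrightarrow> Xs r \<in> wiener_chaos M V B r" and eq: "AE w in M. X w = (\<Sum>r\<le>q. Xs r w)" and p: "p \<le> q"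
  shows "AE w in M. chaos_proj M V B p X w = Xs p w"
proof -
  have inner: "(\<integral>w. (X w - Y w) * Z w \<partial>M) = (\<integral>w. (Xs p w - Y w) * Z w \<partial>M)"
    if Y: "Y \<in> wiener_chaos M V B p" and Z: "Z \<in> wiener_chaos M V B p" for Y Z
  proof -
    note L2 = wiener_chaos_L2[OF Y] wiener_chaos_L2[OF Z]
    have i: "integrable M (\<lambda>w. Xs r w * Z w)" if "r \<le> q" for r
      using wiener_chaos_L2[OF Xs[OF that]] L2 by (intro L2_mult_integrable) auto
    have i': "integrable M (\<lambda>w. (Xs p w - Y w) * Z w)"
      using i[OF p] L2_mult_integrable[OF L2(1,3,2,4)] by (simp add: left_diff_distrib)
    have "(\<integral>w. (X w - Y w) * Z w \<partial>M) = (\<integral>w. (\<Sum>r\<in>{..q} - {p}. Xs r w * Z w) + (Xs p w - Y w) * Z w \<partial>M)"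
    proof (rule integral_cong_AE)
      show "AE w in M. (X w - Y w) * Z w = (\<Sum>r\<in>{..q} - {p}. Xs r w * Z w) + (Xs p w - Y w) * Z w"
        using eq
      proof eventually_elim
        fix w assume "X w = (\<Sum>r\<le>q. Xs r w)"
        also have "\<dots> = Xs p w + (\<Sum>r\<in>{..q} - {p}. Xs r w)" using p by (intro sum.remove) auto
        finally show "(X w - Y w) * Z w = (\<Sum>r\<in>{..q} - {p}. Xs r w * Z w) + (Xs p w - Y w) * Z w"
          by (simp add: algebra_simps sum_distrib_left)
      qed
      show "(\<lambda>w. (\<Sum>r\<in>{..q} - {p}. Xs r w * Z w) + (Xs p w - Y w) * Z w) \<in> borel_measurable M"
        using i i' by (intro borel_measurable_add borel_measurable_sum) auto
    qed (use X L2 in \<open>auto intro!: borel_measurable_times borel_measurable_diff\<close>)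
    also have "\<dots> = (\<Sum>r\<in>{..q} - {p}. \<integral>w. Xs r w * Z w \<partial>M) + (\<integral>w. (Xs p w - Y w) * Z w \<partial>M)"
      using i i' by (subst Bochner_Integration.integral_add) (auto intro!: Bochner_Integration.integral_sum)
    also have "(\<Sum>r\<in>{..q} - {p}. \<integral>w. Xs r w * Z w \<partial>M) = 0"
      using wiener_chaos_orthogonal[OF V Xs Z] by (intro sum.neutral) auto
    finally show ?thesis by simp
  qed
  define Y where "Y = chaos_proj M V B p X"
  have "Y \<in> wiener_chaos M V B p \<and> (\<forall>Z\<in>wiener_chaos M V B p. (\<integral>w. (X w - Y w) * Z w \<partial>M) = 0)"
    unfolding Y_def chaos_proj_def
    by (rule someI[of _ "Xs p"]) (use Xs p inner[OF Xs[OF p]] in auto)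
  then have Y: "Y \<in> wiener_chaos M V B p" and Y0: "\<And>Z. Z \<in> wiener_chaos M V B p \<Longrightarrow> (\<integral>w. (X w - Y w) * Z w \<partial>M) = 0"
    by auto
  have D: "(\<lambda>w. Xs p w - Y w) \<in> wiener_chaos M V B p" by (rule wiener_chaos_diff[OF V Xs[OF p] Y])
  have "(\<integral>w. (Xs p w - Y w)\<^sup>2 \<partial>M) = 0"
    using Y0[OF D] unfolding inner[OF Y D] by (simp add: power2_eq_square)
  then have "AE w in M. (Xs p w - Y w)\<^sup>2 = 0"
    by (subst integral_nonneg_eq_0_iff_AE[symmetric]) (use wiener_chaos_L2(2)[OF D] in auto)
  then show ?thesis unfolding Y_def by (rule eventually_mono) simp
qed

text \<open>The expectation of the sum of all squares is dominated by a geometric series, so the sum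
  is finite almost surely and its terms tend to zero. This gives the full sequence rather than a
  subsequence.\<close>

lemma AE_tendsto_zero_of_L2_summable:
  fixes h :: "nat \<Rightarrow> 'w \<Rightarrow> real"
  assumes h [measurable]: "\<And>n. h n \<in> borel_measurable M" and i: "\<And>n. integrable M (\<lambda>w. (h n w)\<^sup>2)"
    and b: "\<And>n. (\<integral>w. (h n w)\<^sup>2 \<partial>M) \<le> (1 / 2) ^ n"
  shows "AE w in M. (\<lambda>n. h n w) \<longlonglongrightarrow> 0"
proof -
  have "(\<integral>\<^sup>+w. (\<Sum>n. ennreal ((h n w)\<^sup>2)) \<partial>M) = (\<Sum>n. \<integral>\<^sup>+w. ennreal ((h n w)\<^sup>2) \<partial>M)"
    by (rule nn_integral_suminf) measurable
  also have "\<dots> = (\<Sum>n. ennreal (\<integral>w. (h n w)\<^sup>2 \<partial>M))"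
    using i by (subst nn_integral_eq_integral) auto
  also have "\<dots> \<le> (\<Sum>n. ennreal ((1 / 2) ^ n))"
    using b by (intro suminf_le ennreal_leI) auto
  also have "\<dots> < top"
    by (subst suminf_ennreal2) (auto intro!: summable_geometric)
  finally have "(\<integral>\<^sup>+w. (\<Sum>n. ennreal ((h n w)\<^sup>2)) \<partial>M) \<noteq> \<infinity>" by simp
  then have "AE w in M. (\<Sum>n. ennreal ((h n w)\<^sup>2)) \<noteq> \<infinity>"
    by (intro nn_integral_PInf_AE) measurable
  then show ?thesis
  proof eventually_elim
    fix w assume "(\<Sum>n. ennreal ((h n w)\<^sup>2)) \<noteq> \<infinity>"
    then have "summable (\<lambda>n. (h n w)\<^sup>2)" by (intro summable_suminf_not_top) auto
    then have "(\<lambda>n. (h n w)\<^sup>2) \<longlonglongrightarrow> 0" by (rule summable_LIMSEQ_zero)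
    then have "(\<lambda>n. sqrt ((h n w)\<^sup>2)) \<longlonglongrightarrow> sqrt 0" by (rule tendsto_real_sqrt)
    then show "(\<lambda>n. h n w) \<longlonglongrightarrow> 0" by (simp add: tendsto_rabs_zero_iff)
  qed
qed

text \<open>Square integrability of \<open>G\<close> is part of the claim. Since the sequence is
  Cauchy in \<open>L\<^sup>2\<close>, Fatou's lemma in m bounds the second moment of G - g n by e
  for large n; this gives both integrability and convergence, and \<open>g\<close> itself is the
  approximating sequence required by \<open>wiener_chaos\<close>.\<close>

lemma wiener_chaos_AE_limit:
  assumes V: "iid_normal M V B" and g: "\<And>n. g n \<in> chaos_span V B p"
    and G [measurable]: "G \<in> borel_measurable M" and lim: "AE w in M. (\<lambda>n. g n w) \<longlonglongrightarrow> G w"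
  shows "G \<in> wiener_chaos M V B p"
proof -
  have gm [measurable]: "g n \<in> borel_measurable M" for n using chaos_span_L2[OF V g] by simp
  have g2: "integrable M (\<lambda>w. (g n w)\<^sup>2)" for n using chaos_span_L2[OF V g] by simp
  have gu: "g n \<in> chaos_comb V (indices_upto B p)" for n
    using g[of n] chaos_comb_mono[OF multi_indices_upto[OF order_refl]] unfolding chaos_span_eq_comb by blast
  have conv: "AE w in M. convergent (\<lambda>n. g n w)" using lim by eventually_elim (auto simp: convergent_def)
  have fatou: "\<exists>N. \<forall>n\<ge>N. integrable M (\<lambda>w. (G w - g n w)\<^sup>2) \<and> (\<integral>w. (G w - g n w)\<^sup>2 \<partial>M) \<le> e" if e: "e > 0" for e
  proof -
    obtain N where N: "\<And>m n. m \<ge> N \<Longrightarrow> n \<ge> N \<Longrightarrow> (\<integral>w. (g m w - g n w)\<^sup>2 \<partial>M) \<le> e"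
      using chaos_comb_L2_Cauchy[OF V gu conv e] by blast
    have "integrable M (\<lambda>w. (G w - g n w)\<^sup>2) \<and> (\<integral>w. (G w - g n w)\<^sup>2 \<partial>M) \<le> e" if n: "n \<ge> N" for n
    proof -
      have "(\<integral>\<^sup>+w. ennreal ((G w - g n w)\<^sup>2) \<partial>M) = (\<integral>\<^sup>+w. liminf (\<lambda>m. ennreal ((g m w - g n w)\<^sup>2)) \<partial>M)"
      proof (rule nn_integral_cong_AE)
        show "AE w in M. ennreal ((G w - g n w)\<^sup>2) = liminf (\<lambda>m. ennreal ((g m w - g n w)\<^sup>2))"
          using lim
        proof eventually_elim
          fix w assume "(\<lambda>n. g n w) \<longlonglongrightarrow> G w"
          then have "(\<lambda>m. ennreal ((g m w - g n w)\<^sup>2)) \<longlonglongrightarrow> ennreal ((G w - g n w)\<^sup>2)"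
            by (intro tendsto_ennrealI tendsto_intros)
          then show "ennreal ((G w - g n w)\<^sup>2) = liminf (\<lambda>m. ennreal ((g m w - g n w)\<^sup>2))"
            by (rule lim_imp_Liminf[symmetric, OF sequentially_bot])
        qed
      qed
      also have "\<dots> \<le> liminf (\<lambda>m. \<integral>\<^sup>+w. ennreal ((g m w - g n w)\<^sup>2) \<partial>M)"
        by (rule nn_integral_liminf) measurable
      also have "\<dots> \<le> limsup (\<lambda>m. \<integral>\<^sup>+w. ennreal ((g m w - g n w)\<^sup>2) \<partial>M)"
        by (rule Liminf_le_Limsup) simp
      also have "\<dots> \<le> ennreal e"
      proof (rule Limsup_bounded)
        show "\<forall>\<^sub>F m in sequentially. (\<integral>\<^sup>+w. ennreal ((g m w - g n w)\<^sup>2) \<partial>M) \<le> ennreal e"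
          using eventually_ge_at_top[of N]
        proof eventually_elim
          fix m assume "m \<ge> N"
          then show "(\<integral>\<^sup>+w. ennreal ((g m w - g n w)\<^sup>2) \<partial>M) \<le> ennreal e"
            using N[of m n] n L2_diff_integrable(1)[OF gm gm g2 g2]
            by (subst nn_integral_eq_integral) (auto intro: ennreal_leI)
        qed
      qed
      finally have le: "(\<integral>\<^sup>+w. ennreal ((G w - g n w)\<^sup>2) \<partial>M) \<le> ennreal e" .
      then have i: "integrable M (\<lambda>w. (G w - g n w)\<^sup>2)"
        by (intro integrableI_bounded) (auto simp: top_unique less_top[symmetric])
      then show ?thesis
        using le e by (subst (asm) nn_integral_eq_integral) auto
    qed
    then show ?thesis by blast
  qed
  obtain n where n: "integrable M (\<lambda>w. (G w - g n w)\<^sup>2)" using fatou[of 1] by auto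
  have "integrable M (\<lambda>w. ((G w - g n w) - (- g n w))\<^sup>2)"
    by (rule L2_diff_integrable(1)) (use n g2[of n] in auto)
  then have "integrable M (\<lambda>w. (G w)\<^sup>2)" by simp
  moreover have "(\<lambda>n. \<integral>w. (G w - g n w)\<^sup>2 \<partial>M) \<longlonglongrightarrow> 0"
  proof (rule LIMSEQ_I)
    fix r :: real assume "r > 0"
    then obtain N where N: "\<And>n. n \<ge> N \<Longrightarrow> (\<integral>w. (G w - g n w)\<^sup>2 \<partial>M) \<le> r / 2" using fatou[of "r / 2"] by auto
    show "\<exists>N. \<forall>n\<ge>N. norm ((\<integral>w. (G w - g n w)\<^sup>2 \<partial>M) - 0) < r"
    proof (intro exI[of _ N] allI impI)
      fix n assume "n \<ge> N"
      moreover have "0 \<le> (\<integral>w. (G w - g n w)\<^sup>2 \<partial>M)" by (rule Bochner_Integration.integral_nonneg) simp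
      ultimately show "norm ((\<integral>w. (G w - g n w)\<^sup>2 \<partial>M) - 0) < r" using N[of n] \<open>r > 0\<close> by simp
    qed
  qed
  ultimately show ?thesis unfolding wiener_chaos_def using g by auto
qed

theorem theorem1p1:
  fixes M :: "'w measure"
    and W :: "'h::{real_inner, complete_space} \<Rightarrow> 'w \<Rightarrow> real"
    and B :: "'h set"
    and q :: nat
    and Fs :: "nat \<Rightarrow> 'w \<Rightarrow> real"
    and F :: "'w \<Rightarrow> real"
  assumes "prob_space M"
    and "isonormal M W"
    and "countable_onb B"
    and "q \<ge> 2"
    and "\<forall>n. Fs n \<in> chaos_upto M W B q"
    and "F \<in> borel_measurable M"
    and "AE w in M. (\<lambda>n. Fs n w) \<longlonglongrightarrow> F w"
  shows "F \<in> chaos_upto M W B q \<and>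
    (\<forall>p\<le>q. AE w in M. (\<lambda>n. chaos_proj M W B p (Fs n) w) \<longlonglongrightarrow> chaos_proj M W B p F w)"
proof -
  have V: "iid_normal M W B" by (rule isonormal_iid_normal) (use assms in auto)
  have Fm: "Fs n \<in> borel_measurable M" for n using assms(5) by (auto simp: chaos_upto_def)
  have "\<forall>n. \<exists>Xs. (\<forall>p\<le>q. Xs p \<in> wiener_chaos M W B p) \<and> (AE w in M. Fs n w = (\<Sum>p\<le>q. Xs p w))"
    using assms(5) by (auto simp: chaos_upto_def)
  then obtain Xs where Xs: "\<And>n p. p \<le> q \<Longrightarrow> Xs n p \<in> wiener_chaos M W B p"
    and FX: "\<And>n. AE w in M. Fs n w = (\<Sum>p\<le>q. Xs n p w)" by metis
  \<comment> \<open>The tolerance shrinks with n so that the squared errors are summable over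
    n.\<close>
  define Q where "Q n p g \<longleftrightarrow> (p \<le> q \<longrightarrow> g \<in> chaos_span W B p \<and> (\<integral>w. (Xs n p w - g w)\<^sup>2 \<partial>M) \<le> (1 / 2) ^ n)" for n p g
  have "\<exists>g. Q n p g" for n p
  proof (cases "p \<le> q")
    case True
    then obtain Y where Y: "\<And>k. Y k \<in> chaos_span W B p" "(\<lambda>k. \<integral>w. (Xs n p w - Y k w)\<^sup>2 \<partial>M) \<longlonglongrightarrow> 0"
      using Xs[OF True, of n] by (auto simp: wiener_chaos_def)
    have "\<forall>\<^sub>F k in sequentially. (\<integral>w. (Xs n p w - Y k w)\<^sup>2 \<partial>M) < (1 / 2) ^ n"
      using Y(2) by (rule order_tendstoD) simp
    then obtain k where "(\<integral>w. (Xs n p w - Y k w)\<^sup>2 \<partial>M) < (1 / 2) ^ n"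
      by (auto simp: eventually_sequentially)
    then show ?thesis using Y(1)[of k] unfolding Q_def by (intro exI[of _ "Y k"]) simp
  qed (simp add: Q_def)
  then obtain g where Qg: "\<And>n p. Q n p (g n p)" by metis
  then have g: "\<And>n p. p \<le> q \<Longrightarrow> g n p \<in> chaos_span W B p"
    and gX: "\<And>n p. p \<le> q \<Longrightarrow> (\<integral>w. (Xs n p w - g n p w)\<^sup>2 \<partial>M) \<le> (1 / 2) ^ n"
    unfolding Q_def by blast+
  have diff0: "AE w in M. \<forall>p\<in>{..q}. (\<lambda>n. Xs n p w - g n p w) \<longlonglongrightarrow> 0"
  proof (rule AE_finite_allI)
    fix p assume "p \<in> {..q}"
    then have p: "p \<le> q" by simp
    note L2 = wiener_chaos_L2[OF Xs[OF p]] chaos_span_L2[OF V g[OF p]]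
    show "AE w in M. (\<lambda>n. Xs n p w - g n p w) \<longlonglongrightarrow> 0"
      by (rule AE_tendsto_zero_of_L2_summable) (use L2 gX[OF p] in \<open>auto intro!: L2_diff_integrable(1)\<close>)
  qed simp
  have FXall: "AE w in M. \<forall>n. Fs n w = (\<Sum>p\<le>q. Xs n p w)" using FX by (simp add: AE_all_countable)
  have sumlim: "AE w in M. (\<lambda>n. \<Sum>p\<le>q. g n p w) \<longlonglongrightarrow> F w"
    using diff0 FXall assms(7)
  proof eventually_elim
    fix w assume 1: "\<forall>p\<in>{..q}. (\<lambda>n. Xs n p w - g n p w) \<longlonglongrightarrow> 0" and 2: "\<forall>n. Fs n w = (\<Sum>p\<le>q. Xs n p w)"
      and 3: "(\<lambda>n. Fs n w) \<longlonglongrightarrow> F w"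
    have "(\<lambda>n. Fs n w - (\<Sum>p\<le>q. Xs n p w - g n p w)) \<longlonglongrightarrow> F w - (\<Sum>p\<le>q. 0)"
      by (intro tendsto_diff 3 tendsto_sum) (use 1 in auto)
    then show "(\<lambda>n. \<Sum>p\<le>q. g n p w) \<longlonglongrightarrow> F w" using 2 by (simp add: sum_subtractf)
  qed
  then have "AE w in M. convergent (\<lambda>n. \<Sum>p\<le>q. g n p w)"
    by eventually_elim (auto simp: convergent_def)
  from AE_convergent_components[OF V g this]
  have conv: "AE w in M. \<forall>p\<le>q. convergent (\<lambda>n. g n p w)" .
  \<comment> \<open>\<open>lim\<close> yields some value at every point, and a measurable function;
    off the convergence set, a null set, the value is irrelevant.\<close>
  define G where "G p w = lim (\<lambda>n. g n p w)" for p w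
  have glim: "AE w in M. \<forall>p\<le>q. (\<lambda>n. g n p w) \<longlonglongrightarrow> G p w"
    using conv by eventually_elim (simp add: convergent_LIMSEQ_iff G_def)
  have Gm: "G p \<in> borel_measurable M" if "p \<le> q" for p
    unfolding G_def[abs_def] using chaos_span_L2(1)[OF V g[OF that]] by (rule borel_measurable_lim_metric)
  have G: "G p \<in> wiener_chaos M W B p" if p: "p \<le> q" for p
    by (rule wiener_chaos_AE_limit[OF V g[OF p] Gm[OF p]]) (use glim p in \<open>auto elim!: eventually_mono\<close>)
  have FG: "AE w in M. F w = (\<Sum>p\<le>q. G p w)"
    using sumlim glim
  proof eventually_elim
    fix w assume 1: "(\<lambda>n. \<Sum>p\<le>q. g n p w) \<longlonglongrightarrow> F w" and 2: "\<forall>p\<le>q. (\<lambda>n. g n p w) \<longlonglongrightarrow> G p w"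
    have "(\<lambda>n. \<Sum>p\<le>q. g n p w) \<longlonglongrightarrow> (\<Sum>p\<le>q. G p w)" by (intro tendsto_sum) (use 2 in auto)
    with 1 show "F w = (\<Sum>p\<le>q. G p w)" by (rule LIMSEQ_unique)
  qed
  show ?thesis
  proof (intro conjI allI impI)
    show "F \<in> chaos_upto M W B q" unfolding chaos_upto_def using assms(6) G FG by auto
    fix p assume p: "p \<le> q"
    have "AE w in M. \<forall>n. chaos_proj M W B p (Fs n) w = Xs n p w"
      unfolding AE_all_countable using chaos_proj_component[OF V Fm Xs FX p] by blast
    moreover have "AE w in M. chaos_proj M W B p F w = G p w"
      by (rule chaos_proj_component[OF V assms(6) G FG p])
    ultimately show "AE w in M. (\<lambda>n. chaos_proj M W B p (Fs n) w) \<longlonglongrightarrow> chaos_proj M W B p F w"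
      using diff0 glim
    proof eventually_elim
      fix w assume 1: "\<forall>n. chaos_proj M W B p (Fs n) w = Xs n p w" and 2: "chaos_proj M W B p F w = G p w"
        and 3: "\<forall>p\<in>{..q}. (\<lambda>n. Xs n p w - g n p w) \<longlonglongrightarrow> 0" and 4: "\<forall>p\<le>q. (\<lambda>n. g n p w) \<longlonglongrightarrow> G p w"
      have "(\<lambda>n. (Xs n p w - g n p w) + g n p w) \<longlonglongrightarrow> 0 + G p w"
        by (intro tendsto_add) (use 3 4 p in auto)
      then show "(\<lambda>n. chaos_proj M W B p (Fs n) w) \<longlonglongrightarrow> chaos_proj M W B p F w" using 1 2 by simp
    qed
  qed
qed

end
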